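(* Let $n\ge2$. The restricted Jordan locus ${\rm Jo}_{\bf 1}(2,\mathbb{S}^n)$ is a variety with $\lfloor n/2\rfloor$ irreducible components $V_i$, for integers $1\le i\le n/2$. The component $V_i$ has codimension $\binom{i+1}{2}+\binom{n-i+1}{2}-2$ in ${\rm Gr}_{\bf 1}(2,\mathbb{S}^n)\cong\mathbb{P}^{\binom{n+1}{2}-2}$. It is parametrized by diagonalizable matrices that have two distinct eigenvalues of multiplicities $i$ and $n-i$; that is, $V_i$ is the Zariski closure of the set of pencils $\mathbb{C}\{{\bf 1}_n,X\}$ with $X\in\mathbb{S}^n$ such a matrix. (These latter pencils, as Jordan algebras with unit ${\bf 1}_n$, are isomorphic to $\mathbb{C}\times\mathbb{C}$.)
   Context: $\mathbb{S}^n$ is the space of symmetric $n\times n$ matrices over $\mathbb{C}$, and ${\bf 1}_n$ is the identity matrix. ${\rm Gr}_{\bf 1}(2,\mathbb{S}^n)$ is the set of $2$-dimensional subspaces $\mathcal{L}\subset\mathbb{S}^n$ containing ${\bf 1}_n$. Each such $\mathcal{L}$ is $\mathbb{C}\{{\bf 1}_n,X\}$ with $\operatorname{trace}(X)=0$, which identifies ${\rm Gr}_{\bf 1}(2,\mathbb{S}^n)$ with the projective space $\mathbb{P}^{\binom{n+1}{2}-2}$ of traceless symmetric matrices. ${\rm Jo}_{\bf 1}(2,\mathbb{S}^n)$ is the subset of those $\mathcal{L}\in{\rm Gr}_{\bf 1}(2,\mathbb{S}^n)$ that are closed under the product $X\bullet Y=\frac12(XY+YX)$ (equivalently, the closure of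 $\{X^{-1}\mid X\in\mathcal{L},\ \det X\ne0\}$ is a linear space). *)

theory Defs
  imports "HOL-Analysis.Analysis" "HOL-Library.Extended_Nat"
begin

section \<open>Complex matrices as a complex vector space\<close>

text \<open>The library only provides the real vector space structure on \<^typ>\<open>complex^'n^'n\<close>.\<close>

definition cscale :: "complex \<Rightarrow> complex^'n^'n \<Rightarrow> complex^'n^'n" where
  "cscale c X = (\<chi> i j. c * X $ i $ j)"

lemma cscale_nth [simp]: "cscale c X $ i $ j = c * X $ i $ j"
  by (simp add: cscale_def)

interpretation cmat: vector_space cscale
  by unfold_locales (simp_all add: vec_eq_iff algebra_simps)

definition symmetric_matrices :: "(complex^'n^'n) set" where
  "symmetric_matrices = {X. transpose X = X}"

definition traceless_symmetric :: "(complex^'n^'n) set" where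
  "traceless_symmetric = {X \<in> symmetric_matrices. trace X = 0}"

definition projective_space :: "(complex^'n^'n) set \<Rightarrow> (complex^'n^'n) set set" where
  "projective_space W = {l. cmat.subspace l \<and> l \<subseteq> W \<and> cmat.dim l = 1}"

section \<open>Pencils and the restricted Jordan locus\<close>

definition restricted_Gr :: "(complex^'n^'n) set set" where
  "restricted_Gr = {L. cmat.subspace L \<and> L \<subseteq> symmetric_matrices \<and> cmat.dim L = 2 \<and> mat 1 \<in> L}"

definition pencil :: "complex^'n^'n \<Rightarrow> (complex^'n^'n) set" where
  "pencil X = cmat.span {mat 1, X}"

definition jordan_prod :: "complex^'n^'n \<Rightarrow> complex^'n^'n \<Rightarrow> complex^'n^'n" where
  "jordan_prod X Y = cscale (1/2) (X ** Y + Y ** X)"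

definition restricted_Jo :: "(complex^'n^'n) set set" where
  "restricted_Jo = {L \<in> restricted_Gr. \<forall>X\<in>L. \<forall>Y\<in>L. jordan_prod X Y \<in> L}"

text \<open>Isomorphism of unital Jordan algebras onto \<open>\<complex> \<times> \<complex>\<close>, whose Jordan product is
  the componentwise product since that algebra is commutative.\<close>

definition jordan_iso_CC :: "(complex^'n^'n) set \<Rightarrow> bool" where
  "jordan_iso_CC L \<longleftrightarrow> (\<exists>\<phi> :: complex^'n^'n \<Rightarrow> complex \<times> complex.
     bij_betw \<phi> L UNIV \<and>
     (\<forall>X\<in>L. \<forall>Y\<in>L. \<phi> (X + Y) = \<phi> X + \<phi> Y) \<and>
     (\<forall>c. \<forall>X\<in>L. \<phi> (cscale c X) = (c * fst (\<phi> X), c * snd (\<phi> X))) \<and>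
     (\<forall>X\<in>L. \<forall>Y\<in>L. \<phi> (jordan_prod X Y) = (fst (\<phi> X) * fst (\<phi> Y), snd (\<phi> X) * snd (\<phi> Y))) \<and>
     \<phi> (mat 1) = (1, 1))"

section \<open>Diagonalizable matrices with two eigenvalues\<close>

definition diagonalizable :: "complex^'n^'n \<Rightarrow> bool" where
  "diagonalizable X \<longleftrightarrow>
     (\<exists>P D :: complex^'n^'n. invertible P \<and> (\<forall>i j. i \<noteq> j \<longrightarrow> D $ i $ j = 0) \<and> X = P ** D ** matrix_inv P)"

definition eigenspace :: "complex^'n^'n \<Rightarrow> complex \<Rightarrow> (complex^'n) set" where
  "eigenspace X a = {v. X *v v = a *s v}"

definition eigenvalues :: "complex^'n^'n \<Rightarrow> complex set" where
  "eigenvalues X = {a. \<exists>v. v \<noteq> 0 \<and> v \<in> eigenspace X a}"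

text \<open>For a diagonalizable matrix algebraic and geometric multiplicities agree; the latter is used.\<close>

definition two_eigenvalues :: "nat \<Rightarrow> complex^'n^'n \<Rightarrow> bool" where
  "two_eigenvalues i X \<longleftrightarrow> diagonalizable X \<and>
     (\<exists>a b. a \<noteq> b \<and> eigenvalues X = {a, b} \<and>
        vec.dim (eigenspace X a) = i \<and> vec.dim (eigenspace X b) = CARD('n) - i)"

definition two_eigenvalue_pencils :: "nat \<Rightarrow> (complex^'n^'n) set set" where
  "two_eigenvalue_pencils i = {pencil X | X. X \<in> symmetric_matrices \<and> two_eigenvalues i X}"

section \<open>The Zariski topology on pencils\<close>

inductive hom_poly :: "nat \<Rightarrow> (complex^'n^'n \<Rightarrow> complex) \<Rightarrow> bool" where
  const: "hom_poly 0 (\<lambda>X. c)"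
| coord: "hom_poly 1 (\<lambda>X. X $ i $ j)"
| add: "hom_poly d f \<Longrightarrow> hom_poly d g \<Longrightarrow> hom_poly d (\<lambda>X. f X + g X)"
| mult: "hom_poly d f \<Longrightarrow> hom_poly e g \<Longrightarrow> hom_poly (d + e) (\<lambda>X. f X * g X)"

text \<open>A pencil \<open>L\<close> corresponds to the point \<^term>\<open>L \<inter> traceless_symmetric\<close> of the
  projective space of traceless symmetric matrices (see \<open>restricted_Gr_bij\<close> below), and closed sets
  are the projective zero sets. Forms in all matrix entries are allowed: their restrictions to
  \<^const>\<open>traceless_symmetric\<close> are precisely the forms on that subspace.\<close>

definition Gr_zeros :: "(complex^'n^'n \<Rightarrow> complex) set \<Rightarrow> (complex^'n^'n) set set" where
  "Gr_zeros F = {L \<in> restricted_Gr. \<forall>f\<in>F. \<forall>X \<in> L \<inter> traceless_symmetric. f X = 0}"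

definition Gr_algebraic :: "(complex^'n^'n) set set \<Rightarrow> bool" where
  "Gr_algebraic Z \<longleftrightarrow> (\<exists>F. (\<forall>f\<in>F. \<exists>d. hom_poly d f) \<and> Z = Gr_zeros F)"

definition Gr_zariski :: "(complex^'n^'n) set topology" where
  "Gr_zariski = topology (\<lambda>U. U \<subseteq> restricted_Gr \<and> Gr_algebraic (restricted_Gr - U))"

definition irreducible_in :: "'a topology \<Rightarrow> 'a set \<Rightarrow> bool" where
  "irreducible_in T S \<longleftrightarrow> S \<subseteq> topspace T \<and> S \<noteq> {} \<and>
     (\<forall>A B. closedin T A \<and> closedin T B \<and> S \<subseteq> A \<union> B \<longrightarrow> S \<subseteq> A \<or> S \<subseteq> B)"

definition irreducible_components :: "'a topology \<Rightarrow> 'a set \<Rightarrow> 'a set set" where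
  "irreducible_components T S = {Z. Z \<subseteq> S \<and> irreducible_in T Z \<and>
     (\<forall>Z'. Z' \<subseteq> S \<and> irreducible_in T Z' \<and> Z \<subseteq> Z' \<longrightarrow> Z' = Z)}"

text \<open>Codimension in the whole space of an irreducible closed set \<open>Z\<close>: the supremum of the lengths
  \<open>m\<close> of chains \<open>Z = c 0 \<subset> c 1 \<subset> \<dots> \<subset> c m\<close> of irreducible closed sets.\<close>

definition codim_in :: "'a topology \<Rightarrow> 'a set \<Rightarrow> enat" where
  "codim_in T Z = Sup {enat m | m. \<exists>c. c 0 = Z \<and>
     (\<forall>k\<le>m. closedin T (c k) \<and> irreducible_in T (c k)) \<and> (\<forall>k<m. c k \<subset> c (Suc k))}"

section \<open>The topology is well defined\<close>

lemma trace_cscale: "trace (cscale c X) = c * trace X"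
  by (simp add: trace_def sum_distrib_left)

lemma pencil_indep:
  fixes X :: "complex^'n^'n"
  assumes "trace X = 0" "X \<noteq> 0"
  shows "cmat.independent {mat 1, X}" "mat 1 \<noteq> X"
proof -
  have ne: "mat 1 \<notin> cmat.span {X}"
  proof
    assume "mat 1 \<in> cmat.span {X}"
    then obtain k where "mat 1 = cscale k X" by (auto simp: cmat.span_singleton)
    then have "trace (mat 1 :: complex^'n^'n) = 0" by (simp add: trace_cscale assms)
    then show False by (simp add: trace_I)
  qed
  then show "mat 1 \<noteq> X" using cmat.span_base[of X "{X}"] by (metis singletonI)
  show "cmat.independent {mat 1, X}"
    using ne assms(2) by (simp add: cmat.independent_insert)
qed

lemma restricted_Gr_line:
  fixes L :: "(complex^'n^'n) set"
  assumes L: "L \<in> restricted_Gr" and X: "X \<in> L" "trace X = 0" "X \<noteq> 0"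
  shows "L = pencil X" "L \<inter> traceless_symmetric = cmat.span {X}"
proof -
  have sL: "cmat.subspace L" and d: "cmat.dim L = 2" and one: "mat 1 \<in> L"
    using L by (auto simp: restricted_Gr_def)
  obtain B where B: "B \<subseteq> L" "cmat.independent B" "L \<subseteq> cmat.span B" "card B = 2"
    using cmat.basis_exists[of L] d by metis
  then have fB: "finite B" using card.infinite by fastforce
  note ind = pencil_indep[OF X(2,3)]
  have sub: "cmat.span {mat 1, X} \<subseteq> L" using sL one X by (intro cmat.span_minimal) auto
  have sup: "Y \<in> cmat.span {mat 1, X}" if "Y \<in> L" for Y
  proof (rule ccontr)
    assume n: "Y \<notin> cmat.span {mat 1, X}"
    then have i: "cmat.independent {Y, mat 1, X}" by (rule cmat.independent_insertI[OF _ ind(1)])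
    have "Y \<notin> {mat 1, X}" using n cmat.span_base by blast
    then have "card {Y, mat 1, X} = 3" using ind by auto
    moreover have "{Y, mat 1, X} \<subseteq> cmat.span B" using that one X B by auto
    ultimately show False using cmat.independent_span_bound[OF fB i] B by simp
  qed
  show "L = pencil X" using sub sup by (auto simp: pencil_def)
  have "Y \<in> cmat.span {X}" if Y: "Y \<in> L" "trace Y = 0" for Y
  proof -
    obtain k where "Y - cscale k (mat 1) \<in> cmat.span {X}"
      using sup[OF Y(1)] cmat.span_breakdown_eq[of Y "mat 1" "{X}"] by blast
    then obtain c where c: "Y - cscale k (mat 1) = cscale c X" by (auto simp: cmat.span_singleton)
    then have "trace (Y - cscale k (mat 1)) = trace (cscale c X)" by simp
    then have "k * of_nat CARD('n) = 0" using Y X by (simp add: trace_sub trace_cscale trace_I)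
    then have "k = 0" by simp
    then show ?thesis using c by (auto simp: cmat.span_singleton)
  qed
  then show "L \<inter> traceless_symmetric = cmat.span {X}"
    using L X sL
    by (auto simp: traceless_symmetric_def restricted_Gr_def cmat.span_singleton trace_cscale
        cmat.subspace_scale)
qed

lemma restricted_Gr_traceless:
  fixes L :: "(complex^'n^'n) set"
  assumes L: "L \<in> restricted_Gr"
  obtains X where "X \<in> L" "trace X = 0" "X \<noteq> 0"
proof -
  have sL: "cmat.subspace L" and d: "cmat.dim L = 2" and one: "mat 1 \<in> L"
    using L by (auto simp: restricted_Gr_def)
  have "\<not> L \<subseteq> cmat.span {mat 1}"
  proof
    assume "L \<subseteq> cmat.span {mat 1}"
    then have "cmat.dim L \<le> card {mat 1 :: complex^'n^'n}" by (intro cmat.dim_le_card) auto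
    then show False using d by simp
  qed
  then obtain Y where Y: "Y \<in> L" "Y \<notin> cmat.span {mat 1}" by blast
  define k where "k = trace Y / of_nat CARD('n)"
  define X where "X = Y - cscale k (mat 1)"
  have "X \<in> L" unfolding X_def using sL one Y by (intro cmat.subspace_diff cmat.subspace_scale)
  moreover have "trace X = 0" by (simp add: X_def trace_sub trace_cscale trace_I k_def)
  moreover have "X \<noteq> 0" using Y by (auto simp: X_def cmat.span_singleton)
  ultimately show ?thesis using that by blast
qed

lemma pencil_in_Gr:
  fixes X :: "complex^'n^'n"
  assumes "X \<in> traceless_symmetric" "X \<noteq> 0"
  shows "pencil X \<in> restricted_Gr"
proof -
  have X: "trace X = 0" "transpose X = X"
    using assms by (auto simp: traceless_symmetric_def symmetric_matrices_def)
  have "cmat.subspace (symmetric_matrices :: (complex^'n^'n) set)"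
    by (auto simp: cmat.subspace_def symmetric_matrices_def transpose_def vec_eq_iff)
  moreover have "transpose (mat 1 :: complex^'n^'n) = mat 1" by simp
  ultimately have "pencil X \<subseteq> symmetric_matrices" unfolding pencil_def using X
    by (intro cmat.span_minimal) (auto simp: symmetric_matrices_def)
  moreover have "cmat.dim (pencil X) = 2" unfolding pencil_def
    using pencil_indep[OF X(1) assms(2)] cmat.dim_span_eq_card_independent by fastforce
  ultimately show ?thesis
    by (auto simp: restricted_Gr_def pencil_def cmat.span_base)
qed

lemma restricted_Gr_bij:
  "bij_betw (\<lambda>L. L \<inter> traceless_symmetric) restricted_Gr (projective_space traceless_symmetric)"
proof (rule bij_betwI')
  fix L M :: "(complex^'n^'n) set"
  assume L: "L \<in> restricted_Gr" and M: "M \<in> restricted_Gr"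
  show "(L \<inter> traceless_symmetric = M \<inter> traceless_symmetric) = (L = M)"
  proof
    assume eq: "L \<inter> traceless_symmetric = M \<inter> traceless_symmetric"
    obtain X where X: "X \<in> L" "trace X = 0" "X \<noteq> 0" using restricted_Gr_traceless[OF L] .
    then have "X \<in> M" using L eq by (auto simp: traceless_symmetric_def restricted_Gr_def)
    then show "L = M" using restricted_Gr_line(1)[OF L X] restricted_Gr_line(1)[OF M _ X(2,3)] by simp
  qed simp
next
  fix L :: "(complex^'n^'n) set"
  assume L: "L \<in> restricted_Gr"
  obtain X where X: "X \<in> L" "trace X = 0" "X \<noteq> 0" using restricted_Gr_traceless[OF L] .
  have "cmat.dim (cmat.span {X}) = 1"
    using X cmat.dim_span_eq_card_independent[of "{X}"] by simp
  then show "L \<inter> traceless_symmetric \<in> projective_space traceless_symmetric"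
    using restricted_Gr_line(2)[OF L X] by (auto simp: projective_space_def)
next
  fix l :: "(complex^'n^'n) set"
  assume l: "l \<in> projective_space traceless_symmetric"
  then have sl: "cmat.subspace l" "l \<subseteq> traceless_symmetric" "cmat.dim l = 1"
    by (auto simp: projective_space_def)
  obtain B where B: "B \<subseteq> l" "cmat.independent B" "l \<subseteq> cmat.span B" "card B = 1"
    using cmat.basis_exists[of l] sl(3) by metis
  then obtain X where BX: "B = {X}" using card_1_singletonE by blast
  have X0: "X \<noteq> 0" and X: "X \<in> traceless_symmetric" using B BX sl cmat.dependent_zero by auto
  have "l = cmat.span {X}" using B BX sl(1) cmat.span_minimal by blast
  moreover have "pencil X \<inter> traceless_symmetric = cmat.span {X}"
    using X X0
    by (intro restricted_Gr_line(2)[OF pencil_in_Gr])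
      (auto simp: pencil_def cmat.span_base traceless_symmetric_def)
  ultimately show "\<exists>L\<in>restricted_Gr. l = L \<inter> traceless_symmetric"
    using pencil_in_Gr[OF X X0] by blast
qed

lemma hom_poly_scale: "hom_poly d f \<Longrightarrow> f (cscale c X) = c ^ d * f X"
  by (induction rule: hom_poly.induct) (simp_all add: algebra_simps power_add)

lemma Gr_zeros_mult:
  fixes F G :: "(complex^'n^'n \<Rightarrow> complex) set"
  assumes F: "\<forall>f\<in>F. \<exists>d. hom_poly d f" and G: "\<forall>f\<in>G. \<exists>d. hom_poly d f"
  shows "Gr_zeros F \<union> Gr_zeros G = Gr_zeros ((\<lambda>(f, g) X. f X * g X) ` (F \<times> G))"
proof
  show "Gr_zeros F \<union> Gr_zeros G \<subseteq> Gr_zeros ((\<lambda>(f, g) X. f X * g X) ` (F \<times> G))"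
    unfolding Gr_zeros_def by fastforce
  show "Gr_zeros ((\<lambda>(f, g) X. f X * g X) ` (F \<times> G)) \<subseteq> Gr_zeros F \<union> Gr_zeros G"
  proof
    fix L assume L: "L \<in> Gr_zeros ((\<lambda>(f, g) X. f X * g X) ` (F \<times> G))"
    then have LG: "L \<in> restricted_Gr" by (simp add: Gr_zeros_def)
    obtain X where X: "X \<in> L" "trace X = 0" "X \<noteq> 0" using restricted_Gr_traceless[OF LG] .
    have sp: "L \<inter> traceless_symmetric = cmat.span {X}" using restricted_Gr_line(2)[OF LG X] .
    show "L \<in> Gr_zeros F \<union> Gr_zeros G"
    proof (rule ccontr)
      assume "L \<notin> Gr_zeros F \<union> Gr_zeros G"
      then obtain f g Y Z where fg: "f \<in> F" "g \<in> G" "f Y \<noteq> 0" "g Z \<noteq> 0"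
        "Y \<in> L \<inter> traceless_symmetric" "Z \<in> L \<inter> traceless_symmetric"
        using LG unfolding Gr_zeros_def by blast
      then obtain y z where yz: "Y = cscale y X" "Z = cscale z X"
        unfolding sp by (auto simp: cmat.span_singleton)
      obtain d e where de: "hom_poly d f" "hom_poly e g" using fg F G by blast
      have "f X \<noteq> 0" "g X \<noteq> 0"
        using fg(3,4) hom_poly_scale[OF de(1), of y X] hom_poly_scale[OF de(2), of z X] yz by auto
      moreover have "f X * g X = 0"
      proof -
        have "X \<in> L \<inter> traceless_symmetric" unfolding sp by (simp add: cmat.span_base)
        moreover have "(\<lambda>X. f X * g X) \<in> (\<lambda>(f, g) X. f X * g X) ` (F \<times> G)"
          using fg(1,2) by (intro image_eqI[of _ _ "(f, g)"]) auto
        moreover have "\<forall>h \<in> (\<lambda>(f, g) X. f X * g X) ` (F \<times> G). \<forall>X \<in> L \<inter> traceless_symmetric. h X = 0"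
          using L unfolding Gr_zeros_def mem_Collect_eq by (rule conjunct2)
        ultimately show ?thesis by (blast dest: bspec)
      qed
      ultimately show False by simp
    qed
  qed
qed

lemma Gr_algebraic_Un: "Gr_algebraic A \<Longrightarrow> Gr_algebraic B \<Longrightarrow> Gr_algebraic (A \<union> B)"
proof -
  assume "Gr_algebraic A" "Gr_algebraic B"
  then obtain F G where F: "\<forall>f\<in>F. \<exists>d. hom_poly d f" "A = Gr_zeros F"
    and G: "\<forall>f\<in>G. \<exists>d. hom_poly d f" "B = Gr_zeros G"
    by (auto simp: Gr_algebraic_def)
  have "\<forall>h \<in> (\<lambda>(f, g) X. f X * g X) ` (F \<times> G). \<exists>d. hom_poly d h"
  proof
    fix h assume "h \<in> (\<lambda>(f, g) X. f X * g X) ` (F \<times> G)"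
    then obtain f g where h: "h = (\<lambda>X. f X * g X)" "f \<in> F" "g \<in> G" by auto
    then obtain d e where "hom_poly d f" "hom_poly e g" using F G by blast
    then show "\<exists>d. hom_poly d h" unfolding h using hom_poly.mult by blast
  qed
  moreover have "A \<union> B = Gr_zeros ((\<lambda>(f, g) X. f X * g X) ` (F \<times> G))"
    using Gr_zeros_mult[OF F(1) G(1)] F(2) G(2) by simp
  ultimately show ?thesis unfolding Gr_algebraic_def by blast
qed

lemma Gr_algebraic_Inter:
  assumes "\<And>A. A \<in> \<A> \<Longrightarrow> Gr_algebraic A"
  shows "Gr_algebraic (restricted_Gr \<inter> \<Inter>\<A>)"
proof -
  obtain F where F: "\<And>A. A \<in> \<A> \<Longrightarrow> (\<forall>f\<in>F A. \<exists>d. hom_poly d f) \<and> A = Gr_zeros (F A)"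
    using assms unfolding Gr_algebraic_def by metis
  have "restricted_Gr \<inter> \<Inter>\<A> = Gr_zeros (\<Union>(F ` \<A>))"
  proof (intro equalityI subsetI)
    fix L assume "L \<in> restricted_Gr \<inter> \<Inter>\<A>"
    then have "L \<in> restricted_Gr" and mem: "\<And>A. A \<in> \<A> \<Longrightarrow> L \<in> A" by auto
    moreover have "L \<in> Gr_zeros (F A)" if "A \<in> \<A>" for A using mem[OF that] F[OF that] by metis
    ultimately show "L \<in> Gr_zeros (\<Union>(F ` \<A>))" by (auto simp: Gr_zeros_def)
  next
    fix L assume L: "L \<in> Gr_zeros (\<Union>(F ` \<A>))"
    then have "L \<in> Gr_zeros (F A)" if "A \<in> \<A>" for A using that by (auto simp: Gr_zeros_def)
    then have "L \<in> A" if "A \<in> \<A>" for A using that F[OF that] by metis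
    then show "L \<in> restricted_Gr \<inter> \<Inter>\<A>" using L by (auto simp: Gr_zeros_def)
  qed
  moreover have "\<forall>f \<in> \<Union>(F ` \<A>). \<exists>d. hom_poly d f"
  proof
    fix f assume "f \<in> \<Union>(F ` \<A>)"
    then obtain A where "A \<in> \<A>" "f \<in> F A" by blast
    then show "\<exists>d. hom_poly d f" using F[of A] by blast
  qed
  ultimately show ?thesis unfolding Gr_algebraic_def by blast
qed

lemma istopology_Gr_zariski:
  "istopology (\<lambda>U. U \<subseteq> restricted_Gr \<and> Gr_algebraic (restricted_Gr - U))"
  unfolding istopology_def
proof (intro conjI allI impI)
  fix S T :: "(complex^'n^'n) set set"
  assume S: "S \<subseteq> restricted_Gr \<and> Gr_algebraic (restricted_Gr - S)"
    and T: "T \<subseteq> restricted_Gr \<and> Gr_algebraic (restricted_Gr - T)"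
  show "S \<inter> T \<subseteq> restricted_Gr" using S by blast
  have "restricted_Gr - S \<inter> T = (restricted_Gr - S) \<union> (restricted_Gr - T)" by blast
  then show "Gr_algebraic (restricted_Gr - S \<inter> T)"
    using Gr_algebraic_Un[OF conjunct2[OF S] conjunct2[OF T]] by (simp only:)
next
  fix K :: "(complex^'n^'n) set set set"
  assume K: "\<forall>U\<in>K. U \<subseteq> restricted_Gr \<and> Gr_algebraic (restricted_Gr - U)"
  then show "\<Union>K \<subseteq> restricted_Gr" by blast
  have "restricted_Gr - \<Union>K = restricted_Gr \<inter> \<Inter>((\<lambda>U. restricted_Gr - U) ` K)" by blast
  moreover have "Gr_algebraic (restricted_Gr \<inter> \<Inter>((\<lambda>U. restricted_Gr - U) ` K))"
  proof (rule Gr_algebraic_Inter)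
    fix A assume "A \<in> (\<lambda>U. restricted_Gr - U) ` K"
    then obtain U where "U \<in> K" "A = restricted_Gr - U" by blast
    then show "Gr_algebraic A" using K by simp
  qed
  ultimately show "Gr_algebraic (restricted_Gr - \<Union>K)" by (simp only:)
qed

lemma openin_Gr_zariski:
  "openin Gr_zariski U \<longleftrightarrow> U \<subseteq> restricted_Gr \<and> Gr_algebraic (restricted_Gr - U)"
  by (simp add: Gr_zariski_def topology_inverse'[OF istopology_Gr_zariski])

lemma topspace_Gr_zariski: "topspace Gr_zariski = restricted_Gr"
proof -
  have "Gr_zeros {\<lambda>X. 1} = {}"
  proof -
    have "0 \<in> L \<inter> traceless_symmetric" if "L \<in> restricted_Gr" for L :: "(complex^'n^'n) set"
      using that by (auto simp: restricted_Gr_def traceless_symmetric_def symmetric_matrices_def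
          cmat.subspace_0 transpose_def trace_def vec_eq_iff)
    then show ?thesis by (fastforce simp: Gr_zeros_def)
  qed
  then have "Gr_algebraic {}" unfolding Gr_algebraic_def using hom_poly.const
    by (intro exI[of _ "{\<lambda>X. 1}"]) auto
  then have "openin Gr_zariski restricted_Gr" by (simp add: openin_Gr_zariski)
  then show ?thesis
    by (metis openin_Gr_zariski openin_subset openin_topspace subset_antisym)
qed

lemma closedin_Gr_zariski: "closedin Gr_zariski Z \<longleftrightarrow> Gr_algebraic Z"
proof -
  have "Gr_algebraic Z \<Longrightarrow> Z \<subseteq> restricted_Gr" by (auto simp: Gr_algebraic_def Gr_zeros_def)
  then show ?thesis
    by (auto simp: closedin_def topspace_Gr_zariski openin_Gr_zariski double_diff)
qed

end

theory Submission
  imports Defs "HOL-Computational_Algebra.Polynomial"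
begin

text \<open>The pencil spanned by the identity and a traceless symmetric \<open>X \<noteq> 0\<close> is closed under the Jordan product if and
only if \<open>X\<^sup>2\<close> lies in it, i.e. if \<open>X\<close> satisfies a quadratic equation. If this equation has two distinct roots, then
\<open>X\<close> is a combination of the identity and a symmetric idempotent \<open>E\<close>, whose rank \<open>i\<close> may be taken to be at most
\<open>n / 2\<close>. If it has a double root, then \<open>X\<^sup>2 = 0\<close>, and \<open>X\<close> is a limit of multiples of idempotents of rank
\<open>r = rank X \<le> n / 2\<close> (lemma \<open>square_zero_is_limit\<close>). So the Jordan locus is the union of the closures \<open>V i\<close> of the
two-eigenvalue pencils for \<open>1 \<le> i \<le> n / 2\<close>.

The symmetric idempotents of rank \<open>i\<close> are the orthogonal projections \<open>M (M\<^sup>T M)\<^sup>-\<^sup>1 M\<^sup>T\<close> onto nondegenerate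
\<open>i\<close>-dimensional subspaces. Clearing the denominator gives a polynomial map from an affine space, so \<open>V i\<close> is
irreducible. No \<open>V i\<close> contains another one, because the invariant \<open>(trace X\<^sup>3)\<^sup>2 / (trace X\<^sup>2)\<^sup>3\<close> is constant on the
two-eigenvalue pencils of each type and takes different values for different \<open>i \<le> n / 2\<close>.

The codimension is defined by chains of irreducible closed sets, and dimension is measured by the growth of the Hilbert
function, i.e. of the number of linearly independent forms of degree \<open>k\<close> on a cone. Three facts suffice. A proper
inclusion of irreducible closed sets raises the order of growth by at least one (\<open>growth_step\<close>). A set parametrised by
polynomials in \<open>p\<close> variables has growth at most \<open>p\<close> (\<open>growth_le_parameters\<close>). Coordinates that move independently to
first order at one point bound the growth from below (\<open>growth_from_tangent\<close>). Writing generic subspaces as graphs of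
linear maps, \<open>V i\<close> has growth exactly \<open>d = i (n - i)\<close>, and the whole space has growth \<open>N = (n + 1 choose 2) - 2\<close>.
Hence no chain starting at \<open>V i\<close> is longer than \<open>N - d\<close>. Conversely, adding one linear direction after the other to the
cone over \<open>V i\<close>, each chosen outside the closure reached so far, keeps the sets irreducible and increases the number of
parameters by one at a time. So the whole space is not reached before step \<open>N - d\<close> (\<open>strict_chain_exists\<close>). Finally
\<open>N - d\<close> equals the stated codimension (\<open>dim_count\<close>).\<close>

section \<open>Polynomial functions of finitely many parameters\<close>

text \<open>Gaussian elimination: one equation is used to eliminate one unknown. This is the only linear
  algebra behind the upper bounds on Hilbert functions.\<close>

lemma underdetermined_system:
  fixes c :: "'j \<Rightarrow> 'a \<Rightarrow> complex"
  assumes "finite A" "finite J" "card A < card J"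
  shows "\<exists>x. (\<exists>j\<in>J. x j \<noteq> 0) \<and> (\<forall>a\<in>A. (\<Sum>j\<in>J. x j * c j a) = 0)"
  using assms
proof (induction A arbitrary: J c rule: finite_induct)
  case empty
  then obtain j where "j \<in> J" by fastforce
  then show ?case by (intro exI[of _ "\<lambda>_. 1"]) auto
next
  case (insert a0 A)
  show ?case
  proof (cases "\<forall>j\<in>J. c j a0 = 0")
    case True
    obtain x where "\<exists>j\<in>J. x j \<noteq> 0" "\<forall>a\<in>A. (\<Sum>j\<in>J. x j * c j a) = 0"
      using insert.IH[of J c] insert.prems insert.hyps by auto
    then show ?thesis using True by (intro exI[of _ x]) auto
  next
    case False
    then obtain j0 where j0: "j0 \<in> J" "c j0 a0 \<noteq> 0" by blast
    define c' where "c' j a = c j a - c j a0 / c j0 a0 * c j0 a" for j a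
    have "card A < card (J - {j0})" using insert j0 by simp
    then obtain x where x: "\<exists>j\<in>J - {j0}. x j \<noteq> 0" "\<forall>a\<in>A. (\<Sum>j\<in>J - {j0}. x j * c' j a) = 0"
      using insert.IH[of "J - {j0}" c'] insert.prems by auto
    \<comment> \<open>The eliminated unknown is recovered from the equation \<open>a0\<close>.\<close>
    define y where "y j = (if j = j0 then - (\<Sum>j\<in>J - {j0}. x j * c j a0) / c j0 a0 else x j)" for j
    have split: "(\<Sum>j\<in>J. y j * c j a) = y j0 * c j0 a + (\<Sum>j\<in>J - {j0}. x j * c j a)" for a
      using j0 insert.prems by (subst sum.remove[of J j0]) (auto simp: y_def intro!: sum.cong)
    have "(\<Sum>j\<in>J. y j * c j a) = 0" if "a \<in> insert a0 A" for a
    proof (cases "a = a0")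
      case True
      then show ?thesis unfolding split using j0 by (simp add: y_def)
    next
      case False
      have "(\<Sum>j\<in>J - {j0}. x j * c' j a)
          = (\<Sum>j\<in>J - {j0}. x j * c j a) - (\<Sum>j\<in>J - {j0}. x j * c j a0) / c j0 a0 * c j0 a"
        by (simp add: c'_def right_diff_distrib sum_subtractf sum_divide_distrib sum_distrib_right mult.assoc)
      then show ?thesis unfolding split using x(2) that False by (simp add: y_def)
    qed
    moreover have "\<exists>j\<in>J. y j \<noteq> 0" using x(1) by (auto simp: y_def)
    ultimately show ?thesis by blast
  qed
qed

definition monom_on :: "'v set \<Rightarrow> ('v \<Rightarrow> nat) \<Rightarrow> ('v \<Rightarrow> complex) \<Rightarrow> complex" where
  "monom_on R a b = (\<Prod>r\<in>R. b r ^ a r)"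

text \<open>Polynomials of degree at most \<open>d\<close> in each variable of \<open>R\<close> separately. Bounding the degrees
  separately makes the number of available monomials exactly \<open>(d + 1) ^ card R\<close>.\<close>

definition poly_box :: "'v set \<Rightarrow> nat \<Rightarrow> (('v \<Rightarrow> complex) \<Rightarrow> complex) \<Rightarrow> bool" where
  "poly_box R d f \<longleftrightarrow> (\<exists>c. \<forall>b. f b = (\<Sum>a\<in>PiE R (\<lambda>_. {..d}). c a * monom_on R a b))"

definition poly_fun :: "'v set \<Rightarrow> (('v \<Rightarrow> complex) \<Rightarrow> complex) \<Rightarrow> bool" where
  "poly_fun R f \<longleftrightarrow> (\<exists>d. poly_box R d f)"

text \<open>Collecting equal monomials; it allows arbitrary finite sums of monomials, with repetitions
  and with exponent functions that are not cut off outside \<open>R\<close>.\<close>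

lemma poly_box_sumI:
  assumes R: "finite R" and I: "finite I" and e: "\<And>i r. i \<in> I \<Longrightarrow> r \<in> R \<Longrightarrow> e i r \<le> d"
  shows "poly_box R d (\<lambda>b. \<Sum>i\<in>I. c i * monom_on R (e i) b)"
proof -
  let ?B = "PiE R (\<lambda>_. {..d})"
  define e' where "e' i = restrict (e i) R" for i
  have m: "monom_on R (e i) b = monom_on R (e' i) b" for i b
    by (simp add: monom_on_def e'_def)
  have e'B: "e' ` I \<subseteq> ?B" using e by (auto simp: e'_def PiE_iff)
  have fB: "finite ?B" using R by (simp add: finite_PiE)
  have "(\<Sum>i\<in>I. c i * monom_on R (e i) b)
      = (\<Sum>a\<in>?B. (\<Sum>i\<in>{i\<in>I. e' i = a}. c i) * monom_on R a b)" for b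
    unfolding m sum.group[OF I fB e'B, symmetric]
    by (auto simp: sum_distrib_right intro!: sum.cong)
  then show ?thesis unfolding poly_box_def by (intro exI allI)
qed

lemma poly_box_mono: "finite R \<Longrightarrow> poly_box R d f \<Longrightarrow> d \<le> d' \<Longrightarrow> poly_box R d' f"
proof -
  assume R: "finite R" and f: "poly_box R d f" and d: "d \<le> d'"
  obtain c where c: "\<forall>b. f b = (\<Sum>a\<in>PiE R (\<lambda>_. {..d}). c a * monom_on R a b)"
    using f by (auto simp: poly_box_def)
  have "poly_box R d' (\<lambda>b. \<Sum>a\<in>PiE R (\<lambda>_. {..d}). c a * monom_on R a b)"
    by (rule poly_box_sumI) (use R d in \<open>force simp: finite_PiE PiE_iff\<close>)+
  then show ?thesis using c by (simp add: poly_box_def)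
qed

lemma poly_box_const: "finite R \<Longrightarrow> poly_box R d (\<lambda>b. c)"
  using poly_box_sumI[of R "{()}" "\<lambda>_ _. 0" d "\<lambda>_. c"] by (simp add: monom_on_def)

lemma poly_box_var: "finite R \<Longrightarrow> r \<in> R \<Longrightarrow> poly_box R 1 (\<lambda>b. b r)"
proof -
  assume R: "finite R" "r \<in> R"
  have "monom_on R (\<lambda>r'. if r' = r then 1 else 0) b = b r" for b
    unfolding monom_on_def using R by (subst prod.remove[of R r]) (auto intro!: prod.neutral)
  then show ?thesis
    using poly_box_sumI[of R "{()}" "\<lambda>_ r'. if r' = r then 1 else 0" 1 "\<lambda>_. 1"] R by simp
qed

lemma poly_box_add:
  "poly_box R d f \<Longrightarrow> poly_box R d g \<Longrightarrow> poly_box R d (\<lambda>b. f b + g b)"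
proof -
  assume f: "poly_box R d f" and g: "poly_box R d g"
  then obtain c c' where "\<forall>b. f b = (\<Sum>a\<in>PiE R (\<lambda>_. {..d}). c a * monom_on R a b)"
    "\<forall>b. g b = (\<Sum>a\<in>PiE R (\<lambda>_. {..d}). c' a * monom_on R a b)"
    by (auto simp: poly_box_def)
  then have "\<forall>b. f b + g b = (\<Sum>a\<in>PiE R (\<lambda>_. {..d}). (c a + c' a) * monom_on R a b)"
    by (simp add: sum.distrib distrib_right)
  then show ?thesis unfolding poly_box_def by (intro exI)
qed

lemma poly_box_mult:
  assumes R: "finite R" and f: "poly_box R d f" and g: "poly_box R e g"
  shows "poly_box R (d + e) (\<lambda>b. f b * g b)"
proof -
  let ?A = "PiE R (\<lambda>_. {..d})" and ?B = "PiE R (\<lambda>_. {..e})"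
  from f obtain c where c: "\<forall>b. f b = (\<Sum>a\<in>?A. c a * monom_on R a b)"
    unfolding poly_box_def by (elim exE)
  from g obtain c' where c': "\<forall>b. g b = (\<Sum>a\<in>?B. c' a * monom_on R a b)"
    unfolding poly_box_def by (elim exE)
  have "f b * g b = (\<Sum>i\<in>?A \<times> ?B. (c (fst i) * c' (snd i)) * monom_on R (\<lambda>r. fst i r + snd i r) b)" for b
    unfolding c[rule_format, of b] c'[rule_format, of b] sum_product sum.cartesian_product
    by (intro sum.cong) (auto simp: monom_on_def power_add prod.distrib)
  moreover have "poly_box R (d + e)
     (\<lambda>b. \<Sum>i\<in>?A \<times> ?B. (c (fst i) * c' (snd i)) * monom_on R (\<lambda>r. fst i r + snd i r) b)"
  proof (rule poly_box_sumI)
    show "finite (?A \<times> ?B)" using R by (simp add: finite_PiE)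
    fix i r assume "i \<in> ?A \<times> ?B" "r \<in> R"
    then have "fst i r \<in> {..d}" "snd i r \<in> {..e}" by (auto dest: PiE_mem)
    then show "fst i r + snd i r \<le> d + e" by simp
  qed (rule R)
  ultimately show ?thesis by simp
qed

lemma poly_fun_const: "finite R \<Longrightarrow> poly_fun R (\<lambda>b. c)"
  unfolding poly_fun_def by (intro exI[of _ 0] poly_box_const)

lemma poly_fun_var: "finite R \<Longrightarrow> r \<in> R \<Longrightarrow> poly_fun R (\<lambda>b. b r)"
  unfolding poly_fun_def by (intro exI[of _ 1] poly_box_var)

lemma poly_fun_add: "finite R \<Longrightarrow> poly_fun R f \<Longrightarrow> poly_fun R g \<Longrightarrow> poly_fun R (\<lambda>b. f b + g b)"
proof -
  assume R: "finite R" and "poly_fun R f" "poly_fun R g"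
  then obtain d e where de: "poly_box R d f" "poly_box R e g" by (auto simp: poly_fun_def)
  have "poly_box R (max d e) f" "poly_box R (max d e) g"
    using poly_box_mono[OF R de(1)] poly_box_mono[OF R de(2)] by auto
  then show ?thesis unfolding poly_fun_def by (intro exI[of _ "max d e"] poly_box_add)
qed

lemma poly_fun_mult: "finite R \<Longrightarrow> poly_fun R f \<Longrightarrow> poly_fun R g \<Longrightarrow> poly_fun R (\<lambda>b. f b * g b)"
  unfolding poly_fun_def by (elim exE, rule exI, rule poly_box_mult)

lemma poly_fun_diff: "finite R \<Longrightarrow> poly_fun R f \<Longrightarrow> poly_fun R g \<Longrightarrow> poly_fun R (\<lambda>b. f b - g b)"
  using poly_fun_add[of R f "\<lambda>b. (-1) * g b"] poly_fun_mult[of R "\<lambda>_. -1" g] poly_fun_const[of R "-1"]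
  by simp

lemma poly_fun_sum:
  "finite R \<Longrightarrow> (\<And>i. i \<in> I \<Longrightarrow> poly_fun R (f i)) \<Longrightarrow> poly_fun R (\<lambda>b. \<Sum>i\<in>I. f i b)"
  by (induction I rule: infinite_finite_induct) (auto intro: poly_fun_const poly_fun_add)

lemma poly_fun_prod:
  "finite R \<Longrightarrow> (\<And>i. i \<in> I \<Longrightarrow> poly_fun R (f i)) \<Longrightarrow> poly_fun R (\<lambda>b. \<Prod>i\<in>I. f i b)"
  by (induction I rule: infinite_finite_induct) (auto intro: poly_fun_const poly_fun_mult)

definition poly_mat :: "'v set \<Rightarrow> (('v \<Rightarrow> complex) \<Rightarrow> complex^'n^'m) \<Rightarrow> bool" where
  "poly_mat R A \<longleftrightarrow> (\<forall>i j. poly_fun R (\<lambda>b. A b $ i $ j))"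

lemma poly_mat_const: "finite R \<Longrightarrow> poly_mat R (\<lambda>b. A)"
  by (simp add: poly_mat_def poly_fun_const)

lemma poly_mat_add: "finite R \<Longrightarrow> poly_mat R A \<Longrightarrow> poly_mat R B \<Longrightarrow> poly_mat R (\<lambda>b. A b + B b)"
  by (simp add: poly_mat_def poly_fun_add)

lemma poly_mat_diff: "finite R \<Longrightarrow> poly_mat R A \<Longrightarrow> poly_mat R B \<Longrightarrow> poly_mat R (\<lambda>b. A b - B b)"
  by (simp add: poly_mat_def poly_fun_diff)

lemma poly_mat_mult: "finite R \<Longrightarrow> poly_mat R A \<Longrightarrow> poly_mat R B \<Longrightarrow> poly_mat R (\<lambda>b. A b ** B b)"
  by (simp add: poly_mat_def matrix_matrix_mult_def poly_fun_sum poly_fun_mult)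

lemma poly_mat_transpose: "poly_mat R A \<Longrightarrow> poly_mat R (\<lambda>b. transpose (A b))"
  by (simp add: poly_mat_def transpose_def)

lemma poly_mat_cscale:
  "finite R \<Longrightarrow> poly_fun R f \<Longrightarrow> poly_mat R A \<Longrightarrow> poly_mat R (\<lambda>b. cscale (f b) (A b))"
  by (simp add: poly_mat_def poly_fun_mult)

lemma poly_mat_sum:
  "finite R \<Longrightarrow> (\<And>i. i \<in> I \<Longrightarrow> poly_mat R (A i)) \<Longrightarrow> poly_mat R (\<lambda>b. \<Sum>i\<in>I. A i b)"
  by (induction I rule: infinite_finite_induct) (auto intro: poly_mat_const poly_mat_add)

lemma poly_fun_det: "finite R \<Longrightarrow> poly_mat R A \<Longrightarrow> poly_fun R (\<lambda>b. det (A b))"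
  unfolding det_def poly_mat_def
  by (intro poly_fun_sum poly_fun_mult poly_fun_prod poly_fun_const) auto

text \<open>The entries are those of Cramer's rule, so that they are visibly polynomial in the entries of \<open>A\<close>.\<close>

definition adjugate :: "complex^'n^'n \<Rightarrow> complex^'n^'n" where
  "adjugate A = (\<chi> k l. det (\<chi> i j. if j = k then (if i = l then 1 else 0) else A $ i $ j))"

lemma poly_mat_adjugate:
  fixes A :: "('v \<Rightarrow> complex) \<Rightarrow> complex^'n^'n"
  assumes "finite R" "poly_mat R A"
  shows "poly_mat R (\<lambda>b. adjugate (A b))"
proof -
  have "poly_mat R (\<lambda>b. \<chi> i j. if j = k then (if i = l then 1 else 0) else A b $ i $ j)" for k l :: 'n
    using assms unfolding poly_mat_def
    by (intro allI, rename_tac i j, case_tac "j = k") (simp_all add: poly_fun_const)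
  then have "poly_fun R (\<lambda>b. adjugate (A b) $ k $ l)" for k l
    unfolding adjugate_def vec_lambda_beta by (intro poly_fun_det assms(1))
  then show ?thesis by (simp add: poly_mat_def)
qed

lemma matrix_inv_inverse:
  fixes A :: "'a::semiring_1^'n^'m"
  assumes "invertible A"
  shows "A ** matrix_inv A = mat 1" "matrix_inv A ** A = mat 1"
  using someI_ex[OF assms[unfolded invertible_def]] by (simp_all add: matrix_inv_def)

lemma adjugate_eq_inverse:
  fixes A :: "complex^'n^'n"
  assumes "det A \<noteq> 0"
  shows "adjugate A = cscale (det A) (matrix_inv A)"
proof -
  have inv: "A ** matrix_inv A = mat 1"
    using assms by (simp add: invertible_det_nz matrix_inv_inverse)
  have "matrix_inv A $ k $ l = adjugate A $ k $ l / det A" for k l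
  proof -
    define e :: "complex^'n" where "e = (\<chi> i. if i = l then 1 else 0)"
    have [simp]: "(if j = k then e $ i else A $ i $ j) = (if j = k then (if i = l then 1 else 0) else A $ i $ j)"
      for i j k by (simp add: e_def)
    have "A *v (\<chi> k. matrix_inv A $ k $ l) = e" unfolding e_def
      using inv by (simp add: vec_eq_iff matrix_vector_mult_def matrix_matrix_mult_def mat_def)
    then have "(\<chi> k. matrix_inv A $ k $ l)
       = (\<chi> k. det (\<chi> i j. if j = k then e $ i else A $ i $ j) / det A)"
      using cramer[OF assms] by blast
    then show ?thesis by (simp add: vec_eq_iff adjugate_def)
  qed
  then show ?thesis using assms by (simp add: vec_eq_iff)
qed

lemma poly_fun_on_line:
  assumes "poly_fun R f"
  shows "\<exists>p. \<forall>s. f (\<lambda>v. (1 - s) * x v + s * y v) = poly p s"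
proof -
  obtain d c where c: "\<And>b. f b = (\<Sum>a\<in>PiE R (\<lambda>_. {..d}). c a * monom_on R a b)"
    using assms unfolding poly_fun_def poly_box_def by metis
  show ?thesis
    by (intro exI[of _ "\<Sum>a\<in>PiE R (\<lambda>_. {..d}). smult (c a) (\<Prod>r\<in>R. [:x r, y r - x r:] ^ a r)"] allI)
      (simp add: c poly_sum poly_prod monom_on_def algebra_simps)
qed

lemma poly_fun_tendsto:
  assumes "poly_fun R f" "\<And>r. ((\<lambda>s. \<beta> s r) \<longlongrightarrow> b r) F"
  shows "((\<lambda>s. f (\<beta> s)) \<longlongrightarrow> f b) F"
proof -
  obtain d c where c: "\<And>b. f b = (\<Sum>a\<in>PiE R (\<lambda>_. {..d}). c a * monom_on R a b)"
    using assms(1) unfolding poly_fun_def poly_box_def by metis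
  show ?thesis unfolding c monom_on_def by (intro tendsto_intros assms(2))
qed

text \<open>Polynomial functions on an affine space form an integral domain: restricted to the line through
  \<open>x\<close> and \<open>y\<close>, both functions become nonzero polynomials in one variable, and so does their product. Every
  density and irreducibility argument below reduces to this.\<close>

lemma poly_fun_common_nonzero:
  assumes "poly_fun R f" "poly_fun R' g" "f x \<noteq> 0" "g y \<noteq> 0"
  shows "\<exists>z. f z \<noteq> 0 \<and> g z \<noteq> 0"
proof -
  obtain p where p: "\<forall>s. f (\<lambda>v. (1 - s) * x v + s * y v) = poly p s"
    using poly_fun_on_line[OF assms(1)] by blast
  obtain q where q: "\<forall>s. g (\<lambda>v. (1 - s) * x v + s * y v) = poly q s"
    using poly_fun_on_line[OF assms(2)] by blast
  have "poly p 0 \<noteq> 0" "poly q 1 \<noteq> 0" using p[rule_format, of 0] q[rule_format, of 1] assms by auto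
  then have "p * q \<noteq> 0" by auto
  then obtain s where "poly (p * q) s \<noteq> 0" using poly_all_0_iff_0 by blast
  then show ?thesis using p q by (metis mult_zero_left mult_zero_right poly_mult)
qed

text \<open>Induction on the number of variables: the sum is a polynomial in the last variable \<open>x\<close> that vanishes
  identically, so each of its coefficients vanishes, and these are sums of the same kind in fewer variables.\<close>

lemma monomials_independent:
  assumes "finite R" "\<And>b. (\<Sum>a\<in>PiE R (\<lambda>_. {..<q}). c a * monom_on R a b) = 0" "a \<in> PiE R (\<lambda>_. {..<q})"
  shows "c a = 0"
  using assms
proof (induction R arbitrary: c a rule: finite_induct)
  case empty
  then show ?case by (simp add: monom_on_def)
next
  case (insert x R)
  let ?B = "PiE R (\<lambda>_. {..<q})"
  have fB: "finite ?B" using insert by (simp add: finite_PiE)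
  have inj: "inj_on (\<lambda>(y, g). g(x := y)) ({..<q} \<times> ?B)"
  proof (rule inj_onI, clarify)
    fix y g y' g' assume *: "g \<in> ?B" "g' \<in> ?B" "g(x := y) = g'(x := y')"
    have "y = y'" using fun_cong[OF *(3), of x] by simp
    moreover have "g v = g' v" for v
    proof (cases "v = x")
      case True
      then show ?thesis using * insert.hyps PiE_arb[of _ R] by metis
    next
      case False
      then show ?thesis using fun_cong[OF *(3), of v] by simp
    qed
    ultimately show "y = y' \<and> g = g'" by auto
  qed
  have expand: "(\<Sum>a\<in>PiE (insert x R) (\<lambda>_. {..<q}). c a * monom_on (insert x R) a (b(x := t)))
     = (\<Sum>k<q. (\<Sum>g\<in>?B. c (g(x := k)) * monom_on R g b) * t ^ k)" for b t
  proof -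
    have "monom_on (insert x R) (g(x := k)) (b(x := t)) = t ^ k * monom_on R g b" for g k
      using insert.hyps by (simp add: monom_on_def) (intro disjI2 prod.cong, auto)
    then have "(\<Sum>a\<in>PiE (insert x R) (\<lambda>_. {..<q}). c a * monom_on (insert x R) a (b(x := t)))
       = (\<Sum>(k, g)\<in>{..<q} \<times> ?B. c (g(x := k)) * (t ^ k * monom_on R g b))"
      by (simp only: PiE_insert_eq sum.reindex[OF inj]) (simp add: case_prod_unfold)
    also have "\<dots> = (\<Sum>k<q. \<Sum>g\<in>?B. c (g(x := k)) * (t ^ k * monom_on R g b))"
      by (simp add: sum.cartesian_product)
    finally show ?thesis by (simp add: sum_distrib_left mult_ac)
  qed
  have "(\<Sum>g\<in>?B. c (g(x := k)) * monom_on R g b) = 0" if "k < q" for k b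
  proof -
    define C where "C k = (if k < q then \<Sum>g\<in>?B. c (g(x := k)) * monom_on R g b else 0)" for k
    have "(\<Sum>k\<le>q. C k * t ^ k) = 0" for t
    proof -
      have "(\<Sum>k\<le>q. C k * t ^ k) = (\<Sum>k<q. C k * t ^ k)"
        by (simp add: lessThan_Suc_atMost[symmetric] C_def)
      also have "\<dots> = (\<Sum>k<q. (\<Sum>g\<in>?B. c (g(x := k)) * monom_on R g b) * t ^ k)"
        by (simp add: C_def)
      finally show ?thesis using insert.prems(1) expand by metis
    qed
    then have "C k = 0" using polyfun_eq_0[of C q] that by auto
    then show ?thesis using that by (simp add: C_def)
  qed
  then have *: "k < q \<Longrightarrow> g \<in> ?B \<Longrightarrow> c (g(x := k)) = 0" for k g
    using insert.IH[of "\<lambda>g. c (g(x := k))"] by blast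
  obtain k g where "a = g(x := k)" "k < q" "g \<in> ?B"
    using insert.prems(2) by (auto simp: PiE_insert_eq)
  then show ?case using * by blast
qed

section \<open>Matrix algebra and idempotents\<close>

lemma matrix_add_rdistrib: "(B + C) ** (A::complex^'n^'n) = B ** A + C ** A"
  by (simp add: vec_eq_iff matrix_matrix_mult_def sum.distrib distrib_right)

lemma matrix_diff_ldistrib: "(A::complex^'n^'n) ** (B - C) = A ** B - A ** C"
  by (simp add: vec_eq_iff matrix_matrix_mult_def sum_subtractf right_diff_distrib)

lemma matrix_diff_rdistrib: "(B - C) ** (A::complex^'n^'n) = B ** A - C ** A"
  by (simp add: vec_eq_iff matrix_matrix_mult_def sum_subtractf left_diff_distrib)

lemma cscale_mult_left: "cscale c A ** B = cscale c (A ** B)"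
  by (simp add: vec_eq_iff matrix_matrix_mult_def sum_distrib_left mult_ac)

lemma cscale_mult_right: "A ** cscale c B = cscale c (A ** B)"
  by (simp add: vec_eq_iff matrix_matrix_mult_def sum_distrib_left mult_ac)

lemma cscale_mult_vec: "cscale c A *v v = c *s (A *v v)"
  by (simp add: vec_eq_iff matrix_vector_mult_def sum_distrib_left mult.assoc)

lemma transpose_add: "transpose (A + B) = transpose A + transpose (B::complex^'n^'n)"
  by (simp add: transpose_def vec_eq_iff)

lemma transpose_diff: "transpose (A - B) = transpose A - transpose (B::complex^'n^'n)"
  by (simp add: transpose_def vec_eq_iff)

lemma transpose_cscale: "transpose (cscale c A) = cscale c (transpose A)"
  by (simp add: transpose_def vec_eq_iff)

text \<open>Products are kept right-nested. A relation \<open>A ** B = C\<close> is then also needed in this form, which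
  applies inside a longer product.\<close>

lemma mult_rewrite: "(A::complex^'n^'n) ** B = C \<Longrightarrow> A ** (B ** X) = C ** X"
  by (simp add: matrix_mul_assoc)

lemmas mat_ring = matrix_add_ldistrib matrix_add_rdistrib matrix_diff_ldistrib matrix_diff_rdistrib
  cscale_mult_left cscale_mult_right matrix_mul_assoc[symmetric] matrix_mul_lid matrix_mul_rid

lemmas transpose_ring = transpose_add transpose_diff transpose_cscale matrix_transpose_mul transpose_mat
  transpose_transpose

lemma det_cscale_nonzero:
  fixes A :: "complex^'n^'n"
  assumes "det (cscale c A) \<noteq> 0"
  shows "det A \<noteq> 0"
proof -
  obtain B where "cscale c A ** B = mat 1"
    using assms invertible_det_nz invertible_right_inverse by blast
  then have "A ** cscale c B = mat 1" by (simp add: cscale_mult_left cscale_mult_right)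
  then show ?thesis using invertible_det_nz invertible_right_inverse by blast
qed

lemma matrix_inv_unique: "(A::complex^'n^'n) ** B = mat 1 \<Longrightarrow> matrix_inv A = B"
  by (metis invertible_right_inverse matrix_inv_inverse(2) matrix_mul_assoc matrix_mul_lid matrix_mul_rid)

definition coord_proj :: "'n set \<Rightarrow> complex^'n^'n" where
  "coord_proj I = (\<chi> i j. if i = j \<and> i \<in> I then 1 else 0)"

lemma coord_proj_mult_nth [simp]:
  fixes A :: "complex^'n^'n"
  shows
  "(coord_proj I ** A) $ p $ q = (if p \<in> I then A $ p $ q else 0)"
  "(A ** coord_proj I) $ p $ q = (if q \<in> I then A $ p $ q else 0)"
proof -
  have "(coord_proj I ** A) $ p $ q = (\<Sum>k\<in>UNIV. if k = p then (if p \<in> I then A $ p $ q else 0) else 0)"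
    unfolding coord_proj_def matrix_matrix_mult_def vec_lambda_beta by (rule sum.cong) auto
  then show "(coord_proj I ** A) $ p $ q = (if p \<in> I then A $ p $ q else 0)" by simp
  have "(A ** coord_proj I) $ p $ q = (\<Sum>k\<in>UNIV. if k = q then (if q \<in> I then A $ p $ q else 0) else 0)"
    unfolding coord_proj_def matrix_matrix_mult_def vec_lambda_beta by (rule sum.cong) auto
  then show "(A ** coord_proj I) $ p $ q = (if q \<in> I then A $ p $ q else 0)" by simp
qed

lemma coord_proj_idem: "coord_proj I ** coord_proj I = coord_proj I"
  by (simp add: vec_eq_iff) (simp add: coord_proj_def)

lemma coord_proj_transpose: "transpose (coord_proj I) = coord_proj I"
  by (auto simp: vec_eq_iff transpose_def coord_proj_def)

lemma coord_proj_trace: "trace (coord_proj I :: complex^'n^'n) = of_nat (card I)"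
  by (simp add: trace_def coord_proj_def sum.If_cases)

lemma coord_proj_range:
  fixes I :: "'n::finite set"
  shows "range ((*v) (coord_proj I)) = {v :: complex^'n. \<forall>i. i \<notin> I \<longrightarrow> v $ i = 0}"
proof -
  have nth: "(coord_proj I *v v) $ i = (if i \<in> I then v $ i else 0)" for v :: "complex^'n" and i
  proof -
    have "(coord_proj I *v v) $ i = (\<Sum>k\<in>UNIV. if k = i then (if i \<in> I then v $ i else 0) else 0)"
      unfolding coord_proj_def matrix_vector_mult_def vec_lambda_beta by (rule sum.cong) auto
    then show ?thesis by simp
  qed
  show ?thesis
  proof (intro equalityI subsetI)
    fix v :: "complex^'n" assume "v \<in> {v. \<forall>i. i \<notin> I \<longrightarrow> v $ i = 0}"
    then have "v = coord_proj I *v v" by (auto simp: vec_eq_iff nth)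
    then show "v \<in> range ((*v) (coord_proj I))" by blast
  qed (auto simp: nth)
qed

lemma coord_proj_rank: "vec.dim (range ((*v) (coord_proj I))) = card I"
  by (simp only: coord_proj_range dim_substandard_cart)

lemma idempotent_range_iff:
  fixes E :: "complex^'n^'n"
  assumes "E ** E = E"
  shows "v \<in> range ((*v) E) \<longleftrightarrow> E *v v = v"
proof
  assume "v \<in> range ((*v) E)"
  then obtain w where "v = E *v w" by blast
  then show "E *v v = v" by (simp add: matrix_vector_mul_assoc assms)
next
  assume "E *v v = v"
  then show "v \<in> range ((*v) E)" by (intro image_eqI[of _ _ v]) simp_all
qed

lemma idempotent_complement:
  fixes E :: "complex^'n^'n"
  assumes "E ** E = E"
  shows "(mat 1 - E) ** (mat 1 - E) = mat 1 - E"
  using assms by (simp add: mat_ring)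

lemma idempotent_rank_complement:
  fixes E :: "complex^'n^'n"
  assumes E: "E ** E = E"
  shows "vec.dim (range ((*v) E)) + vec.dim (range ((*v) (mat 1 - E))) = CARD('n)"
proof -
  let ?S = "range ((*v) E)" and ?T = "range ((*v) (mat 1 - E))"
  have S: "vec.subspace ?S" and T: "vec.subspace ?T"
    by (rule vec.linear_subspace_image[OF matrix_vector_mul_linear_gen vec.subspace_UNIV])+
  have "v = E *v v + (mat 1 - E) *v v" for v
    by (simp add: matrix_vector_mult_diff_rdistrib)
  then have "{x + y |x y. x \<in> ?S \<and> y \<in> ?T} = UNIV" by blast
  moreover have "v = 0" if "E *v v = v" "(mat 1 - E) *v v = v" for v
    using that by (simp add: matrix_vector_mult_diff_rdistrib)
  then have "?S \<inter> ?T = {0}"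
    using idempotent_range_iff[OF E] idempotent_range_iff[OF idempotent_complement[OF E]]
      vec.subspace_0[OF S] vec.subspace_0[OF T] by blast
  ultimately show ?thesis using vec.dim_sums_Int[OF S T] by (simp add: card_cart_basis)
qed

text \<open>Both idempotents split the space into an image and a complementary kernel of the same dimensions;
  \<open>P\<close> is glued from isomorphisms of the two images and of the two kernels.\<close>

lemma idempotent_conj_coord_proj:
  fixes E :: "complex^'n^'n" and I :: "'n set"
  assumes E: "E ** E = E" and I: "card I = vec.dim (range ((*v) E))"
  shows "\<exists>P. invertible P \<and> E ** P = P ** coord_proj I"
proof -
  let ?J = "coord_proj I :: complex^'n^'n"
  note sub = vec.linear_subspace_image[OF matrix_vector_mul_linear_gen vec.subspace_UNIV]
  obtain f where f: "Vector_Spaces.linear (*s) (*s) f" "f ` range ((*v) ?J) = range ((*v) E)"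
    "inj_on f (range ((*v) ?J))"
    using vec.subspace_isomorphism[OF sub sub, of ?J E] I coord_proj_rank[of I] by auto
  have "vec.dim (range ((*v) (mat 1 - ?J))) = vec.dim (range ((*v) (mat 1 - E)))"
    using idempotent_rank_complement[OF E] idempotent_rank_complement[OF coord_proj_idem[of I]]
      I coord_proj_rank[of I] by linarith
  then obtain g where g: "Vector_Spaces.linear (*s) (*s) g"
    "g ` range ((*v) (mat 1 - ?J)) = range ((*v) (mat 1 - E))" "inj_on g (range ((*v) (mat 1 - ?J)))"
    using vec.subspace_isomorphism[OF sub sub, of "mat 1 - ?J" "mat 1 - E"] by auto
  define P where "P = matrix f ** ?J + matrix g ** (mat 1 - ?J)"
  have Pv: "P *v v = f (?J *v v) + g ((mat 1 - ?J) *v v)" for v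
    by (simp add: P_def matrix_vector_mult_add_rdistrib matrix_vector_mul_assoc[symmetric] matrix_works[OF f(1)]
        matrix_works[OF g(1)])
  have Ef: "E *v f (?J *v v) = f (?J *v v)" for v
    using f(2) idempotent_range_iff[OF E] by blast
  have Eg: "E *v g ((mat 1 - ?J) *v v) = 0" for v
  proof -
    have "(mat 1 - E) *v g ((mat 1 - ?J) *v v) = g ((mat 1 - ?J) *v v)"
      using g(2) idempotent_range_iff[OF idempotent_complement[OF E]] by blast
    then show ?thesis by (simp add: matrix_vector_mult_diff_rdistrib)
  qed
  have f0: "f 0 = 0" and g0: "g 0 = 0" using f(1) g(1) by (simp_all add: vec.linear_0)
  have "v = 0" if "P *v v = 0" for v
  proof -
    have "E *v (P *v v) = f (?J *v v)"
      by (simp add: Pv matrix_vector_right_distrib Ef Eg)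
    then have "f (?J *v v) = f (?J *v 0)" using that f0 by simp
    then have 1: "?J *v v = 0" using f(3) by (metis inj_onD matrix_vector_mult_0_right rangeI)
    then have "g ((mat 1 - ?J) *v v) = g ((mat 1 - ?J) *v 0)" using that g0 f0 by (simp add: Pv)
    then have "(mat 1 - ?J) *v v = 0" using g(3) by (metis inj_onD matrix_vector_mult_0_right rangeI)
    then show ?thesis using 1 by (simp add: matrix_vector_mult_diff_rdistrib)
  qed
  then have "invertible P"
    using matrix_left_invertible_ker[of P] invertible_left_inverse by blast
  moreover have "E ** P = P ** ?J"
  proof -
    have "(E ** P) *v v = (P ** ?J) *v v" for v
    proof -
      have JJ: "?J *v (?J *v v) = ?J *v v" by (simp add: matrix_vector_mul_assoc coord_proj_idem)
      then have "(mat 1 - ?J) *v (?J *v v) = 0" by (simp add: matrix_vector_mult_diff_rdistrib)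
      then show ?thesis
        by (simp add: matrix_vector_mul_assoc[symmetric] Pv matrix_vector_right_distrib Ef Eg JJ g0)
    qed
    then show ?thesis by (simp add: matrix_eq)
  qed
  ultimately show ?thesis by blast
qed

lemma idempotent_trace:
  fixes E :: "complex^'n^'n"
  assumes E: "E ** E = E"
  shows "trace E = of_nat (vec.dim (range ((*v) E)))"
proof -
  have "vec.dim (range ((*v) E)) \<le> CARD('n)" using idempotent_rank_complement[OF E] by simp
  then obtain I :: "'n set" where I: "card I = vec.dim (range ((*v) E))"
    by (metis obtain_subset_with_card_n)
  obtain P where P: "invertible P" "E ** P = P ** coord_proj I"
    using idempotent_conj_coord_proj[OF E I] by blast
  have "trace E = trace ((E ** P) ** matrix_inv P)"
    using P(1) by (simp add: mat_ring matrix_inv_inverse)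
  also have "\<dots> = trace (coord_proj I ** (matrix_inv P ** P))"
    by (metis P(2) matrix_mul_assoc trace_mul_sym)
  finally show ?thesis using P(1) I by (simp add: matrix_inv_inverse coord_proj_trace)
qed

text \<open>In characteristic zero the trace of an idempotent determines its rank. This is how equality of two nested
  projections is detected.\<close>

lemma idempotent_trace_0:
  fixes E :: "complex^'n^'n"
  assumes E: "E ** E = E" and "trace E = 0"
  shows "E = 0"
proof -
  have "vec.dim (range ((*v) E)) = 0" using idempotent_trace[OF E] assms(2) by simp
  then have "range ((*v) E) \<subseteq> {0}" by (simp only: vec.dim_eq_0)
  then show ?thesis by (auto simp: matrix_eq)
qed

section \<open>Symmetric idempotents and their parametrisation\<close>

text \<open>The orthogonal projections of rank \<open>i\<close> for the symmetric bilinear form given by the identity matrix. The rank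
  is recorded as a trace, which makes it a polynomial condition.\<close>

definition orth_proj :: "nat \<Rightarrow> (complex^'n^'n) set" where
  "orth_proj i = {E. transpose E = E \<and> E ** E = E \<and> trace E = of_nat i}"

lemma coord_proj_orth_proj: "coord_proj I \<in> orth_proj (card I)"
  by (simp add: orth_proj_def coord_proj_transpose coord_proj_idem coord_proj_trace)

lemma orth_proj_rank:
  "E \<in> orth_proj i \<Longrightarrow> vec.dim (range ((*v) E)) = i"
  using idempotent_trace[of E] by (simp add: orth_proj_def)

lemma orth_proj_complement:
  assumes "(E :: complex^'n^'n) \<in> orth_proj i" "i \<le> CARD('n)"
  shows "mat 1 - E \<in> orth_proj (CARD('n) - i)"
  using assms idempotent_complement[of E]
  by (simp add: orth_proj_def transpose_diff trace_sub trace_I of_nat_diff)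

lemma orth_proj_card_le: "(E :: complex^'n^'n) \<in> orth_proj i \<Longrightarrow> i \<le> CARD('n)"
  using idempotent_rank_complement[of E] orth_proj_rank[of E i] by (simp add: orth_proj_def)

text \<open>The Gram matrix of those columns of \<open>G\<close> whose index lies in \<open>I\<close>, completed by an identity block
  to a matrix of full size. Working with square matrices throughout avoids a matrix type for each rank.\<close>

definition gram :: "'n set \<Rightarrow> complex^'n^'n \<Rightarrow> complex^'n^'n" where
  "gram I G = coord_proj I ** transpose G ** G ** coord_proj I + (mat 1 - coord_proj I)"

text \<open>The orthogonal projection onto the span of the columns of \<open>G\<close> with index in \<open>I\<close>, i.e. the familiar
  \<open>M (M\<^sup>T M)\<^sup>-\<^sup>1 M\<^sup>T\<close>. It exists as soon as the bilinear form is nondegenerate on that span.\<close>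

definition span_proj :: "'n set \<Rightarrow> complex^'n^'n \<Rightarrow> complex^'n^'n" where
  "span_proj I G = G ** coord_proj I ** matrix_inv (gram I G) ** coord_proj I ** transpose G"

lemma span_proj_orth_proj:
  fixes G :: "complex^'n^'n"
  assumes "det (gram I G) \<noteq> 0"
  shows "span_proj I G \<in> orth_proj (card I)"
proof -
  define J :: "complex^'n^'n" where "J = coord_proj I"
  define K where "K = gram I G"
  define L where "L = matrix_inv K"
  have KL: "K ** L = mat 1" "L ** K = mat 1"
    using assms by (simp_all add: K_def L_def invertible_det_nz matrix_inv_inverse)
  have JJ: "J ** J = J" by (simp add: J_def coord_proj_idem)
  have Kdef: "K = J ** (transpose G ** (G ** J)) + (mat 1 - J)"
    by (simp add: K_def gram_def J_def matrix_mul_assoc)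
  have GG: "J ** (transpose G ** (G ** J)) = K - (mat 1 - J)" by (simp add: Kdef)
  have tJ: "transpose J = J" by (simp add: J_def coord_proj_transpose)
  have tK: "transpose K = K" by (simp add: Kdef transpose_ring tJ mat_ring)
  have tL: "transpose L = L"
  proof -
    have "transpose (L ** K) = mat 1" using KL by simp
    then have "K ** transpose L = mat 1" by (simp add: matrix_transpose_mul tK)
    then show ?thesis using matrix_inv_unique L_def by metis
  qed
  have JK: "J ** K = K ** J" by (simp add: Kdef mat_ring JJ JJ[THEN mult_rewrite])
  have JL: "J ** L = L ** J"
  proof -
    have "L ** (J ** K) ** L = L ** (K ** J) ** L" by (simp add: JK)
    then show ?thesis by (simp add: mat_ring KL KL[THEN mult_rewrite])
  qed
  have KJ: "K ** J = K - (mat 1 - J)" by (simp add: Kdef mat_ring JJ JJ[THEN mult_rewrite])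
  have LJ: "L - L ** J = mat 1 - J"
  proof -
    have "L ** (K ** J) = L ** (K - (mat 1 - J))" by (simp add: KJ)
    then show ?thesis by (simp add: mat_ring KL KL[THEN mult_rewrite] algebra_simps)
  qed
  have E: "span_proj I G = G ** (L ** (J ** transpose G))"
    by (simp add: span_proj_def J_def[symmetric] K_def[symmetric] L_def[symmetric] mat_ring
        JL[THEN mult_rewrite] JL JJ JJ[THEN mult_rewrite])
  have "J ** (transpose G ** (G ** (L ** (J ** X)))) = J ** X" for X :: "complex^'n^'n"
  proof -
    have "J ** (transpose G ** (G ** (L ** (J ** X)))) = (J ** (transpose G ** (G ** J))) ** (L ** X)"
      by (simp add: mat_ring JL[THEN mult_rewrite])
    also have "\<dots> = X - (L ** X - J ** (L ** X))" unfolding GG by (simp add: mat_ring KL[THEN mult_rewrite])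
    also have "L ** X - J ** (L ** X) = (L - L ** J) ** X" by (simp add: mat_ring JL[THEN mult_rewrite])
    finally show ?thesis by (simp add: LJ mat_ring)
  qed
  then have "span_proj I G ** span_proj I G = span_proj I G" by (simp add: E mat_ring)
  moreover have "transpose (span_proj I G) = span_proj I G"
    by (simp add: E transpose_ring tJ tL mat_ring JL[THEN mult_rewrite])
  moreover have "trace (span_proj I G) = of_nat (card I)"
  proof -
    have "trace (span_proj I G) = trace ((G ** J) ** (L ** (J ** transpose G)))"
      by (simp add: E mat_ring JL[THEN mult_rewrite] JJ[THEN mult_rewrite])
    also have "\<dots> = trace (L ** (J ** (transpose G ** (G ** J))))"
      by (subst trace_mul_sym) (simp add: mat_ring)
    also have "\<dots> = trace (mat 1 - (L - L ** J))" by (simp add: GG mat_ring KL)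
    also have "\<dots> = trace J" by (simp add: LJ)
    finally show ?thesis by (simp add: J_def coord_proj_trace)
  qed
  ultimately show ?thesis by (simp add: orth_proj_def)
qed

text \<open>An orthogonal projection projects onto its own image, so \<open>G\<close> may be any invertible \<open>P\<close> with
  \<open>E = P J P\<^sup>-\<^sup>1\<close>, where \<open>J\<close> is the coordinate projection of \<open>I\<close>. As \<open>E\<close> is symmetric, the Gram matrix of
  \<open>P\<close> has the explicit inverse \<open>J P\<^sup>-\<^sup>1 P\<^sup>-\<^sup>T J + (1 - J)\<close>.\<close>

lemma orth_proj_eq_span_proj:
  fixes E :: "complex^'n^'n" and I :: "'n set"
  assumes "E \<in> orth_proj (card I)"
  shows "\<exists>G. det (gram I G) \<noteq> 0 \<and> span_proj I G = E"
proof -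
  define J :: "complex^'n^'n" where "J = coord_proj I"
  have E: "transpose E = E" "E ** E = E" using assms by (auto simp: orth_proj_def)
  obtain P where P: "invertible P" "E ** P = P ** J"
    using idempotent_conj_coord_proj[OF E(2), of I] orth_proj_rank[OF assms] by (auto simp: J_def)
  define Q where "Q = matrix_inv P"
  have PQ: "P ** Q = mat 1" "Q ** P = mat 1" using P(1) by (simp_all add: Q_def matrix_inv_inverse)
  have tPQ: "transpose P ** transpose Q = mat 1" "transpose Q ** transpose P = mat 1"
    using PQ by (metis matrix_transpose_mul transpose_mat)+
  have JJ: "J ** J = J" by (simp add: J_def coord_proj_idem)
  have tJ: "transpose J = J" by (simp add: J_def coord_proj_transpose)
  have PJQ: "P ** (J ** Q) = E"
    using P(2) PQ by (metis matrix_mul_assoc matrix_mul_rid)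
  have QJP: "transpose Q ** (J ** transpose P) = E"
  proof -
    have "transpose (P ** (J ** Q)) = E" by (simp add: PJQ E)
    then show ?thesis by (simp add: matrix_transpose_mul tJ mat_ring)
  qed
  have PEQ: "transpose P ** (E ** transpose Q) = J"
    by (simp add: QJP[symmetric] mat_ring tPQ tPQ[THEN mult_rewrite])
  have K: "gram I P = J ** (transpose P ** (P ** J)) + (mat 1 - J)"
    by (simp add: gram_def J_def matrix_mul_assoc)
  define L where "L = J ** (Q ** (transpose Q ** J)) + (mat 1 - J)"
  have "J ** (transpose P ** (P ** (J ** (Q ** (transpose Q ** J)))))
      = J ** (transpose P ** ((P ** (J ** Q)) ** (transpose Q ** J)))" by (simp add: mat_ring)
  also have "\<dots> = J ** ((transpose P ** (E ** transpose Q)) ** J)" unfolding PJQ by (simp add: mat_ring)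
  also have "\<dots> = J" by (simp add: PEQ JJ)
  finally have *: "J ** (transpose P ** (P ** (J ** (Q ** (transpose Q ** J))))) = J" .
  have KL: "gram I P ** L = mat 1"
    by (simp add: K L_def mat_ring JJ JJ[THEN mult_rewrite] *)
  then have d: "det (gram I P) \<noteq> 0" by (metis invertible_det_nz invertible_right_inverse)
  have "span_proj I P = P ** (J ** (L ** (J ** transpose P)))"
    by (simp add: span_proj_def matrix_inv_unique[OF KL] J_def[symmetric] mat_ring)
  also have "\<dots> = P ** (J ** (Q ** (transpose Q ** (J ** transpose P))))"
    by (simp add: L_def mat_ring JJ JJ[THEN mult_rewrite])
  also have "\<dots> = (P ** (J ** Q)) ** (transpose Q ** (J ** transpose P))" by (simp add: mat_ring)
  also have "\<dots> = E" by (simp add: PJQ QJP E)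
  finally show ?thesis using d by blast
qed

text \<open>A generic subspace of dimension \<open>card I\<close> is the graph of a linear map from the coordinate subspace of
  \<open>I\<close> to that of the complement; \<open>B\<close> is the matrix of this map. Hence \<open>card I * (n - card I)\<close> parameters suffice
  generically. With \<open>N = J E J + (1 - J)\<close> one finds \<open>B = E J N\<^sup>-\<^sup>1 - J\<close>; the Gram matrix of \<open>1 + B\<close> is \<open>N\<^sup>-\<^sup>1\<close>. The
  resulting projection \<open>F = E J N\<^sup>-\<^sup>1 J E\<close> lies below \<open>E\<close> and has the same trace.\<close>

lemma orth_proj_chart:
  fixes E :: "complex^'n^'n" and I :: "'n set"
  assumes "E \<in> orth_proj (card I)"
    and "det (coord_proj I ** E ** coord_proj I + (mat 1 - coord_proj I)) \<noteq> 0"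
  shows "\<exists>B. coord_proj I ** B = 0 \<and> B ** coord_proj I = B
     \<and> det (gram I (mat 1 + B)) \<noteq> 0 \<and> span_proj I (mat 1 + B) = E"
proof -
  define J :: "complex^'n^'n" where "J = coord_proj I"
  have E: "transpose E = E" "E ** E = E" using assms by (auto simp: orth_proj_def)
  have JJ: "J ** J = J" by (simp add: J_def coord_proj_idem)
  have tJ: "transpose J = J" by (simp add: J_def coord_proj_transpose)
  define N where "N = J ** (E ** J) + (mat 1 - J)"
  define M where "M = matrix_inv N"
  have dN: "det N \<noteq> 0" using assms(2) by (simp add: N_def J_def matrix_mul_assoc)
  then have NM: "N ** M = mat 1" "M ** N = mat 1"
    by (simp_all add: M_def invertible_det_nz matrix_inv_inverse)
  have tN: "transpose N = N" by (simp add: N_def transpose_ring tJ E mat_ring)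
  have tM: "transpose M = M"
  proof -
    have "transpose (M ** N) = mat 1" using NM by simp
    then have "N ** transpose M = mat 1" by (simp add: matrix_transpose_mul tN)
    then show ?thesis using matrix_inv_unique M_def by metis
  qed
  have JN: "J ** N = N ** J" by (simp add: N_def mat_ring JJ JJ[THEN mult_rewrite])
  have JM: "J ** M = M ** J"
  proof -
    have "M ** (J ** N) ** M = M ** (N ** J) ** M" by (simp add: JN)
    then show ?thesis by (simp add: mat_ring NM NM[THEN mult_rewrite])
  qed
  have JEJ: "J ** (E ** J) = N - (mat 1 - J)" by (simp add: N_def)
  have NJ: "N ** J = N - (mat 1 - J)" by (simp add: N_def mat_ring JJ JJ[THEN mult_rewrite])
  have MJ: "M ** J = M - (mat 1 - J)"
  proof -
    have "M ** (N ** J) = M ** (N - (mat 1 - J))" by (simp add: NJ)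
    then show ?thesis by (simp add: mat_ring NM NM[THEN mult_rewrite] algebra_simps)
  qed
  have JEJM: "J ** (E ** (J ** M)) = J"
  proof -
    have "J ** (E ** (J ** M)) = (J ** (E ** J)) ** M" by (simp add: mat_ring)
    also have "\<dots> = J" unfolding JEJ by (simp add: mat_ring NM JM MJ)
    finally show ?thesis .
  qed
  define B where "B = E ** (J ** M) - J"
  have JB: "J ** B = 0" by (simp add: B_def mat_ring JEJM JJ)
  have BJ: "B ** J = B" by (simp add: B_def mat_ring JM[symmetric] JJ JJ[THEN mult_rewrite])
  have GJ: "(mat 1 + B) ** J = E ** (J ** M)" by (simp add: mat_ring BJ) (simp add: B_def)
  have "gram I (mat 1 + B) = transpose ((mat 1 + B) ** J) ** ((mat 1 + B) ** J) + (mat 1 - J)"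
    by (simp add: gram_def J_def[symmetric] matrix_transpose_mul tJ matrix_mul_assoc)
  also have "\<dots> = M ** (J ** (E ** (J ** M))) + (mat 1 - J)"
    unfolding GJ by (simp add: transpose_ring tJ tM E mat_ring E(2)[THEN mult_rewrite])
  also have "\<dots> = M" unfolding JEJM by (simp add: MJ)
  finally have gram: "gram I (mat 1 + B) = M" .
  have dM: "det M \<noteq> 0" using NM by (metis invertible_det_nz invertible_right_inverse)
  define F where "F = span_proj I (mat 1 + B)"
  have F: "F \<in> orth_proj (card I)" unfolding F_def by (rule span_proj_orth_proj) (simp add: gram dM)
  have "F = ((mat 1 + B) ** J) ** (N ** transpose ((mat 1 + B) ** J))"
    unfolding F_def span_proj_def gram matrix_inv_unique[OF NM(2)] J_def[symmetric]
    by (simp add: matrix_transpose_mul tJ matrix_mul_assoc)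
  then have FE: "F = E ** (J ** (M ** (J ** E)))"
    unfolding GJ by (simp add: transpose_ring tJ tM E mat_ring NM[THEN mult_rewrite] NM)
  have EF: "E ** F = F" "F ** E = F" by (simp_all add: FE mat_ring E(2) E(2)[THEN mult_rewrite])
  have "(E - F) ** (E - F) = E - F" using F by (simp add: mat_ring EF E orth_proj_def)
  moreover have "trace (E - F) = 0" using F assms(1) by (simp add: orth_proj_def trace_sub)
  ultimately have "E = F" using idempotent_trace_0[of "E - F"] by simp
  then show ?thesis using JB BJ gram dM by (auto simp: J_def F_def)
qed

section \<open>Pencils with two eigenvalues\<close>

lemma mem_pencil: "Z \<in> pencil X \<longleftrightarrow> (\<exists>a b. Z = cscale a (mat 1) + cscale b X)"
  unfolding pencil_def by (simp add: cmat.span_insert cmat.span_singleton diff_eq_eq add.commute)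

lemma mat_1_in_pencil: "mat 1 \<in> pencil X" and self_in_pencil: "X \<in> pencil X"
  by (simp_all add: pencil_def cmat.span_base)

lemma subspace_pencil: "cmat.subspace (pencil X)"
  by (simp add: pencil_def)

lemma pencil_eqI:
  fixes X Y :: "complex^'n^'n"
  assumes "X = cscale c Y + cscale d (mat 1)" "c \<noteq> 0"
  shows "pencil X = pencil Y"
proof -
  have "Y = cscale (1 / c) X - cscale (d / c) (mat 1)" using assms by (simp add: vec_eq_iff field_simps)
  moreover have "cscale (1 / c) X - cscale (d / c) (mat 1) \<in> pencil X" using subspace_pencil
    by (intro cmat.subspace_diff cmat.subspace_scale mat_1_in_pencil self_in_pencil)
  ultimately have "Y \<in> pencil X" by simp
  moreover have "X \<in> pencil Y" unfolding assms(1) using subspace_pencil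
    by (intro cmat.subspace_add cmat.subspace_scale mat_1_in_pencil self_in_pencil)
  moreover have "pencil A \<subseteq> pencil B" if "A \<in> pencil B" for A B :: "complex^'n^'n"
    unfolding pencil_def[of A] using that mat_1_in_pencil subspace_pencil by (intro cmat.span_minimal) auto
  ultimately show ?thesis by blast
qed

text \<open>The traceless representative of the pencil spanned by the identity and a projection of rank \<open>i\<close>.\<close>

definition centred :: "nat \<Rightarrow> complex^'n^'n \<Rightarrow> complex^'n^'n" where
  "centred i E = E - cscale (of_nat i / of_nat CARD('n)) (mat 1)"

lemma centred_orth_proj:
  fixes E :: "complex^'n^'n"
  assumes E: "E \<in> orth_proj i" and i: "0 < i" "i < CARD('n)"
  shows "centred i E \<in> traceless_symmetric" "centred i E \<noteq> 0"
proof -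
  show "centred i E \<in> traceless_symmetric"
    using E by (simp add: centred_def traceless_symmetric_def symmetric_matrices_def orth_proj_def
        transpose_ring trace_sub trace_cscale trace_I)
  show "centred i E \<noteq> 0"
  proof
    define c :: complex where "c = of_nat i / of_nat CARD('n)"
    assume "centred i E = 0"
    then have e: "E = cscale c (mat 1)" by (simp add: centred_def c_def)
    have "E ** E = E" using E by (simp add: orth_proj_def)
    then have "cscale (c * c) (mat 1 :: complex^'n^'n) = cscale c (mat 1)" by (simp add: e mat_ring)
    then have "cscale (c * c) (mat 1 :: complex^'n^'n) $ p $ p = cscale c (mat 1 :: complex^'n^'n) $ p $ p" for p
      by (simp only:)
    then have "c * c = c" unfolding cscale_nth by (simp add: mat_def)
    then have "c = 0 \<or> c = 1" by simp
    then have "of_nat i = (0 :: complex) \<or> of_nat i = (of_nat CARD('n) :: complex)"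
      using i by (auto simp: c_def)
    then show False using i by (auto simp only: of_nat_eq_0_iff of_nat_eq_iff)
  qed
qed

text \<open>For a diagonalizable \<open>X\<close> the product \<open>(X - a)(X - b)\<close> vanishes, so \<open>(X - b) / (a - b)\<close> is idempotent;
  its image is the eigenspace of \<open>a\<close>.\<close>

lemma two_eigenvalues_imp_idempotent:
  fixes X :: "complex^'n^'n"
  assumes "two_eigenvalues i X"
  shows "\<exists>E a b. a \<noteq> b \<and> E ** E = E \<and> trace E = of_nat i \<and> E = cscale (1 / (a - b)) (X - cscale b (mat 1))"
proof -
  obtain a b where ab: "a \<noteq> b" "eigenvalues X = {a, b}" "vec.dim (eigenspace X a) = i"
    using assms by (auto simp: two_eigenvalues_def)
  obtain P D :: "complex^'n^'n" where P: "invertible P" and D: "\<And>i j. i \<noteq> j \<Longrightarrow> D $ i $ j = 0"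
    and X: "X = P ** D ** matrix_inv P"
    using assms by (auto simp: two_eigenvalues_def diagonalizable_def)
  define Q where "Q = matrix_inv P"
  have PQ: "P ** Q = mat 1" "Q ** P = mat 1" using P by (simp_all add: Q_def matrix_inv_inverse)
  have Djj: "D $ j $ j = a \<or> D $ j $ j = b" for j
  proof -
    have "D *v axis j 1 = D $ j $ j *s axis j 1"
    proof -
      have "(D *v axis j 1) $ k = (\<Sum>l\<in>UNIV. if l = j then D $ k $ j else 0)" for k
        unfolding matrix_vector_mult_def vec_lambda_beta by (rule sum.cong) (auto simp: axis_def)
      then show ?thesis using D by (auto simp: vec_eq_iff axis_def)
    qed
    moreover have "X *v (P *v axis j 1) = P *v (D *v axis j 1)"
      by (simp add: X Q_def[symmetric] matrix_vector_mul_assoc mat_ring PQ)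
    ultimately have "X *v (P *v axis j 1) = D $ j $ j *s (P *v axis j 1)"
      by (simp add: vec.scale)
    moreover have "P *v axis j 1 \<noteq> 0"
    proof
      assume "P *v axis j 1 = 0"
      then have "Q *v (P *v axis j 1) = 0" by simp
      then show False by (simp add: matrix_vector_mul_assoc PQ)
    qed
    ultimately have "D $ j $ j \<in> eigenvalues X"
      unfolding eigenvalues_def eigenspace_def by blast
    then show ?thesis using ab by simp
  qed
  have DD: "(D - cscale b (mat 1)) ** (D - cscale a (mat 1)) = 0"
  proof -
    have "(D - cscale b (mat 1)) $ p $ k * (D - cscale a (mat 1)) $ k $ q = 0" for p k q
      using Djj[of k] D[of p k] D[of k q] by (auto simp: mat_def)
    then have "((D - cscale b (mat 1)) ** (D - cscale a (mat 1))) $ p $ q = 0" for p q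
      unfolding matrix_matrix_mult_def vec_lambda_beta by (intro sum.neutral) blast
    then show ?thesis by (simp add: vec_eq_iff)
  qed
  have conj: "X - cscale c (mat 1) = P ** ((D - cscale c (mat 1)) ** Q)" for c
    by (simp add: X Q_def[symmetric] mat_ring PQ)
  have "(X - cscale b (mat 1)) ** (X - cscale a (mat 1))
      = P ** (((D - cscale b (mat 1)) ** (D - cscale a (mat 1))) ** Q)"
    unfolding conj by (simp add: matrix_mul_assoc[symmetric] PQ(2)[THEN mult_rewrite])
  also have "\<dots> = 0" by (simp add: DD)
  finally have 0: "(X - cscale b (mat 1)) ** (X - cscale a (mat 1)) = 0" .
  define E where "E = cscale (1 / (a - b)) (X - cscale b (mat 1))"
  have X': "X - cscale b (mat 1) = (X - cscale a (mat 1)) + cscale (a - b) (mat 1)"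
    by (simp add: vec_eq_iff algebra_simps)
  have "(X - cscale b (mat 1)) ** (X - cscale b (mat 1))
      = (X - cscale b (mat 1)) ** ((X - cscale a (mat 1)) + cscale (a - b) (mat 1))" by (simp only: X'[symmetric])
  also have "\<dots> = cscale (a - b) (X - cscale b (mat 1))"
    by (simp only: matrix_add_ldistrib 0 cscale_mult_right matrix_mul_rid add_0)
  finally have EE: "E ** E = E" using ab(1) by (simp add: E_def cscale_mult_left cscale_mult_right)
  have "v \<in> range ((*v) E) \<longleftrightarrow> v \<in> eigenspace X a" for v
  proof -
    have Ev: "E *v v = (1 / (a - b)) *s (X *v v - b *s v)"
      by (simp add: E_def cscale_mult_vec matrix_vector_mult_diff_rdistrib)
    have "E *v v = v \<longleftrightarrow> X *v v = a *s v"
    proof -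
      have "1 / (a - b) * (x - b * y) = y \<longleftrightarrow> x = a * y" for x y
      proof -
        have "1 / (a - b) * (x - b * y) = y \<longleftrightarrow> x - b * y = y * (a - b)"
          using ab(1) by (simp add: nonzero_divide_eq_eq)
        then show ?thesis by (auto simp: algebra_simps)
      qed
      then show ?thesis unfolding Ev vec_eq_iff vector_smult_component vector_minus_component by simp
    qed
    then show ?thesis unfolding idempotent_range_iff[OF EE] eigenspace_def by simp
  qed
  then have "range ((*v) E) = eigenspace X a" by blast
  then have "trace E = of_nat i" using idempotent_trace[OF EE] ab(3) by simp
  then show ?thesis using ab(1) EE E_def by blast
qed

lemma two_eigenvalues_combination:
  fixes E :: "complex^'n^'n"
  assumes E: "E ** E = E" "trace E = of_nat i" and ab: "a \<noteq> b" and i: "0 < i" "i < CARD('n)"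
  shows "two_eigenvalues i (cscale a E + cscale b (mat 1 - E))" (is "two_eigenvalues i ?X")
proof -
  note C = idempotent_complement[OF E(1)]
  have rank: "vec.dim (range ((*v) E)) = i" using idempotent_trace[OF E(1)] E(2) by simp
  have corank: "vec.dim (range ((*v) (mat 1 - E))) = CARD('n) - i"
    using idempotent_rank_complement[OF E(1)] rank by simp
  have EX: "E ** ?X = cscale a E" and CX: "(mat 1 - E) ** ?X = cscale b (mat 1 - E)"
    by (simp_all add: mat_ring E(1))
  have Xv: "?X *v v = a *s (E *v v) + b *s ((mat 1 - E) *v v)" for v
    by (simp add: cscale_mult_vec matrix_vector_mult_add_rdistrib)
  have split: "v = E *v v + (mat 1 - E) *v v" for v :: "complex^'n"
    by (simp add: matrix_vector_mult_diff_rdistrib)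
  have parts: "a *s (E *v v) = \<mu> *s (E *v v)" "b *s ((mat 1 - E) *v v) = \<mu> *s ((mat 1 - E) *v v)"
    if "?X *v v = \<mu> *s v" for v \<mu>
  proof -
    have "E *v (?X *v v) = E *v (\<mu> *s v)" "(mat 1 - E) *v (?X *v v) = (mat 1 - E) *v (\<mu> *s v)"
      using that by simp_all
    then show "a *s (E *v v) = \<mu> *s (E *v v)" "b *s ((mat 1 - E) *v v) = \<mu> *s ((mat 1 - E) *v v)"
      unfolding matrix_vector_mul_assoc EX CX cscale_mult_vec by (simp_all add: vec.scale)
  qed
  have esa: "eigenspace ?X a = range ((*v) E)"
  proof (intro equalityI subsetI)
    fix v assume "v \<in> eigenspace ?X a"
    then have "b *s ((mat 1 - E) *v v) = a *s ((mat 1 - E) *v v)"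
      using parts(2)[of v a] by (simp add: eigenspace_def)
    then have "(mat 1 - E) *v v = 0" using ab by (simp add: vec_eq_iff)
    then show "v \<in> range ((*v) E)" using split[of v] by (metis add.right_neutral rangeI)
  next
    fix v assume "v \<in> range ((*v) E)"
    then have "E *v v = v" by (simp add: idempotent_range_iff[OF E(1)])
    then show "v \<in> eigenspace ?X a"
      unfolding eigenspace_def mem_Collect_eq Xv by (simp add: matrix_vector_mult_diff_rdistrib)
  qed
  have esb: "eigenspace ?X b = range ((*v) (mat 1 - E))"
  proof (intro equalityI subsetI)
    fix v assume "v \<in> eigenspace ?X b"
    then have "a *s (E *v v) = b *s (E *v v)"
      using parts(1)[of v b] by (simp add: eigenspace_def)
    then have "E *v v = 0" using ab by (simp add: vec_eq_iff)
    then show "v \<in> range ((*v) (mat 1 - E))" using split[of v] by (metis add.left_neutral rangeI)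
  next
    fix v assume "v \<in> range ((*v) (mat 1 - E))"
    then have "(mat 1 - E) *v v = v" by (simp add: idempotent_range_iff[OF C])
    then show "v \<in> eigenspace ?X b"
      unfolding eigenspace_def mem_Collect_eq Xv by (simp add: matrix_vector_mult_diff_rdistrib)
  qed
  have ne: "\<exists>v\<in>S. v \<noteq> 0" if "vec.dim S > 0" for S :: "(complex^'n) set"
  proof -
    have "\<not> S \<subseteq> {0}" using that vec.dim_eq_0[of S] by linarith
    then show ?thesis by blast
  qed
  have "eigenvalues ?X = {a, b}"
  proof (intro equalityI subsetI)
    fix \<mu> assume "\<mu> \<in> eigenvalues ?X"
    then obtain v where v: "v \<noteq> 0" "?X *v v = \<mu> *s v" by (auto simp: eigenvalues_def eigenspace_def)
    have "E *v v \<noteq> 0 \<or> (mat 1 - E) *v v \<noteq> 0" using split[of v] v(1) by auto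
    then show "\<mu> \<in> {a, b}"
      using parts[OF v(2)] by (auto simp: vec.scale_right_imp_eq)
  next
    fix \<mu> assume "\<mu> \<in> {a, b}"
    then show "\<mu> \<in> eigenvalues ?X"
      unfolding eigenvalues_def using ne[of "eigenspace ?X a"] ne[of "eigenspace ?X b"] esa esb rank corank i
      by auto
  qed
  moreover have "diagonalizable ?X"
  proof -
    obtain I :: "'n set" where I: "card I = vec.dim (range ((*v) E))"
      using i rank by (metis obtain_subset_with_card_n less_imp_le)
    obtain P where P: "invertible P" "E ** P = P ** coord_proj I"
      using idempotent_conj_coord_proj[OF E(1) I] by blast
    define D where "D = cscale a (coord_proj I) + cscale b (mat 1 - coord_proj I :: complex^'n^'n)"
    have "P ** D = ?X ** P" by (simp add: D_def mat_ring P(2))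
    then have "P ** D ** matrix_inv P = ?X"
      using P(1) by (simp add: matrix_mul_assoc[symmetric] matrix_inv_inverse)
    moreover have "\<forall>i j. i \<noteq> j \<longrightarrow> D $ i $ j = 0" by (simp add: D_def coord_proj_def mat_def)
    ultimately show ?thesis unfolding diagonalizable_def using P(1) by metis
  qed
  ultimately show ?thesis
    unfolding two_eigenvalues_def using ab esa esb rank corank by metis
qed

text \<open>A symmetric matrix with two eigenvalues is a combination of the identity and one symmetric idempotent,
  and the pencil forgets the coefficients.\<close>

lemma two_eigenvalue_pencils_eq:
  assumes i: "0 < i" "i < CARD('n)"
  shows "two_eigenvalue_pencils i = (\<lambda>E :: complex^'n^'n. pencil (centred i E)) ` orth_proj i"
proof (intro equalityI subsetI)
  fix L :: "(complex^'n^'n) set"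
  assume "L \<in> two_eigenvalue_pencils i"
  then obtain X :: "complex^'n^'n" where X: "L = pencil X" "transpose X = X" "two_eigenvalues i X"
    by (auto simp: two_eigenvalue_pencils_def symmetric_matrices_def)
  obtain E a b where E: "a \<noteq> b" "E ** E = E" "trace E = of_nat i" "E = cscale (1 / (a - b)) (X - cscale b (mat 1))"
    using two_eigenvalues_imp_idempotent[OF X(3)] by blast
  have "E \<in> orth_proj i" using E(2,3) X(2) by (simp add: orth_proj_def) (simp add: E(4) transpose_ring)
  moreover have "X = cscale (a - b) (centred i E)
      + cscale (b + (a - b) * (of_nat i / of_nat CARD('n))) (mat 1)"
  proof -
    have "X = cscale (a - b) E + cscale b (mat 1)" using E(1) by (simp add: E(4))
    then show ?thesis by (simp add: centred_def vec_eq_iff algebra_simps)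
  qed
  then have "pencil X = pencil (centred i E)" by (rule pencil_eqI) (use E(1) in simp)
  ultimately show "L \<in> (\<lambda>E. pencil (centred i E)) ` orth_proj i" using X(1) by blast
next
  fix L :: "(complex^'n^'n) set"
  assume "L \<in> (\<lambda>E. pencil (centred i E)) ` orth_proj i"
  then obtain E where E: "E \<in> orth_proj i" "L = pencil (centred i E)" by blast
  define X where "X = cscale 1 E + cscale 0 (mat 1 - E)"
  have "two_eigenvalues i X"
    unfolding X_def using E(1) i by (intro two_eigenvalues_combination) (auto simp: orth_proj_def)
  moreover have "transpose X = X" using E(1) by (simp add: X_def orth_proj_def)
  moreover have "X = cscale 1 (centred i E) + cscale (of_nat i / of_nat CARD('n)) (mat 1)"
    by (simp add: X_def centred_def)
  then have "pencil X = pencil (centred i E)" by (rule pencil_eqI) simp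
  ultimately show "L \<in> two_eigenvalue_pencils i"
    unfolding two_eigenvalue_pencils_def symmetric_matrices_def using E(2) by blast
qed

text \<open>The Jordan product is bilinear and the identity is its unit, so only the square of \<open>X\<close> has to be tested.\<close>

lemma pencil_in_Jo_iff:
  fixes X :: "complex^'n^'n"
  assumes X: "X \<in> traceless_symmetric" "X \<noteq> 0"
  shows "pencil X \<in> restricted_Jo \<longleftrightarrow> X ** X \<in> pencil X"
proof
  assume "pencil X \<in> restricted_Jo"
  then have "jordan_prod X X \<in> pencil X" using self_in_pencil by (auto simp: restricted_Jo_def)
  moreover have "jordan_prod X X = X ** X" by (simp add: jordan_prod_def vec_eq_iff)
  ultimately show "X ** X \<in> pencil X" by simp
next
  assume XX: "X ** X \<in> pencil X"
  have "jordan_prod Y Z \<in> pencil X" if YZ: "Y \<in> pencil X" "Z \<in> pencil X" for Y Z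
  proof -
    obtain a b c d where "Y = cscale a (mat 1) + cscale b X" "Z = cscale c (mat 1) + cscale d X"
      using YZ by (auto simp: mem_pencil)
    then have "jordan_prod Y Z = cscale (a * c) (mat 1) + cscale (a * d + b * c) X + cscale (b * d) (X ** X)"
      by (simp add: jordan_prod_def mat_ring) (simp add: vec_eq_iff algebra_simps)
    also have "\<dots> \<in> pencil X" using subspace_pencil XX
      by (intro cmat.subspace_add cmat.subspace_scale mat_1_in_pencil self_in_pencil)
    finally show ?thesis .
  qed
  then show "pencil X \<in> restricted_Jo" using pencil_in_Gr[OF X] by (simp add: restricted_Jo_def)
qed

lemma Gr_eq_pencil:
  "L \<in> restricted_Gr \<Longrightarrow> \<exists>X\<in>traceless_symmetric. X \<noteq> 0 \<and> L = pencil X"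
proof -
  assume L: "L \<in> restricted_Gr"
  obtain X where X: "X \<in> L" "trace X = 0" "X \<noteq> 0" using restricted_Gr_traceless[OF L] .
  have "X \<in> traceless_symmetric" using L X by (auto simp: restricted_Gr_def traceless_symmetric_def)
  then show ?thesis using restricted_Gr_line(1)[OF L X] X(3) by blast
qed

lemma centred_pencil_Jo:
  fixes E :: "complex^'n^'n"
  assumes E: "E \<in> orth_proj i" and i: "0 < i" "i < CARD('n)"
  shows "pencil (centred i E) \<in> restricted_Jo"
proof -
  have "E ** E = E" using E by (simp add: orth_proj_def)
  define c where "c = of_nat i / (of_nat CARD('n) :: complex)"
  have "centred i E ** centred i E = cscale (c - c * c) (mat 1) + cscale (1 - 2 * c) (centred i E)"
    by (simp add: centred_def c_def[symmetric] mat_ring \<open>E ** E = E\<close>) (simp add: vec_eq_iff algebra_simps)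
  then show ?thesis
    unfolding pencil_in_Jo_iff[OF centred_orth_proj[OF E i]] mem_pencil by blast
qed

text \<open>The orthogonal idempotents \<open>E\<close> and \<open>1 - E\<close> form a basis of the pencil.\<close>

lemma centred_pencil_iso:
  fixes E :: "complex^'n^'n"
  assumes E: "E \<in> orth_proj i" and i: "0 < i" "i < CARD('n)"
  shows "jordan_iso_CC (pencil (centred i E))"
proof -
  have EE: "E ** E = E" using E by (simp add: orth_proj_def)
  define c where "c = of_nat i / (of_nat CARD('n) :: complex)"
  define \<psi> where "\<psi> = (\<lambda>(x, y). cscale x E + cscale y (mat 1 - E))"
  have cE: "centred i E = E - cscale c (mat 1)" by (simp add: centred_def c_def)
  have inj: "inj \<psi>"
  proof (rule injI, clarify)
    fix x y x' y' assume *: "\<psi> (x, y) = \<psi> (x', y')"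
    then have "E ** \<psi> (x, y) = E ** \<psi> (x', y')" "(mat 1 - E) ** \<psi> (x, y) = (mat 1 - E) ** \<psi> (x', y')" by simp_all
    then have 1: "cscale x E = cscale x' E" "cscale y (mat 1 - E) = cscale y' (mat 1 - E)"
      by (simp_all add: \<psi>_def mat_ring EE)
    have "trace E \<noteq> 0" "trace (mat 1 - E) \<noteq> 0"
      using E i by (auto simp: orth_proj_def trace_sub trace_I)
    moreover have "x * trace E = x' * trace E" "y * trace (mat 1 - E) = y' * trace (mat 1 - E)"
      using 1 by (metis trace_cscale)+
    ultimately show "x = x' \<and> y = y'" by simp
  qed
  have range: "range \<psi> = pencil (centred i E)"
  proof (intro equalityI subsetI)
    fix Z assume "Z \<in> range \<psi>"
    then obtain x y where "Z = \<psi> (x, y)" by auto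
    then have "Z = cscale (y + (x - y) * c) (mat 1) + cscale (x - y) (centred i E)"
      by (simp add: \<psi>_def cE vec_eq_iff algebra_simps)
    then show "Z \<in> pencil (centred i E)" using mem_pencil by blast
  next
    fix Z assume "Z \<in> pencil (centred i E)"
    then obtain a b where "Z = cscale a (mat 1) + cscale b (centred i E)" using mem_pencil by blast
    then have "Z = \<psi> (a + b * (1 - c), a - b * c)"
      by (simp add: \<psi>_def cE vec_eq_iff algebra_simps)
    then show "Z \<in> range \<psi>" by blast
  qed
  define \<phi> where "\<phi> = inv \<psi>"
  have \<phi>: "\<phi> (\<psi> p) = p" for p using inj by (simp add: \<phi>_def)
  show ?thesis
    unfolding jordan_iso_CC_def
  proof (intro exI[of _ \<phi>] conjI ballI allI)
    show "bij_betw \<phi> (pencil (centred i E)) UNIV"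
      unfolding range[symmetric] \<phi>_def using inj by (simp add: inj_imp_bij_betw_inv)
    show "\<phi> (mat 1) = (1, 1)"
    proof -
      have "mat 1 = \<psi> (1, 1)" by (simp add: \<psi>_def)
      then show ?thesis using \<phi> by simp
    qed
    fix X assume "X \<in> pencil (centred i E)"
    then obtain x y where X: "X = \<psi> (x, y)" unfolding range[symmetric] by auto
    show "\<phi> (cscale t X) = (t * fst (\<phi> X), t * snd (\<phi> X))" for t
    proof -
      have "cscale t X = \<psi> (t * x, t * y)" by (simp add: X \<psi>_def vec_eq_iff algebra_simps)
      then show ?thesis using \<phi> X by simp
    qed
    fix Y assume "Y \<in> pencil (centred i E)"
    then obtain x' y' where Y: "Y = \<psi> (x', y')" unfolding range[symmetric] by auto
    have "X + Y = \<psi> (x + x', y + y')" by (simp add: X Y \<psi>_def vec_eq_iff algebra_simps)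
    then show "\<phi> (X + Y) = \<phi> X + \<phi> Y" using \<phi> X Y by simp
    have "jordan_prod X Y = \<psi> (x * x', y * y')"
      by (simp add: X Y \<psi>_def jordan_prod_def mat_ring EE) (simp add: vec_eq_iff algebra_simps)
    then show "\<phi> (jordan_prod X Y) = (fst (\<phi> X) * fst (\<phi> Y), snd (\<phi> X) * snd (\<phi> Y))"
      using \<phi> X Y by simp
  qed
qed

section \<open>Square-zero matrices as limits of symmetric idempotents\<close>

lemma generalised_inverse_exists:
  fixes X :: "complex^'n^'n"
  shows "\<exists>Z. X ** (Z ** X) = X"
proof -
  obtain g where g: "Vector_Spaces.linear (*s) (*s) g" "\<forall>v\<in>range ((*v) X). X *v g v = v"
    using vec.linear_exists_right_inverse_on[OF matrix_vector_mul_linear_gen vec.subspace_UNIV, of X] by blast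
  have "(X ** (matrix g ** X)) *v v = X *v v" for v
    using g by (simp add: matrix_vector_mul_assoc[symmetric] matrix_works[OF g(1)])
  then show ?thesis by (auto simp: matrix_eq)
qed

text \<open>With a generalised inverse, \<open>trace X = trace (X Z X) = trace (Z X X) = 0\<close>.\<close>

lemma square_zero_trace:
  fixes X :: "complex^'n^'n"
  assumes "X ** X = 0"
  shows "trace X = 0"
proof -
  obtain Z where "X ** (Z ** X) = X" using generalised_inverse_exists by blast
  then have "trace X = trace ((Z ** X) ** X)" using trace_mul_sym[of X "Z ** X"] by simp
  then show ?thesis by (simp add: matrix_mul_assoc[symmetric] assms) (simp add: trace_def)
qed

text \<open>The image of \<open>X\<close> is isotropic; the image of \<open>Z\<close> is an isotropic space in duality with it. An arbitrary
  generalised inverse is first symmetrised and made reflexive. Its image is then corrected by the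
  Gram-Schmidt-like shear \<open>S = 1 - X Z / 2\<close>, which moves it along the image of \<open>X\<close> until it becomes isotropic.\<close>

lemma symmetric_square_zero_inverse:
  fixes X :: "complex^'n^'n"
  assumes X: "transpose X = X" "X ** X = 0"
  shows "\<exists>Z. transpose Z = Z \<and> X ** (Z ** X) = X \<and> Z ** (X ** Z) = Z \<and> Z ** Z = 0"
proof -
  obtain Z0 where Z0: "X ** (Z0 ** X) = X" using generalised_inverse_exists by blast
  \<comment> \<open>Averaging with the transpose makes the generalised inverse symmetric.\<close>
  define Z1 where "Z1 = cscale (1 / 2) (Z0 + transpose Z0)"
  have "X ** (transpose Z0 ** X) = transpose (X ** (Z0 ** X))"
    by (simp add: transpose_ring X mat_ring)
  then have tZ0: "X ** (transpose Z0 ** X) = X" using Z0 X by simp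
  have tZ1: "transpose Z1 = Z1" by (simp add: Z1_def transpose_ring add.commute)
  have Z1: "X ** (Z1 ** X) = X"
    by (simp add: Z1_def mat_ring Z0 tZ0) (simp add: vec_eq_iff)
  have Z1': "X ** (Z1 ** (X ** Y)) = X ** Y" for Y :: "complex^'n^'n" using arg_cong[OF Z1, of "\<lambda>A. A ** Y"] by (simp add: mat_ring)
  \<comment> \<open>Now also \<open>Z ** (X ** Z) = Z\<close>.\<close>
  define Z where "Z = Z1 ** (X ** Z1)"
  have tZ: "transpose Z = Z" by (simp add: Z_def transpose_ring tZ1 X mat_ring)
  have XZX: "X ** (Z ** X) = X" by (simp add: Z_def mat_ring Z1 Z1')
  have XZX': "X ** (Z ** (X ** Y)) = X ** Y" for Y :: "complex^'n^'n" using arg_cong[OF XZX, of "\<lambda>A. A ** Y"] by (simp add: mat_ring)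
  have ZXZ: "Z ** (X ** Z) = Z" by (simp add: Z_def mat_ring Z1')
  have ZXZ': "Z ** (X ** (Z ** Y)) = Z ** Y" for Y :: "complex^'n^'n" using arg_cong[OF ZXZ, of "\<lambda>A. A ** Y"] by (simp add: mat_ring)
  define S where "S = mat 1 - cscale (1 / 2) (X ** Z)"
  have tS: "transpose S = mat 1 - cscale (1 / 2) (Z ** X)"
    by (simp add: S_def transpose_ring X tZ)
  define Y where "Y = S ** (Z ** transpose S)"
  have XS: "X ** (S ** A) = X ** A" for A :: "complex^'n^'n"
    by (simp add: S_def mat_ring X(2)[THEN mult_rewrite])
  have SX: "transpose S ** X = X"
    by (simp add: tS mat_ring X)
  have SX': "transpose S ** (X ** A) = X ** A" for A :: "complex^'n^'n" using SX by (simp add: matrix_mul_assoc)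
  have "Z ** (transpose S ** (S ** Z)) = 0"
    unfolding tS by (simp add: S_def mat_ring X(2)[THEN mult_rewrite] ZXZ ZXZ') (simp add: vec_eq_iff)
  then have "(Z ** (transpose S ** (S ** Z))) ** A = 0" for A :: "complex^'n^'n" by simp
  then have "Z ** (transpose S ** (S ** (Z ** A))) = 0" for A :: "complex^'n^'n"
    by (simp add: matrix_mul_assoc)
  then have "Y ** Y = 0" by (simp add: Y_def mat_ring)
  moreover have "transpose Y = Y" by (simp add: Y_def transpose_ring tZ mat_ring)
  moreover have "X ** (Y ** X) = X" by (simp add: Y_def mat_ring XS SX XZX)
  moreover have "Y ** (X ** Y) = Y" by (simp add: Y_def mat_ring XS SX' ZXZ')
  ultimately show ?thesis by blast
qed

text \<open>With \<open>Z\<close> dual to \<open>X\<close> as above, \<open>Q = X Z + Z X\<close> is a symmetric idempotent of rank \<open>2 r\<close>, where \<open>r\<close>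
  is the rank of \<open>X\<close>, and \<open>Y = X / s + s Z\<close> is a square root of \<open>Q\<close>. So \<open>(Q + Y) / 2\<close> is a projection of
  rank \<open>r\<close>; multiplied by \<open>2 s\<close> it tends to \<open>X\<close> for \<open>s \<rightarrow> 0\<close>.\<close>

lemma square_zero_is_limit:
  fixes X :: "complex^'n^'n"
  assumes X: "transpose X = X" "X ** X = 0" "X \<noteq> 0"
  shows "\<exists>r Q Z. 0 < r \<and> 2 * r \<le> CARD('n) \<and>
    (\<forall>s. s \<noteq> 0 \<longrightarrow> (\<exists>E\<in>orth_proj r. X + cscale s Q + cscale (s * s) Z = cscale (2 * s) E))"
proof -
  obtain Z where Z: "transpose Z = Z" "X ** (Z ** X) = X" "Z ** (X ** Z) = Z" "Z ** Z = 0"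
    using symmetric_square_zero_inverse[OF X(1,2)] by blast
  have XZX': "X ** (Z ** (X ** Y)) = X ** Y" for Y :: "complex^'n^'n" using arg_cong[OF Z(2), of "\<lambda>A. A ** Y"] by (simp add: mat_ring)
  have ZXZ': "Z ** (X ** (Z ** Y)) = Z ** Y" for Y :: "complex^'n^'n" using arg_cong[OF Z(3), of "\<lambda>A. A ** Y"] by (simp add: mat_ring)
  define Q where "Q = X ** Z + Z ** X"
  note rel = mat_ring X(2) X(2)[THEN mult_rewrite] Z(2,3) Z(4) Z(4)[THEN mult_rewrite] XZX' ZXZ'
  have QQ: "Q ** Q = Q" by (simp add: Q_def rel)
  have tQ: "transpose Q = Q" by (simp add: Q_def transpose_ring X Z)
  define r where "r = vec.dim (range ((*v) (X ** Z)))"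
  have idem: "(X ** Z) ** (X ** Z) = X ** Z" by (simp add: rel)
  have tr: "trace (X ** Z) = of_nat r" unfolding r_def by (rule idempotent_trace[OF idem])
  have trQ: "trace Q = of_nat (2 * r)" using tr trace_mul_sym[of X Z] by (simp add: Q_def trace_add)
  have "r \<noteq> 0"
  proof
    assume "r = 0"
    then have "X ** Z = 0" using idempotent_trace_0[OF idem] tr by simp
    then have "X ** (Z ** X) = 0" by (simp add: matrix_mul_assoc)
    then show False using Z(2) X(3) by simp
  qed
  moreover have "2 * r \<le> CARD('n)"
    using orth_proj_card_le[of Q "2 * r"] QQ tQ trQ by (simp add: orth_proj_def)
  moreover have "\<exists>E\<in>orth_proj r. X + cscale s Q + cscale (s * s) Z = cscale (2 * s) E" if s: "s \<noteq> 0" for s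
  proof -
    define Y where "Y = cscale (1 / s) X + cscale s Z"
    have YY: "Y ** Y = Q" using s by (simp add: Y_def Q_def rel)
    have QY: "Q ** Y = Y" "Y ** Q = Y" by (simp_all add: Y_def Q_def rel)
    define E where "E = cscale (1 / 2) (Q + Y)"
    have "E ** E = E" by (simp add: E_def mat_ring QQ QY YY) (simp add: vec_eq_iff field_simps)
    moreover have "transpose E = E" by (simp add: E_def Y_def transpose_ring X Z tQ)
    moreover have "trace E = of_nat r"
      using square_zero_trace[OF X(2)] square_zero_trace[OF Z(4)]
      by (simp add: E_def Y_def trace_cscale trace_add trQ)
    ultimately have "E \<in> orth_proj r" by (simp add: orth_proj_def)
    moreover have "X + cscale s Q + cscale (s * s) Z = cscale (2 * s) E"
      using s by (simp add: E_def Y_def vec_eq_iff field_simps)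
    ultimately show ?thesis by blast
  qed
  ultimately show ?thesis by (metis gr0I)
qed

text \<open>A quadratic equation for \<open>X\<close> becomes \<open>Y\<^sup>2 = \<rho>\<close> after completing the square. If \<open>\<rho> \<noteq> 0\<close> then
  \<open>(1 + Y / sqrt \<rho>) / 2\<close> is idempotent, and passing to its complement if necessary its rank is at most \<open>n / 2\<close>.
  If \<open>\<rho> = 0\<close> then \<open>Y\<close> is nilpotent, so both \<open>X\<close> and \<open>Y\<close> are traceless and they coincide.\<close>

lemma Jo_pencil_cases:
  fixes X :: "complex^'n^'n"
  assumes X: "X \<in> traceless_symmetric" "X \<noteq> 0" and Jo: "pencil X \<in> restricted_Jo"
  shows "X ** X = 0 \<or> (\<exists>i. 0 < i \<and> 2 * i \<le> CARD('n) \<and> (\<exists>E\<in>orth_proj i. pencil X = pencil (centred i E)))"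
proof -
  have tX: "transpose X = X" "trace X = 0"
    using X by (auto simp: traceless_symmetric_def symmetric_matrices_def)
  obtain b a where ab: "X ** X = cscale b (mat 1) + cscale a X"
    using Jo pencil_in_Jo_iff[OF X] by (auto simp: mem_pencil)
  define Y where "Y = X - cscale (a / 2) (mat 1)"
  define \<rho> where "\<rho> = b + a * a / 4"
  have YY: "Y ** Y = cscale \<rho> (mat 1)"
    by (simp add: Y_def \<rho>_def mat_ring ab) (simp add: vec_eq_iff field_simps)
  show ?thesis
  proof (cases "\<rho> = 0")
    case True
    then have "trace Y = 0" using YY square_zero_trace[of Y] by simp
    then have "a = 0" using tX by (simp add: Y_def trace_sub trace_cscale trace_I)
    then show ?thesis using YY True by (simp add: Y_def)
  next
    case False
    define w where "w = csqrt \<rho>"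
    have w: "w * w = \<rho>" "w \<noteq> 0" using False by (auto simp: w_def power2_eq_square[symmetric])
    define E where "E = cscale (1 / 2) (mat 1 + cscale (1 / w) Y)"
    have EE: "E ** E = E"
      using w(2) by (simp add: E_def mat_ring YY w(1)[symmetric]) (simp add: vec_eq_iff field_simps)
    have tE: "transpose E = E" by (simp add: E_def Y_def transpose_ring tX)
    define i where "i = vec.dim (range ((*v) E))"
    have E: "E \<in> orth_proj i" using EE tE idempotent_trace[OF EE] by (simp add: orth_proj_def i_def)
    have X': "X = cscale (2 * w) E + cscale (a / 2 - w) (mat 1)"
      using w(2) by (simp add: E_def Y_def vec_eq_iff field_simps)
    have i_le: "i \<le> CARD('n)" by (rule orth_proj_card_le[OF E])
    have scal: "X \<noteq> cscale c (mat 1)" for c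
    proof
      assume "X = cscale c (mat 1)"
      then show False using X(2) tX(2) by (simp add: trace_cscale trace_I)
    qed
    have C: "mat 1 - E \<in> orth_proj (CARD('n) - i)" by (rule orth_proj_complement[OF E i_le])
    have "i \<noteq> 0"
    proof
      assume "i = 0"
      then have "E = 0" using idempotent_trace_0[OF EE] E by (simp add: orth_proj_def)
      then show False using X' scal by simp
    qed
    moreover have "CARD('n) - i \<noteq> 0"
    proof
      assume "CARD('n) - i = 0"
      then have "mat 1 - E = 0" using idempotent_trace_0[of "mat 1 - E"] C by (simp add: orth_proj_def)
      then have "X = cscale (2 * w + (a / 2 - w)) (mat 1)" using X' by (simp add: vec_eq_iff algebra_simps)
      then show False using scal by blast
    qed
    moreover have "pencil X = pencil (centred i E)"
      by (rule pencil_eqI[of _ "2 * w" _ "a / 2 - w + 2 * w * (of_nat i / of_nat CARD('n))"])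
        (use w(2) in \<open>simp_all add: X' centred_def vec_eq_iff algebra_simps\<close>)
    moreover have "pencil X = pencil (centred (CARD('n) - i) (mat 1 - E))"
      by (rule pencil_eqI[of _ "- 2 * w" _
            "a / 2 - w + 2 * w * (1 - of_nat (CARD('n) - i) / of_nat CARD('n))"])
        (use w(2) in \<open>simp_all add: X' centred_def vec_eq_iff algebra_simps\<close>)
    ultimately have
      "0 < i \<and> (\<exists>E\<in>orth_proj i. pencil X = pencil (centred i E))"
      "0 < CARD('n) - i \<and> (\<exists>E\<in>orth_proj (CARD('n) - i). pencil X = pencil (centred (CARD('n) - i) E))"
      using E C by blast+
    moreover have "2 * i \<le> CARD('n) \<or> 2 * (CARD('n) - i) \<le> CARD('n)" using i_le by linarith
    ultimately show ?thesis by blast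
  qed
qed

section \<open>Forms, closed sets and irreducibility\<close>

lemma traceless_symmetric_subspace: "cmat.subspace traceless_symmetric"
  by (simp add: cmat.subspace_def traceless_symmetric_def symmetric_matrices_def transpose_ring
      trace_add trace_cscale) (simp add: trace_def transpose_def vec_eq_iff)

lemma pencil_inter_traceless:
  assumes "X \<in> traceless_symmetric" "X \<noteq> 0"
  shows "pencil X \<inter> traceless_symmetric = range (\<lambda>c. cscale c X)"
  using restricted_Gr_line(2)[OF pencil_in_Gr[OF assms] self_in_pencil] assms
  by (simp add: traceless_symmetric_def cmat.span_singleton)

lemma pencil_eq_traceless:
  assumes "X \<in> traceless_symmetric" "X \<noteq> 0" "Y \<in> traceless_symmetric" "pencil X = pencil Y"
  shows "\<exists>c. Y = cscale c X"
  using pencil_inter_traceless[OF assms(1,2)] assms(3,4) self_in_pencil by blast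

lemma form_vanishes_on_pencil_iff:
  assumes X: "X \<in> traceless_symmetric" "X \<noteq> 0" and f: "hom_poly k f"
  shows "(\<forall>Y\<in>pencil X \<inter> traceless_symmetric. f Y = 0) \<longleftrightarrow> f X = 0"
  using pencil_inter_traceless[OF X] X self_in_pencil
  by (auto simp: hom_poly_scale[OF f])

text \<open>The affine cone over a set of points of the projective space, without its vertex. Through it,
  statements about closed sets of pencils become statements about matrices.\<close>

definition affine_cone :: "(complex^'n^'n) set set \<Rightarrow> (complex^'n^'n) set" where
  "affine_cone Z = {X \<in> traceless_symmetric. X \<noteq> 0 \<and> pencil X \<in> Z}"

text \<open>The affine cone over the Zariski closure of the pencils of \<open>C\<close>.\<close>

definition hull_of_forms :: "(complex^'n^'n) set \<Rightarrow> (complex^'n^'n) set" where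
  "hull_of_forms C = {X \<in> traceless_symmetric. X \<noteq> 0 \<and>
     (\<forall>k f. hom_poly k f \<longrightarrow> (\<forall>Y\<in>C. f Y = 0) \<longrightarrow> f X = 0)}"

lemma hull_of_forms_mono: "C \<subseteq> C' \<Longrightarrow> hull_of_forms C \<subseteq> hull_of_forms C'"
  unfolding hull_of_forms_def by blast

lemma subset_hull_of_forms: "C \<subseteq> traceless_symmetric - {0} \<Longrightarrow> C \<subseteq> hull_of_forms C"
  unfolding hull_of_forms_def by blast

lemma pencil_in_Gr_zeros_iff:
  assumes "X \<in> traceless_symmetric" "X \<noteq> 0" "\<forall>f\<in>F. \<exists>k. hom_poly k f"
  shows "pencil X \<in> Gr_zeros F \<longleftrightarrow> (\<forall>f\<in>F. f X = 0)"
proof -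
  have "(\<forall>Y\<in>pencil X \<inter> traceless_symmetric. f Y = 0) \<longleftrightarrow> f X = 0" if "f \<in> F" for f
    using form_vanishes_on_pencil_iff[OF assms(1,2)] assms(3) that by blast
  then show ?thesis unfolding Gr_zeros_def using pencil_in_Gr[OF assms(1,2)] by blast
qed

lemma cone_point_exists: "Z \<subseteq> restricted_Gr \<Longrightarrow> L \<in> Z \<Longrightarrow> \<exists>X\<in>affine_cone Z. L = pencil X"
  using Gr_eq_pencil[of L] by (auto simp: affine_cone_def)

lemma closure_of_pencils:
  fixes C :: "(complex^'n^'n) set"
  assumes C: "C \<subseteq> traceless_symmetric - {0}"
  shows "Gr_zariski closure_of (pencil ` C) = pencil ` hull_of_forms C"
proof (rule closure_of_unique)
  define F where "F = {f. \<exists>k. hom_poly k f \<and> (\<forall>Y\<in>C. f Y = 0)}"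
  have F: "\<forall>f\<in>F. \<exists>k. hom_poly k f" by (auto simp: F_def)
  have "pencil ` hull_of_forms C = Gr_zeros F"
  proof (intro equalityI subsetI)
    fix L assume "L \<in> pencil ` hull_of_forms C"
    then obtain X where X: "X \<in> hull_of_forms C" "L = pencil X" by blast
    then have "\<forall>f\<in>F. f X = 0" by (auto simp: hull_of_forms_def F_def)
    then show "L \<in> Gr_zeros F" using pencil_in_Gr_zeros_iff[of X F] X F by (simp add: hull_of_forms_def)
  next
    fix L assume L: "L \<in> Gr_zeros F"
    then have "L \<in> restricted_Gr" by (simp add: Gr_zeros_def)
    then obtain X where X: "X \<in> traceless_symmetric" "X \<noteq> 0" "L = pencil X" using Gr_eq_pencil by blast
    then have "\<forall>f\<in>F. f X = 0" using L pencil_in_Gr_zeros_iff[of X F] F by simp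
    then have "X \<in> hull_of_forms C" using X by (auto simp: hull_of_forms_def F_def)
    then show "L \<in> pencil ` hull_of_forms C" using X by blast
  qed
  then show "closedin Gr_zariski (pencil ` hull_of_forms C)"
    unfolding closedin_Gr_zariski Gr_algebraic_def using F by blast
  show "pencil ` C \<subseteq> pencil ` hull_of_forms C"
    using C by (intro image_mono) (auto simp: hull_of_forms_def)
  fix T :: "(complex^'n^'n) set set"
  assume "pencil ` C \<subseteq> T" "closedin Gr_zariski T"
  then obtain G where T: "pencil ` C \<subseteq> Gr_zeros G" "T = Gr_zeros G" and G: "\<forall>f\<in>G. \<exists>k. hom_poly k f"
    unfolding closedin_Gr_zariski Gr_algebraic_def by blast
  have G0: "g Y = 0" if "g \<in> G" "Y \<in> C" for g Y
  proof -
    have "pencil Y \<in> Gr_zeros G" using T(1) that by blast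
    then show ?thesis using pencil_in_Gr_zeros_iff[of Y G] C G that by blast
  qed
  show "pencil ` hull_of_forms C \<subseteq> T"
  proof clarify
    fix X assume X: "X \<in> hull_of_forms C"
    have "g X = 0" if g: "g \<in> G" for g
    proof -
      obtain k where "hom_poly k g" using G g by blast
      then show ?thesis using X G0[OF g] unfolding hull_of_forms_def by blast
    qed
    then show "pencil X \<in> T" unfolding T(2)
      using X G by (subst pencil_in_Gr_zeros_iff) (auto simp: hull_of_forms_def)
  qed
qed

text \<open>Traceless generators of the same pencil are proportional, and zero sets of forms are closed under scaling.\<close>

lemma cone_pencils_hull:
  "affine_cone (pencil ` hull_of_forms C) = hull_of_forms C"
proof
  show "affine_cone (pencil ` hull_of_forms C) \<subseteq> hull_of_forms C"
  proof
    fix X assume "X \<in> affine_cone (pencil ` hull_of_forms C)"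
    then obtain Y where X: "X \<in> traceless_symmetric" "X \<noteq> 0" and Y: "Y \<in> hull_of_forms C" "pencil Y = pencil X"
      by (auto simp: affine_cone_def)
    then obtain c where c: "X = cscale c Y" using pencil_eq_traceless[of Y X] by (auto simp: hull_of_forms_def)
    have "f X = 0" if "hom_poly k f" "\<forall>Y\<in>C. f Y = 0" for k f
    proof -
      have "f Y = 0" using Y(1) that by (auto simp: hull_of_forms_def)
      then show ?thesis by (simp add: c hom_poly_scale[OF that(1)])
    qed
    then show "X \<in> hull_of_forms C" using X by (auto simp: hull_of_forms_def)
  qed
qed (auto simp: affine_cone_def hull_of_forms_def)

text \<open>The homogeneous ideal of \<open>C\<close> is prime, tested on homogeneous elements only.\<close>

definition prime_on :: "(complex^'n^'n) set \<Rightarrow> bool" where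
  "prime_on C \<longleftrightarrow> (\<forall>k l f g. hom_poly k f \<longrightarrow> hom_poly l g \<longrightarrow> (\<forall>X\<in>C. f X * g X = 0) \<longrightarrow>
     (\<forall>X\<in>C. f X = 0) \<or> (\<forall>X\<in>C. g X = 0))"

lemma irreducible_closure_of_pencils:
  fixes C :: "(complex^'n^'n) set"
  assumes C: "C \<subseteq> traceless_symmetric - {0}" "C \<noteq> {}" and "prime_on C"
  shows "irreducible_in Gr_zariski (Gr_zariski closure_of (pencil ` C))"
  unfolding irreducible_in_def
proof (intro conjI allI impI)
  show "Gr_zariski closure_of (pencil ` C) \<subseteq> topspace Gr_zariski" by (rule closure_of_subset_topspace)
  have sub: "pencil ` C \<subseteq> pencil ` hull_of_forms C"
    using C by (intro image_mono) (auto simp: hull_of_forms_def)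
  then show "Gr_zariski closure_of (pencil ` C) \<noteq> {}"
    unfolding closure_of_pencils[OF C(1)] using C(2) by blast
  fix A B :: "(complex^'n^'n) set set"
  assume AB: "closedin Gr_zariski A \<and> closedin Gr_zariski B \<and> Gr_zariski closure_of (pencil ` C) \<subseteq> A \<union> B"
  obtain F where F: "A = Gr_zeros F" "\<forall>f\<in>F. \<exists>k. hom_poly k f"
    using AB unfolding closedin_Gr_zariski Gr_algebraic_def by blast
  obtain G where G: "B = Gr_zeros G" "\<forall>f\<in>G. \<exists>k. hom_poly k f"
    using AB unfolding closedin_Gr_zariski Gr_algebraic_def by blast
  have witness: "\<exists>f\<in>F. \<exists>Y\<in>C. f Y \<noteq> 0"
    if n: "\<not> Gr_zariski closure_of (pencil ` C) \<subseteq> Gr_zeros F" and F: "\<forall>f\<in>F. \<exists>k. hom_poly k f"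
    for F :: "(complex^'n^'n \<Rightarrow> complex) set"
  proof -
    obtain X where X: "X \<in> hull_of_forms C" "pencil X \<notin> Gr_zeros F"
      using n unfolding closure_of_pencils[OF C(1)] by blast
    then obtain f where f: "f \<in> F" "f X \<noteq> 0"
      using pencil_in_Gr_zeros_iff[of X F] F by (auto simp: hull_of_forms_def)
    then show ?thesis using X(1) F unfolding hull_of_forms_def by blast
  qed
  show "Gr_zariski closure_of (pencil ` C) \<subseteq> A \<or> Gr_zariski closure_of (pencil ` C) \<subseteq> B"
  proof (rule ccontr)
    assume "\<not> ?thesis"
    then have n: "\<not> Gr_zariski closure_of (pencil ` C) \<subseteq> Gr_zeros F"
      "\<not> Gr_zariski closure_of (pencil ` C) \<subseteq> Gr_zeros G" unfolding F(1) G(1) by auto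
    obtain f where f: "f \<in> F" "\<exists>Y\<in>C. f Y \<noteq> 0" using witness[OF n(1) F(2)] by blast
    obtain g where g: "g \<in> G" "\<exists>Y\<in>C. g Y \<noteq> 0" using witness[OF n(2) G(2)] by blast
    obtain k l where kl: "hom_poly k f" "hom_poly l g" using f g F(2) G(2) by blast
    have "\<not> (\<forall>X\<in>C. f X * g X = 0)"
      using assms(3)[unfolded prime_on_def, rule_format, OF kl] f g by blast
    then obtain Y where Y: "Y \<in> C" "f Y \<noteq> 0" "g Y \<noteq> 0" by auto
    then have W: "Y \<in> traceless_symmetric" "Y \<noteq> 0" using C(1) by auto
    have "pencil Y \<in> Gr_zeros F \<union> Gr_zeros G"
      using AB sub Y(1) unfolding closure_of_pencils[OF C(1)] F(1) G(1) by blast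
    moreover have "pencil Y \<notin> Gr_zeros F"
      unfolding pencil_in_Gr_zeros_iff[OF W F(2)] using f(1) Y by blast
    moreover have "pencil Y \<notin> Gr_zeros G"
      unfolding pencil_in_Gr_zeros_iff[OF W G(2)] using g(1) Y by blast
    ultimately show False by blast
  qed
qed

lemma prime_on_cone:
  assumes Z: "irreducible_in Gr_zariski Z"
  shows "prime_on (affine_cone (Z :: (complex^'n^'n) set set))"
  unfolding prime_on_def
proof (intro allI impI)
  fix k l and f g :: "complex^'n^'n \<Rightarrow> complex"
  assume f: "hom_poly k f" and g: "hom_poly l g" and fg: "\<forall>X\<in>affine_cone Z. f X * g X = 0"
  have ZG: "Z \<subseteq> restricted_Gr" using Z by (simp add: irreducible_in_def topspace_Gr_zariski)
  have cl: "closedin Gr_zariski (Gr_zeros {h})" if "hom_poly j h" for j and h :: "complex^'n^'n \<Rightarrow> complex"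
    unfolding closedin_Gr_zariski Gr_algebraic_def using that by blast
  have mem: "pencil X \<in> Gr_zeros {h} \<longleftrightarrow> h X = 0" if "X \<in> affine_cone Z" "hom_poly j h" for X h j
    using pencil_in_Gr_zeros_iff[of X "{h}"] that by (auto simp: affine_cone_def)
  have "Z \<subseteq> Gr_zeros {f} \<union> Gr_zeros {g}"
  proof
    fix L assume "L \<in> Z"
    then obtain X where X: "X \<in> affine_cone Z" "L = pencil X" using cone_point_exists[OF ZG] by blast
    then have "f X = 0 \<or> g X = 0" using fg by simp
    then show "L \<in> Gr_zeros {f} \<union> Gr_zeros {g}" using mem[OF X(1) f] mem[OF X(1) g] X(2) by blast
  qed
  then have "Z \<subseteq> Gr_zeros {f} \<or> Z \<subseteq> Gr_zeros {g}"
    using Z cl[OF f] cl[OF g] unfolding irreducible_in_def by blast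
  then show "(\<forall>X\<in>affine_cone Z. f X = 0) \<or> (\<forall>X\<in>affine_cone Z. g X = 0)"
    using mem[OF _ f] mem[OF _ g] by (auto simp: affine_cone_def)
qed

lemma form_separating_closed:
  assumes "closedin Gr_zariski Z" "Z \<subset> Z'" "Z' \<subseteq> restricted_Gr"
  shows "\<exists>k g. hom_poly k g \<and> (\<forall>X\<in>affine_cone Z. g X = 0) \<and> (\<exists>X\<in>affine_cone Z'. g X \<noteq> 0)"
proof -
  obtain F where F: "Z = Gr_zeros F" "\<forall>f\<in>F. \<exists>k. hom_poly k f"
    using assms(1) unfolding closedin_Gr_zariski Gr_algebraic_def by blast
  obtain L where "L \<in> Z'" "L \<notin> Z" using assms(2) by blast
  then obtain X where X: "X \<in> affine_cone Z'" "pencil X \<notin> Z" using cone_point_exists[OF assms(3)] by blast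
  then obtain f where f: "f \<in> F" "f X \<noteq> 0"
    using pencil_in_Gr_zeros_iff[of X F] F(2) unfolding F(1) affine_cone_def by blast
  moreover have "\<forall>Y\<in>affine_cone Z. f Y = 0"
  proof
    fix Y assume Y: "Y \<in> affine_cone Z"
    then have "pencil Y \<in> Gr_zeros F" using F(1) by (simp add: affine_cone_def)
    then show "f Y = 0" using pencil_in_Gr_zeros_iff[of Y F] F(2) f(1) Y by (simp add: affine_cone_def)
  qed
  ultimately show ?thesis using F(2) X(1) by blast
qed

section \<open>Dimension through the growth of Hilbert functions\<close>

lemma hom_poly_cmult: "hom_poly k f \<Longrightarrow> hom_poly k (\<lambda>X. c * f X)"
  using hom_poly.mult[OF hom_poly.const[of c]] by fastforce

lemma hom_poly_power: "hom_poly k f \<Longrightarrow> hom_poly (k * m) (\<lambda>X. f X ^ m)"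
proof (induction m)
  case 0
  then show ?case using hom_poly.const[of 1] by simp
next
  case (Suc m)
  then show ?case using hom_poly.mult[OF Suc.prems Suc.IH] by simp
qed

lemma hom_poly_zero: "hom_poly k (\<lambda>X. 0)"
  using hom_poly_cmult[OF hom_poly_power[OF hom_poly.coord, of k], of 0] by simp

lemma hom_poly_sum: "(\<And>a. a \<in> A \<Longrightarrow> hom_poly k (f a)) \<Longrightarrow> hom_poly k (\<lambda>X. \<Sum>a\<in>A. f a X)"
  by (induction A rule: infinite_finite_induct) (auto intro: hom_poly_zero hom_poly.add)

lemma hom_poly_diff: "hom_poly k f \<Longrightarrow> hom_poly k g \<Longrightarrow> hom_poly k (\<lambda>X. f X - g X)"
  using hom_poly.add[of k f "\<lambda>X. (-1) * g X"] hom_poly_cmult[of k g "-1"] by simp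

lemma hom_poly_prod:
  "finite A \<Longrightarrow> (\<And>a. a \<in> A \<Longrightarrow> hom_poly (d a) (f a)) \<Longrightarrow> hom_poly (\<Sum>a\<in>A. d a) (\<lambda>X. \<Prod>a\<in>A. f a X)"
proof (induction A rule: finite_induct)
  case empty
  then show ?case using hom_poly.const[of 1] by simp
next
  case (insert x A)
  then show ?case using hom_poly.mult[of "d x" "f x" "\<Sum>a\<in>A. d a" "\<lambda>X. \<Prod>a\<in>A. f a X"] by simp
qed

text \<open>The forms of degree \<open>k\<close>, restricted to \<open>C\<close>, span a space of dimension at least \<open>r\<close>. In other
  words, the Hilbert function of \<open>C\<close> takes at \<open>k\<close> a value of at least \<open>r\<close>.\<close>

definition hilbert_ge :: "(complex^'n^'n) set \<Rightarrow> nat \<Rightarrow> nat \<Rightarrow> bool" where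
  "hilbert_ge C k r \<longleftrightarrow> (\<exists>f :: nat \<Rightarrow> complex^'n^'n \<Rightarrow> complex. (\<forall>j<r. hom_poly k (f j)) \<and>
     (\<forall>c. (\<forall>X\<in>C. (\<Sum>j<r. c j * f j X) = 0) \<longrightarrow> (\<forall>j<r. c j = 0)))"

lemma hilbert_ge_family:
  assumes A: "finite A" and f: "\<And>a. a \<in> A \<Longrightarrow> hom_poly k (f a)"
    and ind: "\<And>c a. (\<And>X. X \<in> C \<Longrightarrow> (\<Sum>a\<in>A. c a * f a X) = 0) \<Longrightarrow> a \<in> A \<Longrightarrow> c a = 0"
  shows "hilbert_ge C k (card A)"
proof -
  obtain h where h: "bij_betw h {..<card A} A"
    using ex_bij_betw_nat_finite[OF A] by (auto simp: atLeast0LessThan)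
  let ?g = "the_inv_into {..<card A} h"
  have g: "bij_betw ?g A {..<card A}" using h by (rule bij_betw_the_inv_into)
  have gh: "?g (h j) = j" if "j < card A" for j
    using h that by (auto simp: bij_betw_def the_inv_into_f_f)
  have hm: "h j \<in> A" if "j < card A" for j using h that by (auto simp: bij_betw_def)
  show ?thesis
    unfolding hilbert_ge_def
  proof (intro exI[of _ "\<lambda>j. f (h j)"] conjI allI impI)
    fix j assume "j < card A"
    then show "hom_poly k (f (h j))" using f hm by blast
  next
    fix c j assume c: "\<forall>X\<in>C. (\<Sum>j<card A. c j * f (h j) X) = 0" and j: "j < card A"
    have "(\<Sum>a\<in>A. c (?g a) * f a X) = (\<Sum>j<card A. c j * f (h j) X)" for X
      by (subst sum.reindex_bij_betw[OF h, symmetric]) (auto intro!: sum.cong simp: gh)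
    then have "c (?g (h j)) = 0" using ind[of "\<lambda>a. c (?g a)" "h j"] c hm[OF j] by simp
    then show "c j = 0" using gh[OF j] by simp
  qed
qed

lemma hilbert_ge_dominate:
  assumes dom: "\<And>f. hom_poly k f \<Longrightarrow> (\<And>X. X \<in> C \<Longrightarrow> f X = 0) \<Longrightarrow> (\<And>X. X \<in> C' \<Longrightarrow> f X = 0)"
    and "hilbert_ge C' k r"
  shows "hilbert_ge C k r"
proof -
  obtain f where f: "\<And>j. j < r \<Longrightarrow> hom_poly k (f j)"
    "\<And>c. (\<forall>X\<in>C'. (\<Sum>j<r. c j * f j X) = 0) \<Longrightarrow> (\<forall>j<r. c j = 0)"
    using assms(2) unfolding hilbert_ge_def by blast
  show ?thesis
    unfolding hilbert_ge_def
  proof (intro exI[of _ f] conjI allI impI)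
    fix c j assume c: "\<forall>X\<in>C. (\<Sum>j<r. c j * f j X) = 0" and j: "j < r"
    have "hom_poly k (\<lambda>X. \<Sum>j<r. c j * f j X)" using f(1) by (intro hom_poly_sum hom_poly_cmult) auto
    then have "\<forall>X\<in>C'. (\<Sum>j<r. c j * f j X) = 0" using dom c by blast
    then show "c j = 0" using f(2) j by blast
  qed (use f(1) in auto)
qed

text \<open>If the form \<open>g\<close> vanishes on \<open>C\<close> but not on the larger, irreducible \<open>C'\<close>, then multiplication by
  \<open>g\<close> is injective on forms on \<open>C'\<close> and its image restricts to zero on \<open>C\<close>. Hence
  \<open>h\<^sub>C (k + e) + h\<^sub>C\<^sub>' k \<le> h\<^sub>C\<^sub>' (k + e)\<close> for the Hilbert functions.\<close>

lemma hilbert_ge_step: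
  assumes prime: "prime_on C'" and sub: "C \<subseteq> C'"
    and g: "hom_poly e g" "\<And>X. X \<in> C \<Longrightarrow> g X = 0" "\<exists>X\<in>C'. g X \<noteq> 0"
    and C: "hilbert_ge C (k + e) s" and C': "hilbert_ge C' k r"
  shows "hilbert_ge C' (k + e) (s + r)"
proof -
  obtain f where f: "\<And>j. j < s \<Longrightarrow> hom_poly (k + e) (f j)"
    "\<And>c. (\<forall>X\<in>C. (\<Sum>j<s. c j * f j X) = 0) \<Longrightarrow> (\<forall>j<s. c j = 0)"
    using C unfolding hilbert_ge_def by blast
  obtain h where h: "\<And>j. j < r \<Longrightarrow> hom_poly k (h j)"
    "\<And>c. (\<forall>X\<in>C'. (\<Sum>j<r. c j * h j X) = 0) \<Longrightarrow> (\<forall>j<r. c j = 0)"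
    using C' unfolding hilbert_ge_def by blast
  define F where "F j X = (if j < s then f j X else h (j - s) X * g X)" for j X
  show ?thesis
    unfolding hilbert_ge_def
  proof (intro exI[of _ F] conjI allI impI)
    fix j assume j: "j < s + r"
    show "hom_poly (k + e) (F j)"
    proof (cases "j < s")
      case True
      then show ?thesis using f(1) by (simp add: F_def[abs_def])
    next
      case False
      then show ?thesis using hom_poly.mult[OF h(1) g(1), of "j - s"] j by (simp add: F_def[abs_def])
    qed
  next
    fix c j assume c: "\<forall>X\<in>C'. (\<Sum>j<s + r. c j * F j X) = 0" and j: "j < s + r"
    have split: "(\<Sum>j<s + r. c j * F j X) = (\<Sum>j<s. c j * f j X) + (\<Sum>j<r. c (s + j) * h j X) * g X" for X
    proof -
      have "(\<Sum>j<s + r. c j * F j X) = (\<Sum>j<s. c j * F j X) + (\<Sum>j<r. c (s + j) * F (s + j) X)"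
        by (induction r) (simp_all add: add.assoc)
      then show ?thesis by (simp add: F_def sum_distrib_right mult.assoc)
    qed
    have 1: "\<forall>j<s. c j = 0"
    proof (rule f(2), rule ballI)
      fix X assume X: "X \<in> C"
      then have "(\<Sum>j<s + r. c j * F j X) = 0" using c sub by blast
      then show "(\<Sum>j<s. c j * f j X) = 0" unfolding split using g(2)[OF X] by simp
    qed
    have "hom_poly k (\<lambda>X. \<Sum>j<r. c (s + j) * h j X)" using h(1) by (intro hom_poly_sum hom_poly_cmult) auto
    moreover have "\<forall>X\<in>C'. (\<Sum>j<r. c (s + j) * h j X) * g X = 0"
    proof
      fix X assume "X \<in> C'"
      then have "(\<Sum>j<s + r. c j * F j X) = 0" using c by blast
      then show "(\<Sum>j<r. c (s + j) * h j X) * g X = 0" unfolding split using 1 by simp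
    qed
    ultimately have "\<forall>X\<in>C'. (\<Sum>j<r. c (s + j) * h j X) = 0"
      using prime[unfolded prime_on_def, rule_format, OF _ g(1), of k "\<lambda>X. \<Sum>j<r. c (s + j) * h j X"] g(3) by blast
    then have 2: "\<forall>j<r. c (s + j) = 0" by (rule h(2))
    show "c j = 0"
    proof (cases "j < s")
      case False
      then show ?thesis using 2[rule_format, of "j - s"] j by simp
    qed (use 1 in blast)
  qed
qed

text \<open>The Hilbert function grows at least like a polynomial of degree \<open>e\<close>, i.e. the projective dimension is
  at least \<open>e\<close>. Only the arguments \<open>c * q\<close> are tested; the stretching constant \<open>c\<close> absorbs the degrees of all
  auxiliary forms.\<close>

definition growth_ge :: "(complex^'n^'n) set \<Rightarrow> nat \<Rightarrow> bool" where
  "growth_ge C e \<longleftrightarrow> (\<exists>c. \<forall>q\<ge>1. hilbert_ge C (c * q) (q ^ e))"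

text \<open>Growth depends only on the forms vanishing on a set, hence is the same for a set and its closure.\<close>

lemma growth_dominate:
  assumes dom: "\<And>k f X. hom_poly k f \<Longrightarrow> (\<And>X. X \<in> C \<Longrightarrow> f X = 0) \<Longrightarrow> X \<in> C' \<Longrightarrow> f X = 0"
    and "growth_ge C' d"
  shows "growth_ge C d"
proof -
  obtain c where c: "\<And>q. q \<ge> 1 \<Longrightarrow> hilbert_ge C' (c * q) (q ^ d)" using assms(2) by (auto simp: growth_ge_def)
  have "hilbert_ge C (c * q) (q ^ d)" if "q \<ge> 1" for q
  proof (rule hilbert_ge_dominate[OF _ c[OF that]])
    fix f X assume "hom_poly (c * q) f" "\<And>X. X \<in> C \<Longrightarrow> f X = 0" "X \<in> C'"
    then show "f X = 0" by (rule dom)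
  qed
  then show ?thesis unfolding growth_ge_def by blast
qed

lemma growth_mono: "growth_ge C d \<Longrightarrow> C \<subseteq> C' \<Longrightarrow> growth_ge C' d"
  by (rule growth_dominate) auto

lemma growth_hull: "growth_ge (hull_of_forms C) d \<Longrightarrow> growth_ge C d"
  by (rule growth_dominate[of C]) (auto simp: hull_of_forms_def)

text \<open>On an irreducible set, multiplication by a form that does not vanish identically embeds forms of degree \<open>k\<close>
  into forms of degree \<open>k + m\<close>; this is the inequality of Hilbert functions for the empty subset.\<close>

lemma hilbert_ge_raise_degree:
  assumes "hilbert_ge C k r" "X \<in> C" "f X \<noteq> 0" "hom_poly m f" "prime_on C"
  shows "hilbert_ge C (k + m) r"
proof -
  have "hilbert_ge {} (k + m) 0" by (auto simp: hilbert_ge_def)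
  then have "hilbert_ge C (k + m) (0 + r)" using assms
    by (intro hilbert_ge_step[of C "{}" m f]) auto
  then show ?thesis by simp
qed

text \<open>Iterating the inequality of Hilbert functions with a power of \<open>g\<close> sums up \<open>q\<close> values of the Hilbert function
  of \<open>C\<close>. This gains one power of \<open>q\<close>, while the degree stays linear in \<open>q\<close>.\<close>

lemma growth_step:
  assumes prime: "prime_on C'" and sub: "C \<subseteq> C'"
    and g: "hom_poly e g" "\<And>X. X \<in> C \<Longrightarrow> g X = 0" "\<exists>X\<in>C'. g X \<noteq> 0"
    and C: "growth_ge C d" and primeC: "prime_on C" and ne: "X0 \<in> C" "X0 \<noteq> 0"
  shows "growth_ge C' (Suc d)"
proof -
  obtain c0 where c0: "\<And>q. q \<ge> 1 \<Longrightarrow> hilbert_ge C (c0 * q) (q ^ d)" using C by (auto simp: growth_ge_def)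
  define c where "c = Suc c0"
  \<comment> \<open>A coordinate that does not vanish identically on \<open>C\<close> lifts bounds to all higher degrees.\<close>
  obtain i j where ij: "X0 $ i $ j \<noteq> 0" using ne(2) by (auto simp: vec_eq_iff)
  have up: "hilbert_ge C (c * q + m) (q ^ d)" if "q \<ge> 1" for q m
    using hilbert_ge_raise_degree[OF c0[OF that] ne(1) _ hom_poly_power[OF hom_poly.coord] primeC, of i j "q + m"] ij
    by (simp add: c_def algebra_simps)
  have gc: "hom_poly (e * c) (\<lambda>X. g X ^ c)" using g(1) by (rule hom_poly_power)
  have iter: "hilbert_ge C' (c * q + t * (e * c)) (t * q ^ d)" if q: "q \<ge> 1" for q t
  proof (induction t)
    case 0
    show ?case by (auto simp: hilbert_ge_def)
  next
    case (Suc t)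
    have "hilbert_ge C' ((c * q + t * (e * c)) + e * c) (q ^ d + t * q ^ d)"
    proof (rule hilbert_ge_step[OF prime sub gc])
      show "hilbert_ge C (c * q + t * (e * c) + e * c) (q ^ d)"
        using up[OF q, of "t * (e * c) + e * c"] by (simp add: add.assoc)
    qed (use g Suc in \<open>auto simp: c_def\<close>)
    then show ?case by (simp add: algebra_simps)
  qed
  show ?thesis unfolding growth_ge_def
  proof (intro exI[of _ "c * (1 + e)"] allI impI)
    fix q :: nat assume "q \<ge> 1"
    then have "hilbert_ge C' (c * q + q * (e * c)) (q * q ^ d)" using iter by simp
    then show "hilbert_ge C' (c * (1 + e) * q) (q ^ Suc d)" by (simp add: algebra_simps)
  qed
qed

lemma hom_poly_comp_poly_box:
  fixes \<pi> :: "('v \<Rightarrow> complex) \<Rightarrow> complex^'n^'n"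
  assumes R: "finite R" and \<pi>: "\<And>i j. poly_box R D (\<lambda>b. \<pi> b $ i $ j)" and f: "hom_poly k f"
  shows "poly_box R (D * k) (\<lambda>b. f (\<pi> b))"
  using f
proof (induction rule: hom_poly.induct)
  case (mult d f e g)
  then show ?case using poly_box_mult[OF R mult.IH] by (simp add: distrib_left)
qed (use R \<pi> in \<open>auto intro: poly_box_const poly_box_add\<close>)

lemma poly_mat_poly_box:
  fixes \<pi> :: "('v \<Rightarrow> complex) \<Rightarrow> complex^'n^'n"
  assumes R: "finite R" and \<pi>: "poly_mat R \<pi>"
  shows "\<exists>D. \<forall>i j. poly_box R D (\<lambda>b. \<pi> b $ i $ j)"
proof -
  obtain d where d: "\<And>i j. poly_box R (d i j) (\<lambda>b. \<pi> b $ i $ j)"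
    using \<pi> unfolding poly_mat_def poly_fun_def by metis
  have "d i j \<le> (\<Sum>i\<in>UNIV. \<Sum>j\<in>UNIV. d i j)" for i j
    using member_le_sum[of j UNIV "d i"] member_le_sum[of i UNIV "\<lambda>i. \<Sum>j\<in>UNIV. d i j"] by force
  then show ?thesis using poly_box_mono[OF R d] by blast
qed

lemma poly_fun_form:
  fixes \<pi> :: "('v \<Rightarrow> complex) \<Rightarrow> complex^'n^'n"
  assumes "finite R" "poly_mat R \<pi>" "hom_poly k f"
  shows "poly_fun R (\<lambda>b. f (\<pi> b))"
  using poly_mat_poly_box[OF assms(1,2)] hom_poly_comp_poly_box[OF assms(1) _ assms(3)]
  unfolding poly_fun_def by blast

text \<open>A set covered, up to closure, by a polynomial map in the parameters \<open>R\<close> has dimension at most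
  \<open>card R\<close>: pulled back, a form of degree \<open>k\<close> is a combination of \<open>(D * k + 1) ^ card R\<close> monomials.\<close>

lemma growth_le_parameters:
  fixes \<pi> :: "('v \<Rightarrow> complex) \<Rightarrow> complex^'n^'n"
  assumes R: "finite R" and \<pi>: "poly_mat R \<pi>"
    and dom: "\<And>k f. hom_poly k f \<Longrightarrow> (\<And>b. f (\<pi> b) = 0) \<Longrightarrow> (\<And>X. X \<in> C \<Longrightarrow> f X = 0)"
    and growth_ge: "growth_ge C e"
  shows "e \<le> card R"
proof -
  obtain D where D: "\<And>i j. poly_box R D (\<lambda>b. \<pi> b $ i $ j)" using poly_mat_poly_box[OF R \<pi>] by blast
  have bound: "r \<le> (D * k + 1) ^ card R" if r: "hilbert_ge C k r" for k r
  proof (rule ccontr)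
    assume small: "\<not> r \<le> (D * k + 1) ^ card R"
    let ?A = "PiE R (\<lambda>_. {..D * k})"
    have cA: "card ?A < r" using small R by (simp add: card_PiE)
    obtain f where f: "\<And>j. j < r \<Longrightarrow> hom_poly k (f j)"
      "\<And>c. (\<forall>X\<in>C. (\<Sum>j<r. c j * f j X) = 0) \<Longrightarrow> (\<forall>j<r. c j = 0)"
      using r unfolding hilbert_ge_def by blast
    have "\<forall>j\<in>{..<r}. \<exists>c. \<forall>b. f j (\<pi> b) = (\<Sum>a\<in>?A. c a * monom_on R a b)"
      using hom_poly_comp_poly_box[OF R D f(1)] unfolding poly_box_def by simp
    then obtain c where c: "\<forall>j\<in>{..<r}. \<forall>b. f j (\<pi> b) = (\<Sum>a\<in>?A. c j a * monom_on R a b)"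
      unfolding bchoice_iff by blast
    obtain x where x: "\<exists>j\<in>{..<r}. x j \<noteq> 0" "\<forall>a\<in>?A. (\<Sum>j<r. x j * c j a) = 0"
      using underdetermined_system[of ?A "{..<r}" c] cA R by (auto simp: finite_PiE)
    have "(\<Sum>j<r. x j * f j (\<pi> b)) = 0" for b
    proof -
      have "(\<Sum>j<r. x j * f j (\<pi> b)) = (\<Sum>j<r. \<Sum>a\<in>?A. x j * c j a * monom_on R a b)"
        using c by (simp add: sum_distrib_left mult.assoc)
      also have "\<dots> = (\<Sum>a\<in>?A. (\<Sum>j<r. x j * c j a) * monom_on R a b)"
        by (subst sum.swap) (simp add: sum_distrib_right)
      also have "\<dots> = 0" using x(2) by simp
      finally show ?thesis .
    qed
    moreover have "hom_poly k (\<lambda>X. \<Sum>j<r. x j * f j X)" using f(1) by (intro hom_poly_sum hom_poly_cmult) auto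
    ultimately have "\<forall>X\<in>C. (\<Sum>j<r. x j * f j X) = 0" using dom by blast
    then show False using f(2) x(1) by blast
  qed
  obtain c where c: "\<And>q. q \<ge> 1 \<Longrightarrow> hilbert_ge C (c * q) (q ^ e)" using growth_ge by (auto simp: growth_ge_def)
  show ?thesis
  proof (rule ccontr)
    assume "\<not> ?thesis"
    then have e: "Suc (card R) \<le> e" by simp
    \<comment> \<open>The value \<open>q = M ^ card R + 1\<close> is large enough to violate \<open>q ^ (card R + 1) \<le> (M * q) ^ card R\<close>.\<close>
  define M where "M = D * c + 1"
    define q where "q = M ^ card R + 1"
    have q: "q \<ge> 1" by (simp add: q_def)
    have "q ^ Suc (card R) \<le> q ^ e" using q e by (intro power_increasing) auto
    also have "\<dots> \<le> (D * (c * q) + 1) ^ card R" by (rule bound[OF c[OF q]])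
    also have "\<dots> \<le> (M * q) ^ card R" using q by (intro power_mono) (simp_all add: M_def)
    also have "\<dots> = M ^ card R * q ^ card R" by (simp add: power_mult_distrib)
    finally have "q * q ^ card R \<le> M ^ card R * q ^ card R" by simp
    then have "q \<le> M ^ card R" using q by simp
    then show False by (simp add: q_def)
  qed
qed

text \<open>A lower bound for the dimension from first-order information at one point. The ratios of the entries \<open>r \<in> R\<close>
  to the entry \<open>z\<close> serve as coordinates near a point where the former vanish and the latter is \<open>y0 \<noteq> 0\<close>.
  The curves \<open>\<gamma>\<close> show that these coordinates move independently to first order. Consequently the monomials of
  degree \<open>k\<close> in all these entries are linearly independent on \<open>C\<close>: along \<open>\<gamma>\<close> the terms of lowest order \<open>m\<close> in \<open>s\<close> survive division by
  \<open>s ^ m\<close> and give a polynomial relation between arbitrary numbers \<open>b r\<close>.\<close>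

lemma growth_from_tangent:
  fixes R :: "('n \<times> 'n::finite) set" and y0 :: complex
  assumes l: "y0 \<noteq> 0"
    and curve: "\<And>b. \<exists>\<gamma> h. (\<forall>\<^sub>F s in at 0. \<gamma> s \<in> C) \<and>
      (\<forall>r\<in>R. (h r \<longlongrightarrow> b r) (at 0) \<and> (\<forall>s. \<gamma> s $ fst r $ snd r = s * h r s)) \<and>
      ((\<lambda>s::complex. \<gamma> s $ fst z $ snd z) \<longlongrightarrow> y0) (at 0)"
  shows "growth_ge C (card R)"
  unfolding growth_ge_def
proof (intro exI[of _ "card R"] allI impI)
  fix q :: nat assume q: "q \<ge> 1"
  define k where "k = card R * q"
  let ?A = "PiE R (\<lambda>_. {..<q})"
  define w where "w a = (\<Sum>r\<in>R. a r)" for a :: "'n \<times> 'n \<Rightarrow> nat"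
  define F where "F a X = (\<Prod>r\<in>R. (X $ fst r $ snd r) ^ a r) * (X $ fst z $ snd z) ^ (k - w a)"
    for a and X :: "complex^'n^'n"
  have fA: "finite ?A" by (simp add: finite_PiE)
  have wk: "w a \<le> k" if "a \<in> ?A" for a
  proof -
    have "w a \<le> (\<Sum>r\<in>R. q)" unfolding w_def using that by (intro sum_mono) (auto dest: PiE_mem)
    then show ?thesis by (simp add: k_def)
  qed
  have "hilbert_ge C k (card ?A)"
  proof (rule hilbert_ge_family[OF fA, of _ F])
    fix a assume a: "a \<in> ?A"
    have "hom_poly (w a + (k - w a)) (F a)"
      unfolding F_def[abs_def] w_def
      by (intro hom_poly.mult hom_poly_prod)
        (use hom_poly_power[OF hom_poly.coord] in \<open>auto\<close>)
    then show "hom_poly k (F a)" using wk[OF a] by simp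
  next
    fix c a0 assume c: "\<And>X. X \<in> C \<Longrightarrow> (\<Sum>a\<in>?A. c a * F a X) = 0" and a0: "a0 \<in> ?A"
    show "c a0 = 0"
    proof (rule ccontr)
      assume ca0: "c a0 \<noteq> 0"
      define S where "S = w ` {a\<in>?A. c a \<noteq> 0}"
      \<comment> \<open>The lowest order in \<open>s\<close> among the monomials that occur.\<close>
      define m where "m = Min S"
      have S: "finite S" "S \<noteq> {}" using fA a0 ca0 by (auto simp: S_def)
      have m: "m \<in> S" unfolding m_def by (rule Min_in[OF S])
      have mw: "m \<le> w a" if "a \<in> ?A" "c a \<noteq> 0" for a
        unfolding m_def using S that by (intro Min_le) (auto simp: S_def)
      define c' where "c' a = (if w a = m then c a * y0 ^ (k - m) else 0)" for a
      have "(\<Sum>a\<in>?A. c' a * monom_on R a b) = 0" for b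
      proof -
        obtain \<gamma> h where g: "\<forall>\<^sub>F s in at 0. \<gamma> s \<in> C" and h: "\<And>r. r \<in> R \<Longrightarrow> (h r \<longlongrightarrow> b r) (at 0)"
          "\<And>r s. r \<in> R \<Longrightarrow> \<gamma> s $ fst r $ snd r = s * h r s"
          and z: "((\<lambda>s. \<gamma> s $ fst z $ snd z) \<longlongrightarrow> y0) (at 0)"
          using curve[of b] by blast
        define G where "G s = (\<Sum>a\<in>?A. c a * (s ^ (w a - m) * ((\<Prod>r\<in>R. h r s ^ a r) * (\<gamma> s $ fst z $ snd z) ^ (k - w a))))"
          for s
        have "(G \<longlongrightarrow> (\<Sum>a\<in>?A. c a * (0 ^ (w a - m) * ((\<Prod>r\<in>R. b r ^ a r) * y0 ^ (k - w a))))) (at 0)"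
          unfolding G_def[abs_def] using h(1) z by (intro tendsto_intros) auto
        also have "(\<Sum>a\<in>?A. c a * (0 ^ (w a - m) * ((\<Prod>r\<in>R. b r ^ a r) * y0 ^ (k - w a))))
            = (\<Sum>a\<in>?A. c' a * monom_on R a b)"
        proof (rule sum.cong[OF refl])
          fix a assume a: "a \<in> ?A"
          show "c a * (0 ^ (w a - m) * ((\<Prod>r\<in>R. b r ^ a r) * y0 ^ (k - w a))) = c' a * monom_on R a b"
            using mw[OF a] by (cases "c a = 0") (auto simp: c'_def monom_on_def power_0_left)
        qed
        finally have lim: "(G \<longlongrightarrow> (\<Sum>a\<in>?A. c' a * monom_on R a b)) (at 0)" .
        have "\<forall>\<^sub>F s in at 0. G s = 0"
        proof (rule eventually_mono[OF eventually_conj[OF g eventually_neq_at_within[of 0]]])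
          fix s assume s: "\<gamma> s \<in> C \<and> s \<noteq> 0"
          have "s ^ m * G s = (\<Sum>a\<in>?A. c a * F a (\<gamma> s))"
            unfolding G_def sum_distrib_left
          proof (rule sum.cong[OF refl])
            fix a assume a: "a \<in> ?A"
            have "(\<Prod>r\<in>R. (\<gamma> s $ fst r $ snd r) ^ a r) = s ^ w a * (\<Prod>r\<in>R. h r s ^ a r)"
              using h(2) by (simp add: power_mult_distrib prod.distrib w_def power_sum)
            then show "s ^ m * (c a * (s ^ (w a - m) * ((\<Prod>r\<in>R. h r s ^ a r) * (\<gamma> s $ fst z $ snd z) ^ (k - w a))))
                = c a * F a (\<gamma> s)"
              using mw[OF a] by (cases "c a = 0") (simp_all add: F_def mult_ac flip: power_add)
          qed
          then show "G s = 0" using c s by simp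
        qed
        then have "((\<lambda>_. 0) \<longlongrightarrow> (\<Sum>a\<in>?A. c' a * monom_on R a b)) (at (0::complex))"
          using tendsto_cong[of G "\<lambda>_. 0" "at 0"] lim by blast
        then show ?thesis by (simp add: tendsto_const_iff)
      qed
      then have c'0: "c' a = 0" if "a \<in> ?A" for a using monomials_independent[where R = R and q = q and c = c' and a = a] that by simp
      obtain a where a: "a \<in> ?A" "c a \<noteq> 0" "w a = m" using m by (auto simp: S_def)
      have "c' a \<noteq> 0" using a l by (simp add: c'_def)
      then show False using c'0[OF a(1)] by simp
    qed
  qed
  then show "hilbert_ge C (card R * q) (q ^ card R)" by (simp add: k_def card_PiE)
qed

section \<open>Coordinates on the traceless symmetric matrices\<close>

text \<open>An arbitrary numbering of the index type, which singles out the upper triangle of a matrix.\<close>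

definition index_of :: "'n::finite \<Rightarrow> nat" where
  "index_of = (SOME h. bij_betw h UNIV {..<CARD('n)})"

lemma index_of_bij: "bij_betw (index_of :: 'n::finite \<Rightarrow> nat) UNIV {..<CARD('n)}"
  unfolding index_of_def
proof (rule someI_ex[of "\<lambda>h :: 'n \<Rightarrow> nat. bij_betw h UNIV {..<CARD('n)}"])
  show "\<exists>h :: 'n \<Rightarrow> nat. bij_betw h UNIV {..<CARD('n)}"
    using ex_bij_betw_finite_nat[of "UNIV :: 'n set"] by (simp add: atLeast0LessThan)
qed

lemma index_of_inj: "index_of p = index_of q \<longleftrightarrow> p = q"
  using index_of_bij by (metis bij_betw_def inj_eq)

definition upper_pairs :: "('n::finite \<times> 'n) set" where
  "upper_pairs = {(p, q). index_of p \<le> index_of q}"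

text \<open>A traceless symmetric matrix is determined by its upper triangle without one diagonal entry.\<close>

definition free_entries :: "'n::finite \<Rightarrow> ('n \<times> 'n) set" where
  "free_entries z = upper_pairs - {(z, z)}"

lemma card_upper_pairs: "card (upper_pairs :: ('n::finite \<times> 'n) set) = (CARD('n) + 1) choose 2"
proof -
  let ?h = "index_of :: 'n \<Rightarrow> nat" and ?n = "CARD('n)"
  have h: "inj ?h" "range ?h = {..<?n}" using index_of_bij by (auto simp: bij_betw_def)
  have sum_Suc: "(\<Sum>b<m. Suc b) = (m + 1) choose 2" for m
    by (induction m) (simp_all add: numeral_2_eq_2)
  have "bij_betw (\<lambda>(p, q). (?h q, ?h p)) upper_pairs (Sigma {..<?n} (\<lambda>b. {..b}))"
    unfolding bij_betw_def
  proof
    show "inj_on (\<lambda>(p, q). (?h q, ?h p)) upper_pairs"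
      by (auto simp: inj_on_def index_of_inj)
    show "(\<lambda>(p, q). (?h q, ?h p)) ` upper_pairs = Sigma {..<?n} (\<lambda>b. {..b})"
    proof (intro equalityI subsetI)
      fix x assume "x \<in> Sigma {..<?n} (\<lambda>b. {..b})"
      then obtain a b where x: "x = (b, a)" "b < ?n" "a \<le> b" by auto
      then have "a \<in> range ?h" "b \<in> range ?h" unfolding h(2) by auto
      then obtain p q where "a = ?h p" "b = ?h q" by blast
      then show "x \<in> (\<lambda>(p, q). (?h q, ?h p)) ` upper_pairs"
        using x by (auto simp: upper_pairs_def intro!: image_eqI[of _ _ "(p, q)"])
    qed (use h(2) in \<open>auto simp: upper_pairs_def\<close>)
  qed
  then have "card (upper_pairs :: ('n \<times> 'n) set) = card (Sigma {..<?n} (\<lambda>b. {..b}))"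
    by (rule bij_betw_same_card)
  also have "\<dots> = (\<Sum>b<?n. Suc b)" by simp
  also have "\<dots> = (?n + 1) choose 2" by (rule sum_Suc)
  finally show ?thesis .
qed

lemma card_free_entries: "card (free_entries (z :: 'n::finite)) = ((CARD('n) + 1) choose 2) - 1"
proof -
  have "(z, z) \<in> upper_pairs" by (simp add: upper_pairs_def)
  then show ?thesis by (simp add: free_entries_def card_Diff_singleton card_upper_pairs)
qed

text \<open>The entry \<open>(z, z)\<close> is determined by the vanishing of the trace.\<close>

definition sym_matrix :: "'n::finite \<Rightarrow> ('n \<times> 'n \<Rightarrow> complex) \<Rightarrow> complex^'n^'n" where
  "sym_matrix z v = (\<chi> p q. if p = z \<and> q = z then - (\<Sum>k\<in>UNIV - {z}. v (k, k))
     else if index_of p \<le> index_of q then v (p, q) else v (q, p))"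

lemma sym_matrix_free: "r \<in> free_entries z \<Longrightarrow> sym_matrix z v $ fst r $ snd r = v r"
  by (auto simp: sym_matrix_def free_entries_def upper_pairs_def)

lemma sym_matrix_traceless: "sym_matrix z v \<in> traceless_symmetric"
proof -
  have "transpose (sym_matrix z v) = sym_matrix z v"
    by (auto simp: vec_eq_iff transpose_def sym_matrix_def) (metis index_of_inj)+
  moreover have "trace (sym_matrix z v) = sym_matrix z v $ z $ z + (\<Sum>k\<in>UNIV - {z}. sym_matrix z v $ k $ k)"
    unfolding trace_def by (rule sum.remove) auto
  then have "trace (sym_matrix z v) = 0" by (simp add: sym_matrix_def)
  ultimately show ?thesis by (simp add: traceless_symmetric_def symmetric_matrices_def)
qed

lemma sym_matrix_cong:
  assumes "\<And>r. r \<in> free_entries z \<Longrightarrow> v r = v' r"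
  shows "sym_matrix z v = sym_matrix z v'"
proof -
  have 1: "v (k, k) = v' (k, k)" if "k \<noteq> z" for k
    using assms[of "(k, k)"] that by (simp add: free_entries_def upper_pairs_def)
  have 2: "v (p, q) = v' (p, q)" if "index_of p \<le> index_of q" "\<not> (p = z \<and> q = z)" for p q
    using assms[of "(p, q)"] that by (auto simp: free_entries_def upper_pairs_def)
  show ?thesis unfolding vec_eq_iff sym_matrix_def using 1 2 by auto
qed

lemma traceless_eq_sym_matrix:
  assumes "X \<in> traceless_symmetric"
  shows "X = sym_matrix z (\<lambda>r. X $ fst r $ snd r)"
proof -
  have X: "transpose X = X" "trace X = 0"
    using assms by (auto simp: traceless_symmetric_def symmetric_matrices_def)
  have sym: "X $ p $ q = X $ q $ p" for p q
    using arg_cong[OF X(1), of "\<lambda>A. A $ q $ p"] by (simp add: transpose_def)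
  have "trace X = X $ z $ z + (\<Sum>k\<in>UNIV - {z}. X $ k $ k)"
    unfolding trace_def by (rule sum.remove) auto
  then have "X $ z $ z = - (\<Sum>k\<in>UNIV - {z}. X $ k $ k)" using X(2) by (simp add: eq_neg_iff_add_eq_0)
  then have zz: "sym_matrix z (\<lambda>r. X $ fst r $ snd r) $ z $ z = X $ z $ z" by (simp add: sym_matrix_def)
  have "sym_matrix z (\<lambda>r. X $ fst r $ snd r) $ p $ q = (if index_of p \<le> index_of q then X $ p $ q else X $ q $ p)"
    if "\<not> (p = z \<and> q = z)" for p q
    unfolding sym_matrix_def vec_lambda_beta fst_conv snd_conv using that by (rule if_not_P)
  also have "(if index_of p \<le> index_of q then X $ p $ q else X $ q $ p) = X $ p $ q" for p q
    by (rule trans[OF if_cong[OF refl refl sym] if_cancel])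
  finally have "sym_matrix z (\<lambda>r. X $ fst r $ snd r) $ p $ q = X $ p $ q" for p q
    using zz by (cases "p = z \<and> q = z") blast+
  then show ?thesis by (simp add: vec_eq_iff)
qed

lemma traceless_eqI:
  assumes "X \<in> traceless_symmetric" "Y \<in> traceless_symmetric"
    and "\<And>r. r \<in> free_entries z \<Longrightarrow> X $ fst r $ snd r = Y $ fst r $ snd r"
  shows "X = Y"
proof -
  have "X = sym_matrix z (\<lambda>r. X $ fst r $ snd r)" by (rule traceless_eq_sym_matrix[OF assms(1)])
  also have "\<dots> = sym_matrix z (\<lambda>r. Y $ fst r $ snd r)" by (rule sym_matrix_cong[OF assms(3)])
  also have "\<dots> = Y" by (rule traceless_eq_sym_matrix[OF assms(2), symmetric])
  finally show ?thesis .
qed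

lemma poly_mat_sym_matrix:
  assumes "finite R" "\<And>r. r \<in> free_entries z \<Longrightarrow> poly_fun R (\<lambda>b. v b r)"
  shows "poly_mat R (\<lambda>b. sym_matrix z (v b))"
proof -
  have 1: "poly_fun R (\<lambda>b. v b (p, q))" if "index_of p \<le> index_of q" "\<not> (p = z \<and> q = z)" for p q
    using assms(2)[of "(p, q)"] that by (auto simp: free_entries_def upper_pairs_def)
  have "poly_fun R (\<lambda>b. sym_matrix z (v b) $ p $ q)" for p q
  proof (cases "p = z \<and> q = z")
    case True
    have "poly_fun R (\<lambda>b. 0 - (\<Sum>k\<in>UNIV - {z}. v b (k, k)))"
      using assms(1) by (intro poly_fun_diff poly_fun_sum poly_fun_const 1) auto
    then show ?thesis using True by (simp add: sym_matrix_def)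
  next
    case False
    then show ?thesis
      using 1[of p q] 1[of q p] by (cases "index_of p \<le> index_of q") (auto simp: sym_matrix_def)
  qed
  then show ?thesis by (simp add: poly_mat_def)
qed

lemma dim_traceless_symmetric:
  "cmat.dim (traceless_symmetric :: (complex^'n^'n) set) = ((CARD('n) + 1) choose 2) - 1"
proof -
  fix z :: 'n
  define e :: "'n \<times> 'n \<Rightarrow> complex^'n^'n" where "e r = sym_matrix z (\<lambda>r'. if r' = r then 1 else 0)" for r
  let ?U = "free_entries z"
  have ent: "e r $ fst s $ snd s = (if s = r then 1 else 0)" if "s \<in> ?U" for r s
    unfolding e_def by (rule sym_matrix_free[OF that])
  have inj: "inj_on e ?U"
  proof (rule inj_onI)
    fix r s assume rs: "r \<in> ?U" "s \<in> ?U" "e r = e s"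
    then show "r = s" using ent[OF rs(1), of r] ent[OF rs(1), of s] by (simp split: if_splits)
  qed
  have coord: "(\<Sum>r\<in>?U. cscale (c r) (e r)) $ fst s $ snd s = c s" if "s \<in> ?U" for c s
  proof -
    have "(\<Sum>r\<in>?U. cscale (c r) (e r)) $ fst s $ snd s = (\<Sum>r\<in>?U. if s = r then c r else 0)"
      unfolding sum_component by (rule sum.cong) (simp_all add: ent[OF that])
    then show ?thesis using that by simp
  qed
  have sumW: "(\<Sum>r\<in>?U. cscale (c r) (e r)) \<in> traceless_symmetric" for c
    using traceless_symmetric_subspace
    by (intro cmat.subspace_sum cmat.subspace_scale) (auto simp: e_def sym_matrix_traceless)
  show ?thesis
  proof (rule cmat.dim_unique[of "e ` ?U"])
    show "e ` ?U \<subseteq> traceless_symmetric" by (auto simp: e_def sym_matrix_traceless)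
    show "traceless_symmetric \<subseteq> cmat.span (e ` ?U)"
    proof
      fix X :: "complex^'n^'n" assume X: "X \<in> traceless_symmetric"
      have "X = (\<Sum>r\<in>?U. cscale (X $ fst r $ snd r) (e r))"
        by (rule traceless_eqI[OF X sumW, of z]) (rule coord[symmetric])
      also have "\<dots> \<in> cmat.span (e ` ?U)"
        by (intro cmat.span_sum cmat.span_scale cmat.span_base) auto
      finally show "X \<in> cmat.span (e ` ?U)" .
    qed
    show "cmat.independent (e ` ?U)"
    proof (rule cmat.independent_if_scalars_zero)
      fix f x assume f: "(\<Sum>x\<in>e ` ?U. cscale (f x) x) = 0" and x: "x \<in> e ` ?U"
      obtain r where r: "r \<in> ?U" "x = e r" using x by blast
      have "(\<Sum>r\<in>?U. cscale (f (e r)) (e r)) = 0" using f by (simp add: sum.reindex[OF inj])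
      then show "f x = 0" using coord[OF r(1), of "\<lambda>r. f (e r)"] r(2) by simp
    qed simp
    show "card (e ` ?U) = ((CARD('n) + 1) choose 2) - 1"
      by (simp add: card_image[OF inj] card_free_entries)
  qed
qed

lemma free_entries_nonempty:
  assumes "CARD('n::finite) \<ge> 2"
  shows "\<exists>r. r \<in> free_entries (z :: 'n)"
proof -
  have "(UNIV :: 'n set) \<noteq> {z}" using assms by (metis card_1_singleton_iff One_nat_def not_less_eq_eq numeral_2_eq_2 le_refl)
  then obtain p where "p \<noteq> z" by blast
  then show ?thesis by (intro exI[of _ "(p, p)"]) (simp add: free_entries_def upper_pairs_def)
qed

text \<open>The whole space has the full dimension: all free entries but one move independently, relative to the last one.\<close>

lemma growth_traceless:
  assumes "CARD('n::finite) \<ge> 2"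
  shows "growth_ge (traceless_symmetric - {0} :: (complex^'n^'n) set) (((CARD('n) + 1) choose 2) - 2)"
proof -
  fix z :: 'n
  obtain u where u: "u \<in> free_entries z" using free_entries_nonempty[OF assms] by blast
  let ?R = "free_entries z - {u}"
  have "growth_ge (traceless_symmetric - {0} :: (complex^'n^'n) set) (card ?R)"
  proof (rule growth_from_tangent[of 1 _ _ u])
    fix b :: "'n \<times> 'n \<Rightarrow> complex"
    define \<gamma> where "\<gamma> s = sym_matrix z (\<lambda>r. if r = u then 1 else s * b r)" for s
    have g: "\<gamma> s $ fst r $ snd r = (if r = u then 1 else s * b r)" if "r \<in> free_entries z" for r s
      unfolding \<gamma>_def by (rule sym_matrix_free[OF that])
    have "\<gamma> s \<in> traceless_symmetric - {0}" for s
      using g[OF u, of s] sym_matrix_traceless[of z] by (auto simp: \<gamma>_def)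
    then show "\<exists>\<gamma> h. (\<forall>\<^sub>F s in at 0. \<gamma> s \<in> traceless_symmetric - {0}) \<and>
      (\<forall>r\<in>?R. (h r \<longlongrightarrow> b r) (at 0) \<and> (\<forall>s. \<gamma> s $ fst r $ snd r = s * h r s)) \<and>
      ((\<lambda>s. \<gamma> s $ fst u $ snd u) \<longlongrightarrow> 1) (at 0)"
      by (intro exI[of _ \<gamma>] exI[of _ "\<lambda>r _. b r"]) (auto simp: g g[OF u])
  qed simp
  then show ?thesis using u by (simp add: card_free_entries numeral_2_eq_2)
qed

text \<open>Forms on the whole space are determined by their values where one free entry \<open>u\<close> equals 1, since they are
  homogeneous. This saves the one parameter by which the cone exceeds the projective space.\<close>

lemma growth_traceless_le:
  assumes n: "CARD('n::finite) \<ge> 2" and C: "C \<subseteq> (traceless_symmetric :: (complex^'n^'n) set)" and "growth_ge C e"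
  shows "e \<le> ((CARD('n) + 1) choose 2) - 2"
proof -
  fix z :: 'n
  obtain u where u: "u \<in> free_entries z" using free_entries_nonempty[OF n] by blast
  let ?R = "free_entries z - {u}"
  have "e \<le> card ?R"
  proof (rule growth_le_parameters[OF _ _ _ \<open>growth_ge C e\<close>])
    show "poly_mat ?R (\<lambda>b. sym_matrix z (b(u := 1)))"
    proof (rule poly_mat_sym_matrix)
      fix r assume "r \<in> free_entries z"
      then show "poly_fun ?R (\<lambda>b. (b(u := 1)) r)"
        by (cases "r = u") (auto intro: poly_fun_const poly_fun_var)
    qed simp
    fix k f X
    assume f: "hom_poly k f" "\<And>b. f (sym_matrix z (b(u := 1))) = 0" and X: "X \<in> C"
    show "f X = 0"
    proof (rule ccontr)
      assume "f X \<noteq> 0"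
      then have "f (sym_matrix z (\<lambda>r. X $ fst r $ snd r)) \<noteq> 0"
        using traceless_eq_sym_matrix[of X z] X C by auto
      moreover have PM: "poly_mat (free_entries z) (sym_matrix z)"
        by (rule poly_mat_sym_matrix) (auto intro: poly_fun_var)
      have "poly_fun (free_entries z) (\<lambda>b. f (sym_matrix z b))"
        by (rule poly_fun_form[OF _ PM f(1)]) simp
      moreover have "poly_fun (free_entries z) (\<lambda>b. b u)" using u by (simp add: poly_fun_var)
      ultimately obtain v where v: "f (sym_matrix z v) \<noteq> 0" "v u \<noteq> 0"
        using poly_fun_common_nonzero[of "free_entries z" "\<lambda>b. f (sym_matrix z b)" "free_entries z" "\<lambda>b. b u"
            "\<lambda>r. X $ fst r $ snd r" "\<lambda>_. 1"] by auto
      define v' where "v' r = v r / v u" for r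
      have "v' = v'(u := 1)" using v(2) by (auto simp: v'_def)
      then have "f (sym_matrix z v') = 0" using f(2) by metis
      moreover have "sym_matrix z v = cscale (v u) (sym_matrix z v')"
        using v(2) by (simp add: vec_eq_iff sym_matrix_def v'_def sum_divide_distrib[symmetric])
      ultimately show False using v(1) by (simp add: hom_poly_scale[OF f(1)])
    qed
  qed simp
  then show ?thesis using u by (simp add: card_free_entries numeral_2_eq_2)
qed

section \<open>Components of a finite union\<close>

lemma irreducible_in_finite_union:
  assumes "finite K" "irreducible_in T Z" "\<And>i. i \<in> K \<Longrightarrow> closedin T (V i)" "Z \<subseteq> (\<Union>i\<in>K. V i)"
  shows "\<exists>i\<in>K. Z \<subseteq> V i"
  using assms
proof (induction K rule: finite_induct)
  case empty
  then show ?case by (auto simp: irreducible_in_def)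
next
  case (insert x K)
  have "closedin T (\<Union>i\<in>K. V i)" using insert by (intro closedin_Union) auto
  moreover have "Z \<subseteq> V x \<union> (\<Union>i\<in>K. V i)" using insert.prems by auto
  ultimately have "Z \<subseteq> V x \<or> Z \<subseteq> (\<Union>i\<in>K. V i)"
    using insert.prems(1,2) unfolding irreducible_in_def by blast
  then show ?case using insert by blast
qed

text \<open>An irreducible subset of a finite union of closed sets lies in one of them.\<close>

lemma irreducible_components_of_union:
  assumes K: "finite K" and V: "\<And>i. i \<in> K \<Longrightarrow> closedin T (V i)" "\<And>i. i \<in> K \<Longrightarrow> irreducible_in T (V i)"
    and incomparable: "\<And>i j. i \<in> K \<Longrightarrow> j \<in> K \<Longrightarrow> V i \<subseteq> V j \<Longrightarrow> i = j"
  shows "irreducible_components T (\<Union>i\<in>K. V i) = V ` K"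
proof (intro equalityI subsetI)
  fix Z assume Z: "Z \<in> irreducible_components T (\<Union>i\<in>K. V i)"
  then have Z1: "Z \<subseteq> (\<Union>i\<in>K. V i)" "irreducible_in T Z" unfolding irreducible_components_def by auto
  obtain i where i: "i \<in> K" "Z \<subseteq> V i" using irreducible_in_finite_union[OF K Z1(2) V(1) Z1(1)] by blast
  have "V i \<subseteq> (\<Union>i\<in>K. V i)" using i(1) by blast
  then have "V i = Z" using Z i V(2)[OF i(1)] unfolding irreducible_components_def by blast
  then show "Z \<in> V ` K" using i(1) by blast
next
  fix Z assume "Z \<in> V ` K"
  then obtain i where i: "i \<in> K" "Z = V i" by blast
  have "Z' = V i" if Z': "Z' \<subseteq> (\<Union>i\<in>K. V i)" "irreducible_in T Z'" "V i \<subseteq> Z'" for Z'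
  proof -
    obtain j where j: "j \<in> K" "Z' \<subseteq> V j" using irreducible_in_finite_union[OF K Z'(2) V(1) Z'(1)] by blast
    then have "i = j" using incomparable[OF i(1) j(1)] Z'(3) by blast
    then show ?thesis using j(2) Z'(3) by blast
  qed
  moreover have "V i \<subseteq> (\<Union>i\<in>K. V i)" using i(1) by blast
  ultimately show "Z \<in> irreducible_components T (\<Union>i\<in>K. V i)"
    unfolding irreducible_components_def i(2) using V(2)[OF i(1)] by blast
qed

section \<open>The cones over two-eigenvalue pencils, swept along linear directions\<close>

text \<open>The traceless part of \<open>span_proj I G\<close> multiplied by the Gram determinant, and therefore polynomial in \<open>G\<close>.\<close>

definition cleared :: "'n set \<Rightarrow> complex^'n^'n \<Rightarrow> complex^'n^'n" where
  "cleared I G = G ** coord_proj I ** adjugate (gram I G) ** coord_proj I ** transpose G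
     - cscale (of_nat (card I) / of_nat CARD('n) * det (gram I G)) (mat 1)"

lemma cleared_eq:
  fixes G :: "complex^'n^'n"
  assumes "det (gram I G) \<noteq> 0"
  shows "cleared I G = cscale (det (gram I G)) (centred (card I) (span_proj I G))"
  by (simp add: cleared_def adjugate_eq_inverse[OF assms] centred_def span_proj_def mat_ring)
    (simp add: vec_eq_iff algebra_simps)

lemma poly_mat_gram: "finite R \<Longrightarrow> poly_mat R G \<Longrightarrow> poly_mat R (\<lambda>b. gram I (G b))"
  unfolding gram_def
  by (intro poly_mat_add poly_mat_diff poly_mat_mult poly_mat_const poly_mat_transpose)

lemma poly_mat_cleared: "finite R \<Longrightarrow> poly_mat R G \<Longrightarrow> poly_mat R (\<lambda>b. cleared I (G b))"
  unfolding cleared_def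
  by (intro poly_mat_add poly_mat_diff poly_mat_mult poly_mat_const poly_mat_transpose poly_mat_cscale
      poly_mat_adjugate poly_mat_gram poly_fun_mult poly_fun_const poly_fun_det)

text \<open>Parameters are indexed by matrix positions, for a matrix whose columns span a subspace, and by numbers, for
  the coefficients of linear directions.\<close>

definition mat_of :: "('n \<times> 'n + nat \<Rightarrow> complex) \<Rightarrow> complex^'n^'n" where
  "mat_of b = (\<chi> p q. b (Inl (p, q)))"

text \<open>For nondegenerate Gram matrices the first summand runs through representatives of all pencils with two eigenvalues of
  multiplicities \<open>card I\<close> and \<open>n - card I\<close>, the second one through the linear span of \<open>u 0, \<dots>, u (j - 1)\<close>. Increasing \<open>j\<close> produces
  the increasing chain of irreducible sets that realises the codimension.\<close>

definition swept :: "'n set \<Rightarrow> (nat \<Rightarrow> complex^'n^'n) \<Rightarrow> nat \<Rightarrow> ('n \<times> 'n + nat \<Rightarrow> complex) \<Rightarrow> complex^'n^'n" where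
  "swept I u j b = cleared I (mat_of b) + (\<Sum>k<j. cscale (b (Inr k)) (u k))"

text \<open>Parameters with degenerate Gram matrix are excluded, because \<open>cleared\<close> need not come from a projection there;
  so is the vertex of the cone, which is no point of the projective space.\<close>

definition swept_cone :: "'n set \<Rightarrow> (nat \<Rightarrow> complex^'n^'n) \<Rightarrow> nat \<Rightarrow> (complex^'n^'n) set" where
  "swept_cone I u j = {swept I u j b | b. det (gram I (mat_of b)) \<noteq> 0 \<and> swept I u j b \<noteq> 0}"

definition sweep_vars :: "nat \<Rightarrow> ('n::finite \<times> 'n + nat) set" where
  "sweep_vars j = Inl ` UNIV \<union> Inr ` {..<j}"

lemma swept_cone_cong: "(\<And>k. k < j \<Longrightarrow> u k = u' k) \<Longrightarrow> swept_cone I u j = swept_cone I u' j"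
proof -
  assume "\<And>k. k < j \<Longrightarrow> u k = u' k"
  then have "swept I u j = swept I u' j" by (simp add: swept_def fun_eq_iff)
  then show ?thesis by (simp add: swept_cone_def)
qed

lemma finite_sweep_vars: "finite (sweep_vars j)" by (simp add: sweep_vars_def)

lemma poly_mat_mat_of: "poly_mat (sweep_vars j) mat_of"
  by (auto simp: poly_mat_def mat_of_def sweep_vars_def intro!: poly_fun_var)

lemma poly_mat_swept: "poly_mat (sweep_vars j) (swept I u j)"
  unfolding swept_def[abs_def]
  by (intro poly_mat_add poly_mat_cleared poly_mat_sum poly_mat_cscale poly_mat_const poly_mat_mat_of
      finite_sweep_vars poly_fun_var) (auto simp: sweep_vars_def)

lemma poly_fun_gram: "poly_fun (sweep_vars j) (\<lambda>b. det (gram I (mat_of b)))"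
  by (intro poly_fun_det poly_mat_gram poly_mat_mat_of finite_sweep_vars)

text \<open>The image of an irreducible parameter space is irreducible: if neither \<open>f\<close> nor \<open>g\<close> vanishes on it, then
  their pullbacks, multiplied by the conditions excluding bad parameters, have a common non-zero.\<close>

lemma prime_on_swept_cone: "prime_on (swept_cone I u j)"
  unfolding prime_on_def
proof (intro allI impI, rule ccontr)
  fix k l and f g :: "complex^'a^'a \<Rightarrow> complex"
  assume f: "hom_poly k f" and g: "hom_poly l g" and fg: "\<forall>X\<in>swept_cone I u j. f X * g X = 0"
    and n: "\<not> ((\<forall>X\<in>swept_cone I u j. f X = 0) \<or> (\<forall>X\<in>swept_cone I u j. g X = 0))"
  obtain b where b: "det (gram I (mat_of b)) \<noteq> 0" "swept I u j b \<noteq> 0" "f (swept I u j b) \<noteq> 0"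
    using n by (auto simp: swept_cone_def)
  obtain b' where b': "g (swept I u j b') \<noteq> 0" using n by (auto simp: swept_cone_def)
  obtain p q where pq: "swept I u j b $ p $ q \<noteq> 0" using b(2) by (auto simp: vec_eq_iff)
  note F = poly_fun_form[OF finite_sweep_vars[of j] poly_mat_swept[of j I u]]
  have F1: "poly_fun (sweep_vars j) (\<lambda>b. f (swept I u j b) * det (gram I (mat_of b)) * swept I u j b $ p $ q)"
    using poly_mat_swept[of j I u] unfolding poly_mat_def
    by (intro poly_fun_mult finite_sweep_vars F[OF f] poly_fun_gram) blast
  obtain c where "f (swept I u j c) * det (gram I (mat_of c)) * swept I u j c $ p $ q \<noteq> 0"
    "g (swept I u j c) \<noteq> 0"
    using poly_fun_common_nonzero[OF F1 F[OF g], of b b'] b b' pq by auto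
  moreover from this have "swept I u j c \<in> swept_cone I u j" by (auto simp: swept_cone_def)
  ultimately show False using fg by auto
qed

lemma swept_cone_traceless:
  fixes I :: "'n::finite set"
  assumes u: "\<And>k. u k \<in> traceless_symmetric" and I: "0 < card I" "card I < CARD('n)"
  shows "swept_cone I u j \<subseteq> traceless_symmetric - {0}"
proof
  fix X assume "X \<in> swept_cone I u j"
  then obtain b where b: "det (gram I (mat_of b)) \<noteq> 0" "X = swept I u j b" "X \<noteq> 0"
    by (auto simp: swept_cone_def)
  have "cleared I (mat_of b) \<in> traceless_symmetric"
    unfolding cleared_eq[OF b(1)] using centred_orth_proj(1)[OF span_proj_orth_proj[OF b(1)] I]
    by (intro cmat.subspace_scale traceless_symmetric_subspace)
  then have "X \<in> traceless_symmetric" unfolding b(2) swept_def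
    by (intro cmat.subspace_add[OF traceless_symmetric_subspace] cmat.subspace_sum[OF traceless_symmetric_subspace]
        cmat.subspace_scale[OF traceless_symmetric_subspace] u)
  then show "X \<in> traceless_symmetric - {0}" using b(3) by simp
qed

lemma swept_cone_0_eq:
  fixes I :: "'n::finite set"
  assumes I: "0 < card I" "card I < CARD('n)"
  shows "swept_cone I u 0 = {cscale (det (gram I G)) (centred (card I) (span_proj I G)) | G. det (gram I G) \<noteq> 0}"
    (is "_ = ?S")
proof (intro equalityI subsetI)
  fix X assume "X \<in> swept_cone I u 0"
  then obtain b where b: "det (gram I (mat_of b)) \<noteq> 0" "X = swept I u 0 b" by (auto simp: swept_cone_def)
  then have "X = cscale (det (gram I (mat_of b))) (centred (card I) (span_proj I (mat_of b)))"
    by (simp add: swept_def cleared_eq)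
  then show "X \<in> ?S" using b(1) by blast
next
  fix X assume "X \<in> ?S"
  then obtain G where G: "det (gram I G) \<noteq> 0" "X = cscale (det (gram I G)) (centred (card I) (span_proj I G))"
    by blast
  define b where "b = case_sum (\<lambda>(p, q). G $ p $ q) (\<lambda>k::nat. 0)"
  have m: "mat_of b = G" by (simp add: mat_of_def b_def vec_eq_iff)
  have "X = swept I u 0 b" by (simp add: swept_def m cleared_eq[OF G(1)] G(2))
  moreover have "X \<noteq> 0" using centred_orth_proj(2)[OF span_proj_orth_proj[OF G(1)] I] G by auto
  ultimately show "X \<in> swept_cone I u 0" unfolding swept_cone_def using G(1) m by auto
qed

lemma pencil_cscale: "c \<noteq> 0 \<Longrightarrow> pencil (cscale c X) = pencil X"
  by (rule pencil_eqI[of _ c _ 0]) auto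

lemma pencil_swept_cone_0:
  fixes I :: "'n::finite set"
  assumes I: "0 < card I" "card I < CARD('n)"
  shows "pencil ` swept_cone I u 0 = two_eigenvalue_pencils (card I)"
  unfolding swept_cone_0_eq[OF I] two_eigenvalue_pencils_eq[OF I]
proof (intro equalityI subsetI)
  fix L :: "(complex^'n^'n) set" assume "L \<in> pencil ` {cscale (det (gram I G)) (centred (card I) (span_proj I G)) | G. det (gram I G) \<noteq> 0}"
  then obtain G where G: "det (gram I G) \<noteq> 0" "L = pencil (centred (card I) (span_proj I G))"
    using pencil_cscale by auto
  then show "L \<in> (\<lambda>E. pencil (centred (card I) E)) ` orth_proj (card I)"
    using span_proj_orth_proj[OF G(1)] by blast
next
  fix L :: "(complex^'n^'n) set" assume "L \<in> (\<lambda>E. pencil (centred (card I) E)) ` orth_proj (card I)"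
  then obtain E where E: "E \<in> orth_proj (card I)" "L = pencil (centred (card I) E)" by blast
  obtain G where G: "det (gram I G) \<noteq> 0" "span_proj I G = E" using orth_proj_eq_span_proj[OF E(1)] by blast
  then show "L \<in> pencil ` {cscale (det (gram I G)) (centred (card I) (span_proj I G)) | G. det (gram I G) \<noteq> 0}"
    using E(2) pencil_cscale[OF G(1)] by (intro image_eqI[of _ _ "cscale (det (gram I G)) (centred (card I) (span_proj I G))"]) auto
qed

lemma gram_mat_1: "gram I (mat 1) = mat 1"
  by (simp add: gram_def coord_proj_idem)

lemma adjugate_mat_1: "adjugate (mat 1 :: complex^'n^'n) = mat 1"
  using adjugate_eq_inverse[of "mat 1 :: complex^'n^'n"]
    matrix_inv_unique[of "mat 1 :: complex^'n^'n" "mat 1"] by simp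

lemma swept_cone_mono: "swept_cone I u j \<subseteq> swept_cone I u (Suc j)"
proof
  fix X assume "X \<in> swept_cone I u j"
  then obtain b where b: "det (gram I (mat_of b)) \<noteq> 0" "X = swept I u j b" "X \<noteq> 0"
    by (auto simp: swept_cone_def)
  have "swept I u (Suc j) (b(Inr j := 0)) = X" "mat_of (b(Inr j := 0)) = mat_of b"
    using b(2) by (simp_all add: swept_def mat_of_def)
  then show "X \<in> swept_cone I u (Suc j)" unfolding swept_cone_def using b by (intro CollectI exI[of _ "b(Inr j := 0)"]) auto
qed

lemma swept_cone_nonempty:
  fixes I :: "'n::finite set"
  assumes I: "0 < card I" "card I < CARD('n)"
  shows "swept_cone I u j \<noteq> {}"
proof (induction j)
  case 0
  have "det (gram I (mat 1)) \<noteq> 0" by (simp add: gram_mat_1)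
  then show ?case unfolding swept_cone_0_eq[OF I] by blast
next
  case (Suc j)
  then show ?case using swept_cone_mono by blast
qed

text \<open>The matrix of a linear map from the coordinate subspace of \<open>I\<close> to the complementary one.\<close>

definition offdiag :: "'n set \<Rightarrow> ('n \<times> 'n \<Rightarrow> complex) \<Rightarrow> complex^'n^'n" where
  "offdiag I b = (\<chi> p q. if p \<notin> I \<and> q \<in> I then b (p, q) else 0)"

lemma poly_mat_offdiag:
  assumes "finite R" "\<And>p q. p \<notin> I \<Longrightarrow> q \<in> I \<Longrightarrow> poly_fun R (\<lambda>b. \<beta> b (p, q))"
  shows "poly_mat R (\<lambda>b. mat 1 + offdiag I (\<beta> b))"
proof -
  have "poly_fun R (\<lambda>b. offdiag I (\<beta> b) $ p $ q)" for p q
    using assms by (cases "p \<notin> I \<and> q \<in> I") (auto simp: offdiag_def intro: poly_fun_const)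
  then have "poly_mat R (\<lambda>b. offdiag I (\<beta> b))" by (simp add: poly_mat_def)
  then show ?thesis using assms(1) by (intro poly_mat_add poly_mat_const)
qed

text \<open>Density of the chart. Membership of a projection in the chart is the nonvanishing of a determinant that is
  polynomial in \<open>G\<close> once denominators are cleared, and it holds at \<open>G = 1\<close>; so a parameter at which \<open>f\<close> does not
  vanish can be moved into the chart. There the projection is also given by some \<open>1 + B\<close>, and the
  cleared matrices differ by the ratio \<open>d / e\<close> of the Gram determinants, which is harmless by homogeneity.\<close>

lemma swept_cone_dominated_by_chart:
  fixes I :: "'n::finite set" and u :: "nat \<Rightarrow> complex^'n^'n"
  assumes f: "hom_poly k f"
    and chart: "\<And>b. f (cleared I (mat 1 + offdiag I (\<lambda>r. b (Inl r))) + (\<Sum>k<j. cscale (b (Inr k)) (u k))) = 0"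
    and X: "X \<in> swept_cone I u j"
  shows "f X = 0"
proof (rule ccontr)
  assume fX: "f X \<noteq> 0"
  obtain b where b: "det (gram I (mat_of b)) \<noteq> 0" "X = swept I u j b" using X by (auto simp: swept_cone_def)
  let ?J = "coord_proj I :: complex^'n^'n"
  \<comment> \<open>The determinant deciding membership in the chart, with denominators cleared.\<close>
  define N where "N G = ?J ** (G ** ?J ** adjugate (gram I G) ** ?J ** transpose G) ** ?J
     + cscale (det (gram I G)) (mat 1 - ?J)" for G
  have N: "poly_fun (sweep_vars j) (\<lambda>b. det (N (mat_of b)))"
    unfolding N_def
    by (intro poly_fun_det poly_mat_add poly_mat_diff poly_mat_mult poly_mat_const poly_mat_transpose poly_mat_cscale
      poly_mat_adjugate poly_mat_gram poly_mat_mat_of finite_sweep_vars)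
  have F: "poly_fun (sweep_vars j) (\<lambda>b. f (swept I u j b) * det (gram I (mat_of b)))"
    by (intro poly_fun_mult finite_sweep_vars poly_fun_form[OF finite_sweep_vars poly_mat_swept f] poly_fun_gram)
  define b1 :: "'n \<times> 'n + nat \<Rightarrow> complex" where "b1 = case_sum (\<lambda>(p, q). if p = q then 1 else 0) (\<lambda>_. 0)"
  have b1: "mat_of b1 = mat 1" by (simp add: mat_of_def b1_def mat_def)
  have "N (mat 1) = mat 1"
    by (simp add: N_def gram_mat_1 adjugate_mat_1 coord_proj_idem)
  then have "det (N (mat_of b1)) \<noteq> 0" by (simp add: b1)
  then obtain c where c: "f (swept I u j c) * det (gram I (mat_of c)) \<noteq> 0" "det (N (mat_of c)) \<noteq> 0"
    using poly_fun_common_nonzero[OF F N, of b b1] b fX by auto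
  define G where "G = mat_of c"
  define d where "d = det (gram I G)"
  have d: "d \<noteq> 0" using c(1) by (auto simp: d_def G_def)
  define E where "E = span_proj I G"
  have "N G = cscale d (?J ** E ** ?J + (mat 1 - ?J))"
    unfolding N_def d_def[symmetric] E_def span_proj_def
    using d by (simp add: adjugate_eq_inverse d_def mat_ring) (simp add: vec_eq_iff algebra_simps)
  then have dE: "det (?J ** E ** ?J + (mat 1 - ?J)) \<noteq> 0"
    using c(2) det_cscale_nonzero by (metis G_def)
  have EI: "E \<in> orth_proj (card I)" unfolding E_def by (rule span_proj_orth_proj) (use d in \<open>simp add: d_def\<close>)
  obtain B where B: "?J ** B = 0" "B ** ?J = B" "det (gram I (mat 1 + B)) \<noteq> 0" "span_proj I (mat 1 + B) = E"
    using orth_proj_chart[OF EI dE] by blast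
  define e where "e = det (gram I (mat 1 + B))"
  have "B $ p $ q = 0" if "p \<in> I \<or> q \<notin> I" for p q
  proof -
    have "(?J ** B) $ p $ q = 0" "(B ** ?J) $ p $ q = B $ p $ q" using B(1,2) by simp_all
    then show ?thesis using that by (auto split: if_splits)
  qed
  then have BO: "B = offdiag I (\<lambda>(p, q). B $ p $ q)" by (simp add: offdiag_def vec_eq_iff)
  have e: "e \<noteq> 0" using B(3) by (simp add: e_def)
  \<comment> \<open>The linear parameters are rescaled so that the factor \<open>d / e\<close> can be taken out of the whole sum.\<close>
  define b' where "b' = case_sum (\<lambda>(p, q). B $ p $ q) (\<lambda>k. c (Inr k) * e / d)"
  have "cleared I G = cscale (d / e) (cleared I (mat 1 + B))"
    using d e by (simp add: cleared_eq d_def[symmetric] e_def[symmetric] B(4) E_def[symmetric])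
  then have "swept I u j c = cscale (d / e) (cleared I (mat 1 + B) + (\<Sum>k<j. cscale (b' (Inr k)) (u k)))"
    using d e by (simp add: swept_def G_def[symmetric] b'_def cmat.scale_right_distrib cmat.scale_sum_right)
  moreover have "f (cleared I (mat 1 + B) + (\<Sum>k<j. cscale (b' (Inr k)) (u k))) = 0"
  proof -
    have "mat 1 + B = mat 1 + offdiag I (\<lambda>r. b' (Inl r))" using BO by (simp add: b'_def)
    then show ?thesis using chart[of b'] by simp
  qed
  ultimately show False using c(1) by (simp add: hom_poly_scale[OF f])
qed

text \<open>The chart has \<open>card I * (n - card I)\<close> parameters, and each additional direction contributes one.\<close>

lemma growth_swept_cone_le:
  fixes I :: "'n::finite set" and u :: "nat \<Rightarrow> complex^'n^'n"
  assumes "growth_ge (swept_cone I u j) e"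
  shows "e \<le> card I * (CARD('n) - card I) + j"
proof -
  let ?R = "Inl ` ((- I) \<times> I) \<union> Inr ` {..<j}"
  have "e \<le> card ?R"
  proof (rule growth_le_parameters[OF _ _ _ assms])
    show "poly_mat ?R (\<lambda>b. cleared I (mat 1 + offdiag I (\<lambda>r. b (Inl r))) + (\<Sum>k<j. cscale (b (Inr k)) (u k)))"
      by (intro poly_mat_add poly_mat_cleared poly_mat_offdiag poly_mat_sum poly_mat_cscale poly_mat_const poly_fun_var)
        auto
  qed (use swept_cone_dominated_by_chart in \<open>blast | simp\<close>)+
  also have "card ?R = card (Inl ` ((- I) \<times> I) :: ('n \<times> 'n + nat) set) + card (Inr ` {..<j} :: ('n \<times> 'n + nat) set)"
    by (rule card_Un_disjoint) auto
  also have "\<dots> = card I * (CARD('n) - card I) + j"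
    by (simp add: card_image card_cartesian_product Compl_eq_Diff_UNIV card_Diff_subset)
  finally show ?thesis .
qed

text \<open>Along \<open>G = 1 + s B\<close> with \<open>B\<close> in the off-diagonal block, the projection starts at the coordinate
  projection, and its off-diagonal block is \<open>s B\<close> up to higher order in \<open>s\<close>. So these entries move
  independently to first order.\<close>

lemma growth_swept_cone_0:
  fixes I :: "'n::finite set"
  assumes I: "0 < card I" "card I < CARD('n)"
  shows "growth_ge (swept_cone I u 0) (card I * (CARD('n) - card I))"
proof -
  let ?J = "coord_proj I :: complex^'n^'n" and ?R = "(- I) \<times> I"
  obtain z where z: "z \<in> I" using I(1) by fastforce
  define y0 :: complex where "y0 = 1 - of_nat (card I) / of_nat CARD('n)"
  have "y0 \<noteq> 0"
  proof
    assume "y0 = 0"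
    then have "(of_nat (card I) :: complex) = of_nat CARD('n)" by (simp add: y0_def)
    then show False using I(2) by (simp only: of_nat_eq_iff)
  qed
  then have "growth_ge (swept_cone I u 0) (card ?R)"
  proof (rule growth_from_tangent[of y0 _ _ "(z, z)"])
    fix b :: "'n \<times> 'n \<Rightarrow> complex"
    define B where "B = offdiag I b"
    define M where "M s = mat 1 + offdiag I (\<lambda>r. s * b r)" for s
    define A where "A s = adjugate (gram I (M s))" for s
    have pm: "poly_mat ?R (\<lambda>b. mat 1 + offdiag I b)"
      by (rule poly_mat_offdiag) (auto intro: poly_fun_var)
    have M0: "mat 1 + offdiag I (\<lambda>r. 0) = mat 1" by (simp add: offdiag_def vec_eq_iff)
    have lim_b: "((\<lambda>s::complex. s * b r) \<longlongrightarrow> 0) (at 0)" for r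
    proof -
      have "((\<lambda>s::complex. s * b r) \<longlongrightarrow> 0 * b r) (at 0)" by (intro tendsto_intros)
      then show ?thesis by simp
    qed
    have A: "((\<lambda>s. A s $ p $ q) \<longlongrightarrow> mat 1 $ p $ q) (at 0)" for p q
    proof -
      have "poly_fun ?R (\<lambda>b. adjugate (gram I (mat 1 + offdiag I b)) $ p $ q)"
        using poly_mat_adjugate[OF _ poly_mat_gram[OF _ pm]] by (simp add: poly_mat_def)
      from poly_fun_tendsto[OF this lim_b] show ?thesis by (simp add: A_def M_def M0 gram_mat_1 adjugate_mat_1)
    qed
    have D: "((\<lambda>s. det (gram I (M s))) \<longlongrightarrow> 1) (at 0)"
    proof -
      have "poly_fun ?R (\<lambda>b. det (gram I (mat 1 + offdiag I b)))"
        using poly_fun_det[OF _ poly_mat_gram[OF _ pm]] by simp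
      from poly_fun_tendsto[OF this lim_b] show ?thesis by (simp add: M_def M0 gram_mat_1)
    qed
    define \<gamma> where "\<gamma> s = cleared I (M s)" for s
    define h where "h r s = (\<Sum>x\<in>UNIV. B $ fst r $ x * A s $ x $ snd r)" for r s
    have MJ: "(M s ** ?J) $ p $ x = s * B $ p $ x" if "p \<notin> I" for p x s
      using that by (auto simp: M_def B_def offdiag_def mat_def)
    have MJ': "(M s ** ?J) $ q $ y = (if y = q then 1 else 0)" if "q \<in> I" for q y s
      using that by (auto simp: M_def offdiag_def mat_def)
    have entry: "(M s ** ?J ** A s ** ?J ** transpose (M s)) $ p $ q = (M s ** ?J ** A s) $ p $ q"
      if q: "q \<in> I" for p q s
    proof -
      have "M s ** ?J ** A s ** ?J ** transpose (M s) = (M s ** ?J ** A s) ** transpose (M s ** ?J)"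
        by (simp add: matrix_transpose_mul coord_proj_transpose matrix_mul_assoc)
      also have "\<dots> $ p $ q = (\<Sum>y\<in>UNIV. (M s ** ?J ** A s) $ p $ y * (M s ** ?J) $ q $ y)"
        unfolding matrix_matrix_mult_def[of "M s ** ?J ** A s"] by (simp add: transpose_def)
      also have "\<dots> = (\<Sum>y\<in>UNIV. if y = q then (M s ** ?J ** A s) $ p $ q else 0)"
        unfolding MJ'[OF q] by (rule sum.cong) auto
      finally show ?thesis by simp
    qed
    have mult_entry: "(M s ** ?J ** A s) $ p $ q = (\<Sum>x\<in>UNIV. (M s ** ?J) $ p $ x * A s $ x $ q)" for p q s
      unfolding matrix_matrix_mult_def[of "M s ** ?J" "A s"] by simp
    have off: "\<gamma> s $ p $ q = s * h (p, q) s" if "p \<notin> I" "q \<in> I" for p q s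
    proof -
      have "p \<noteq> q" using that by blast
      then have "\<gamma> s $ p $ q = (M s ** ?J ** A s) $ p $ q"
        using entry[OF that(2), of s p] unfolding \<gamma>_def cleared_def A_def by (simp add: mat_def)
      then show ?thesis unfolding mult_entry MJ[OF that(1)]
        by (simp add: h_def sum_distrib_left mult.assoc)
    qed
    have diag: "\<gamma> s $ z $ z = A s $ z $ z - of_nat (card I) / of_nat CARD('n) * det (gram I (M s))" for s
    proof -
      have "(M s ** ?J ** A s) $ z $ z = (\<Sum>x\<in>UNIV. if x = z then A s $ z $ z else 0)"
        unfolding mult_entry MJ'[OF z] by (rule sum.cong) auto
      then show ?thesis using entry[OF z, of s z] unfolding \<gamma>_def cleared_def A_def by (simp add: mat_def)
    qed
    have "(h r \<longlongrightarrow> b r) (at 0)" if "r \<in> ?R" for r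
    proof -
      have "(h r \<longlongrightarrow> (\<Sum>x\<in>UNIV. B $ fst r $ x * mat 1 $ x $ snd r)) (at 0)"
        unfolding h_def[abs_def] by (intro tendsto_intros A)
      also have "(\<Sum>x\<in>UNIV. B $ fst r $ x * mat 1 $ x $ snd r) = (\<Sum>x\<in>UNIV. if x = snd r then B $ fst r $ snd r else 0)"
        by (rule sum.cong) (auto simp: mat_def)
      also have "\<dots> = b r" using that by (auto simp: B_def offdiag_def)
      finally show ?thesis .
    qed
    moreover have "((\<lambda>s. \<gamma> s $ z $ z) \<longlongrightarrow> y0) (at 0)"
    proof -
      have "((\<lambda>s. \<gamma> s $ z $ z) \<longlongrightarrow> mat 1 $ z $ z - of_nat (card I) / of_nat CARD('n) * 1) (at 0)"
        unfolding diag by (intro tendsto_intros A D)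
      then show ?thesis by (simp add: y0_def mat_def)
    qed
    moreover have "\<forall>\<^sub>F s in at 0. \<gamma> s \<in> swept_cone I u 0"
    proof (rule eventually_mono[OF tendsto_imp_eventually_ne[OF D, of 0]])
      show "\<gamma> s \<in> swept_cone I u 0" if "det (gram I (M s)) \<noteq> 0" for s
        unfolding swept_cone_0_eq[OF I] \<gamma>_def cleared_eq[OF that] using that by blast
    qed simp
    ultimately show "\<exists>\<gamma> h. (\<forall>\<^sub>F s in at 0. \<gamma> s \<in> swept_cone I u 0) \<and>
      (\<forall>r\<in>?R. (h r \<longlongrightarrow> b r) (at 0) \<and> (\<forall>s. \<gamma> s $ fst r $ snd r = s * h r s)) \<and>
      ((\<lambda>s. \<gamma> s $ fst (z, z) $ snd (z, z)) \<longlongrightarrow> y0) (at 0)"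
      using off by (intro exI[of _ \<gamma>] exI[of _ h]) auto
  qed
  then show ?thesis
    by (simp add: card_cartesian_product Compl_eq_Diff_UNIV card_Diff_subset mult.commute)
qed

section \<open>Codimension\<close>

text \<open>A symmetric matrix consists of two symmetric diagonal blocks and one rectangular block.\<close>

lemma dim_count:
  assumes "i \<le> n"
  shows "(n + 1) choose 2 = ((i + 1) choose 2) + ((n - i + 1) choose 2) + i * (n - i)"
proof -
  have "(i + k + 1) choose 2 = ((i + 1) choose 2) + ((k + 1) choose 2) + i * k" for k
    by (induction k) (simp_all add: numeral_2_eq_2)
  from this[of "n - i"] assms show ?thesis by simp
qed

text \<open>Directions are chosen greedily. If no further direction enlarged the closure, the closure would contain every
  traceless symmetric matrix \<open>Y\<close>, as \<open>Y = X + (Y - X)\<close> lies on the sweep of a point \<open>X\<close> in the direction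
  \<open>Y - X\<close>. Then the dimension of the whole space would be bounded by the number of parameters,
  which is still too small at step \<open>j\<close>.\<close>

lemma strict_chain_exists:
  fixes I :: "'n::finite set"
  assumes n: "CARD('n) \<ge> 2" and I: "0 < card I" "card I < CARD('n)"
    and j: "j + card I * (CARD('n) - card I) \<le> ((CARD('n) + 1) choose 2) - 2"
  shows "\<exists>u :: nat \<Rightarrow> complex^'n^'n. (\<forall>k. u k \<in> traceless_symmetric) \<and>
     (\<forall>k<j. hull_of_forms (swept_cone I u k) \<subset> hull_of_forms (swept_cone I u (Suc k)))"
  using j
proof (induction j)
  case 0
  have "(\<lambda>_. 0) k \<in> (traceless_symmetric :: (complex^'n^'n) set)" for k :: nat
    using cmat.subspace_0[OF traceless_symmetric_subspace] by simp
  then show ?case by (intro exI[of _ "\<lambda>_. 0"]) auto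
next
  case (Suc j)
  then obtain u :: "nat \<Rightarrow> complex^'n^'n" where u: "\<And>k. u k \<in> traceless_symmetric"
    "\<And>k. k < j \<Longrightarrow> hull_of_forms (swept_cone I u k) \<subset> hull_of_forms (swept_cone I u (Suc k))" by auto
  have "\<exists>v\<in>traceless_symmetric. \<not> swept_cone I (u(j := v)) (Suc j) \<subseteq> hull_of_forms (swept_cone I u j)"
  proof (rule ccontr)
    assume "\<not> ?thesis"
    then have all: "\<And>v. v \<in> traceless_symmetric \<Longrightarrow> swept_cone I (u(j := v)) (Suc j) \<subseteq> hull_of_forms (swept_cone I u j)"
      by blast
    obtain X where X: "X \<in> swept_cone I u j" using swept_cone_nonempty[OF I] by blast
    then obtain b where b: "det (gram I (mat_of b)) \<noteq> 0" "X = swept I u j b" by (auto simp: swept_cone_def)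
    have XW: "X \<in> traceless_symmetric" using swept_cone_traceless[of u, OF u(1) I] X by blast
    have whole: "Y \<in> hull_of_forms (swept_cone I u j)" if Y: "Y \<in> traceless_symmetric - {0}" for Y
    proof -
      have "Y - X \<in> traceless_symmetric" using Y XW cmat.subspace_diff[OF traceless_symmetric_subspace] by blast
      moreover have "swept I (u(j := Y - X)) (Suc j) (b(Inr j := 1)) = Y"
        "mat_of (b(Inr j := 1)) = mat_of b"
        using b(2) by (simp_all add: swept_def mat_of_def)
      then have "Y \<in> swept_cone I (u(j := Y - X)) (Suc j)"
        unfolding swept_cone_def using b(1) Y by (intro CollectI exI[of _ "b(Inr j := 1)"]) auto
      ultimately show ?thesis using all by blast
    qed
    have "growth_ge (swept_cone I u j) (((CARD('n) + 1) choose 2) - 2)"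
      using growth_hull[OF growth_mono[OF growth_traceless[OF n] subsetI[OF whole]]] .
    then have "((CARD('n) + 1) choose 2) - 2 \<le> card I * (CARD('n) - card I) + j" by (rule growth_swept_cone_le)
    then show False using Suc.prems by linarith
  qed
  then obtain v where v: "v \<in> traceless_symmetric"
    "\<not> swept_cone I (u(j := v)) (Suc j) \<subseteq> hull_of_forms (swept_cone I u j)" by blast
  define u' where "u' = u(j := v)"
  have u'W: "u' k \<in> traceless_symmetric" for k using u(1) v(1) by (simp add: u'_def)
  have same: "swept_cone I u' k = swept_cone I u k" if "k \<le> j" for k
    by (rule swept_cone_cong) (use that in \<open>simp add: u'_def\<close>)
  have "hull_of_forms (swept_cone I u' k) \<subset> hull_of_forms (swept_cone I u' (Suc k))" if "k < Suc j" for k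
  proof (cases "k = j")
    case False
    then show ?thesis using u(2)[of k] same that by simp
  next
    case True
    have "hull_of_forms (swept_cone I u' j) \<subseteq> hull_of_forms (swept_cone I u' (Suc j))"
      by (rule hull_of_forms_mono[OF swept_cone_mono])
    moreover have "\<not> hull_of_forms (swept_cone I u' (Suc j)) \<subseteq> hull_of_forms (swept_cone I u' j)"
      using v(2) same[of j] subset_hull_of_forms[OF swept_cone_traceless[of u', OF u'W I], of "Suc j"] unfolding u'_def
      by auto
    ultimately show ?thesis using True by blast
  qed
  then show ?case using u'W by blast
qed

text \<open>Consecutive sets are separated by a form that vanishes on the smaller one only, so each step raises the growth
  by one.\<close>

lemma closed_chain_growth:
  fixes c :: "nat \<Rightarrow> (complex^'n^'n) set set"
  assumes cl: "\<And>k. k \<le> m \<Longrightarrow> closedin Gr_zariski (c k) \<and> irreducible_in Gr_zariski (c k)"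
    and strict: "\<And>k. k < m \<Longrightarrow> c k \<subset> c (Suc k)" and growth_ge: "growth_ge (affine_cone (c 0)) d"
  shows "k \<le> m \<Longrightarrow> growth_ge (affine_cone (c k)) (d + k)"
proof (induction k)
  case 0
  then show ?case using growth_ge by simp
next
  case (Suc k)
  have sub: "c k \<subseteq> restricted_Gr" "c (Suc k) \<subseteq> restricted_Gr"
    using cl[of k] cl[of "Suc k"] Suc.prems closedin_subset topspace_Gr_zariski by fastforce+
  obtain e g where g: "hom_poly e g" "\<forall>X\<in>affine_cone (c k). g X = 0" "\<exists>X\<in>affine_cone (c (Suc k)). g X \<noteq> 0"
    using form_separating_closed[of "c k" "c (Suc k)"] cl[of k] strict[of k] sub Suc.prems by auto
  obtain L where "L \<in> c k" using cl[of k] Suc.prems by (auto simp: irreducible_in_def)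
  then obtain X0 where X0: "X0 \<in> affine_cone (c k)" using cone_point_exists[OF sub(1)] by blast
  have "growth_ge (affine_cone (c (Suc k))) (Suc (d + k))"
  proof (rule growth_step[OF _ _ g(1)])
    show "prime_on (affine_cone (c (Suc k)))" "prime_on (affine_cone (c k))"
      using cl[of k] cl[of "Suc k"] Suc.prems prime_on_cone by auto
    show "affine_cone (c k) \<subseteq> affine_cone (c (Suc k))" using strict[of k] Suc.prems by (auto simp: affine_cone_def)
    show "X0 \<in> affine_cone (c k)" "X0 \<noteq> 0" using X0 by (auto simp: affine_cone_def)
    show "growth_ge (affine_cone (c k)) (d + k)" using Suc by simp
  qed (use g in blast)+
  then show ?case by simp
qed

text \<open>A chain starting at the closure cannot be longer than the dimensions permit, since each step raises the growth of
  the Hilbert function; the sweep in greedily chosen directions attains this length.\<close>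

lemma codim_two_eigenvalue_closure:
  assumes n: "CARD('n::finite) \<ge> 2" and i: "0 < i" "i < CARD('n)"
  shows "codim_in Gr_zariski (Gr_zariski closure_of (two_eigenvalue_pencils i :: (complex^'n^'n) set set))
    = enat (((i + 1) choose 2) + ((CARD('n) - i + 1) choose 2) - 2)"
proof -
  let ?N = "((CARD('n) + 1) choose 2) - 2" and ?d = "i * (CARD('n) - i)"
  let ?V = "Gr_zariski closure_of (two_eigenvalue_pencils i :: (complex^'n^'n) set set)"
  have d: "((i + 1) choose 2) + ((CARD('n) - i + 1) choose 2) - 2 = ?N - ?d"
    using dim_count[of i "CARD('n)"] i by simp
  obtain I :: "'n set" where I: "card I = i" using i by (metis obtain_subset_with_card_n less_imp_le)
  note Ii = i[folded I]
  have V: "?V = Gr_zariski closure_of (pencil ` swept_cone I u 0)" for u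
    using pencil_swept_cone_0[OF Ii, of u] I by simp
  have grow0: "growth_ge (swept_cone I u 0) ?d" for u using growth_swept_cone_0[OF Ii] I by simp
  have zeroW: "(\<lambda>_. 0) k \<in> (traceless_symmetric :: (complex^'n^'n) set)" for k :: nat
    using cmat.subspace_0[OF traceless_symmetric_subspace] by simp
  have upper: "m \<le> ?N - ?d"
    if c0: "c 0 = ?V" and cl: "\<forall>k\<le>m. closedin Gr_zariski (c k) \<and> irreducible_in Gr_zariski (c k)"
      and st: "\<forall>k<m. c k \<subset> c (Suc k)" for m and c :: "nat \<Rightarrow> (complex^'n^'n) set set"
  proof -
    let ?C = "swept_cone I (\<lambda>_. 0) 0 :: (complex^'n^'n) set"
    have CW: "?C \<subseteq> traceless_symmetric - {0}" by (rule swept_cone_traceless[OF zeroW Ii])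
    have "affine_cone (c 0) = hull_of_forms ?C"
      unfolding c0 V[of "\<lambda>_. 0"] closure_of_pencils[OF CW] by (rule cone_pencils_hull)
    then have g0: "growth_ge (affine_cone (c 0)) ?d" using growth_mono[OF grow0 subset_hull_of_forms[OF CW]] by simp
    have "growth_ge (affine_cone (c m)) (?d + m)"
    proof (rule closed_chain_growth[where c = c and m = m])
      show "growth_ge (affine_cone (c 0)) ?d" by (rule g0)
    qed (use cl st in simp_all)
    moreover have "affine_cone (c m) \<subseteq> traceless_symmetric" by (auto simp: affine_cone_def)
    ultimately have "?d + m \<le> ?N" using growth_traceless_le[OF n] by blast
    then show ?thesis by linarith
  qed
  have dN: "?d \<le> ?N"
    using growth_traceless_le[OF n _ grow0[of "\<lambda>_. 0"]] swept_cone_traceless[OF zeroW Ii] by blast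
  then have "(?N - ?d) + card I * (CARD('n) - card I) \<le> ?N" unfolding I by linarith
  from strict_chain_exists[OF n Ii this] obtain u :: "nat \<Rightarrow> complex^'n^'n"
    where u: "\<And>k. u k \<in> traceless_symmetric"
    "\<And>k. k < ?N - ?d \<Longrightarrow> hull_of_forms (swept_cone I u k) \<subset> hull_of_forms (swept_cone I u (Suc k))" by blast
  note W = swept_cone_traceless[of u, OF u(1) Ii]
  define c where "c k = Gr_zariski closure_of (pencil ` swept_cone I u k)" for k
  have "c k \<subset> c (Suc k)" if "k < ?N - ?d" for k
  proof -
    have "c k \<noteq> c (Suc k)"
    proof
      assume "c k = c (Suc k)"
      then have "affine_cone (c k) = affine_cone (c (Suc k))" by simp
      then show False using u(2)[OF that] unfolding c_def closure_of_pencils[OF W] cone_pencils_hull by blast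
    qed
    moreover have "c k \<subseteq> c (Suc k)" unfolding c_def by (intro closure_of_mono image_mono swept_cone_mono)
    ultimately show ?thesis by blast
  qed
  moreover have "closedin Gr_zariski (c k) \<and> irreducible_in Gr_zariski (c k)" for k
    unfolding c_def using irreducible_closure_of_pencils[OF W swept_cone_nonempty[OF Ii] prime_on_swept_cone] by simp
  moreover have "c 0 = ?V" unfolding c_def using V by simp
  ultimately have attained: "\<exists>c. c 0 = ?V \<and> (\<forall>k\<le>?N - ?d. closedin Gr_zariski (c k) \<and> irreducible_in Gr_zariski (c k)) \<and>
      (\<forall>k<?N - ?d. c k \<subset> c (Suc k))" by blast
  show ?thesis
    unfolding codim_in_def d
  proof (rule antisym)
    show "enat (?N - ?d) \<le> Sup {enat m |m. \<exists>c. c 0 = ?V \<and> (\<forall>k\<le>m. closedin Gr_zariski (c k) \<and> irreducible_in Gr_zariski (c k)) \<and>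
      (\<forall>k<m. c k \<subset> c (Suc k))}"
      using attained by (intro Sup_upper) blast
  qed (rule Sup_least, use upper in auto)
qed

section \<open>Decomposition of the Jordan locus\<close>

lemma hom_poly_square_entry: "hom_poly 2 (\<lambda>X :: complex^'n^'n. (X ** X) $ p $ q)"
proof -
  have "hom_poly (1 + 1) (\<lambda>X :: complex^'n^'n. \<Sum>k\<in>UNIV. X $ p $ k * X $ k $ q)"
    by (intro hom_poly_sum hom_poly.mult hom_poly.coord)
  then show ?thesis unfolding one_add_one by (simp add: matrix_matrix_mult_def)
qed

text \<open>For a traceless \<open>X\<close> with eigenvalues of multiplicities \<open>i\<close> and \<open>n - i\<close>, the ratio
  \<open>(trace X\<^sup>3)\<^sup>2 / (trace X\<^sup>2)\<^sup>3\<close> is \<open>(n - 2 i)\<^sup>2 / (n i (n - i))\<close>. The form expresses that this ratio has its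
  value for \<open>i = j\<close>.\<close>

definition trace_form :: "nat \<Rightarrow> complex^'n^'n \<Rightarrow> complex" where
  "trace_form j X = of_nat CARD('n) * of_nat j * (of_nat CARD('n) - of_nat j) * trace (X ** (X ** X)) ^ 2
     - (of_nat CARD('n) - 2 * of_nat j) ^ 2 * trace (X ** X) ^ 3"

lemma hom_poly_trace_form: "hom_poly 6 (trace_form j :: complex^'n^'n \<Rightarrow> complex)"
proof -
  note c2 = hom_poly_square_entry
  have c3: "hom_poly 3 (\<lambda>X :: complex^'n^'n. (X ** (X ** X)) $ p $ q)" for p q
  proof -
    have entry: "(X ** (X ** X)) $ p $ q = (\<Sum>k\<in>UNIV. X $ p $ k * (X ** X) $ k $ q)" for X :: "complex^'n^'n"
      unfolding matrix_matrix_mult_def[of X "X ** X"] by simp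
    have three: "(3 :: nat) = 1 + 2" by simp
    show ?thesis
      unfolding entry three by (intro hom_poly_sum hom_poly.mult hom_poly.coord c2)
  qed
  have t2: "hom_poly 2 (\<lambda>X :: complex^'n^'n. trace (X ** X))"
    unfolding trace_def by (intro hom_poly_sum c2)
  have t3: "hom_poly 3 (\<lambda>X :: complex^'n^'n. trace (X ** (X ** X)))"
    unfolding trace_def by (intro hom_poly_sum c3)
  have "hom_poly 6 (\<lambda>X :: complex^'n^'n. trace (X ** (X ** X)) ^ 2)" "hom_poly 6 (\<lambda>X :: complex^'n^'n. trace (X ** X) ^ 3)"
    using hom_poly_power[OF t3, of 2] hom_poly_power[OF t2, of 3] by simp_all
  then show ?thesis unfolding trace_form_def[abs_def] by (intro hom_poly_diff hom_poly_cmult)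
qed

lemma trace_form_centred:
  fixes E :: "complex^'n^'n"
  assumes E: "E \<in> orth_proj i"
  shows "trace_form j (centred i E)
    = of_nat i ^ 2 * (of_nat CARD('n) - of_nat i) ^ 2 / of_nat CARD('n)
      * (of_nat j * (of_nat CARD('n) - of_nat j) - of_nat i * (of_nat CARD('n) - of_nat i))"
proof -
  define N where "N = (of_nat CARD('n) :: complex)"
  define a where "a = (of_nat i :: complex)"
  define t where "t = (of_nat j :: complex)"
  have N: "N \<noteq> 0" by (simp add: N_def)
  have EE: "E ** E = E" and tr: "trace E = a" using E by (auto simp: orth_proj_def a_def)
  have X: "centred i E = E - cscale (a / N) (mat 1)" by (simp add: centred_def a_def N_def)
  have XX: "centred i E ** centred i E = cscale (1 - 2 * (a / N)) E + cscale ((a / N) ^ 2) (mat 1)"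
    by (simp add: X mat_ring EE) (simp add: vec_eq_iff algebra_simps power2_eq_square)
  have XXX: "centred i E ** (centred i E ** centred i E)
      = cscale (1 - 3 * (a / N) + 3 * (a / N) ^ 2) E - cscale ((a / N) ^ 3) (mat 1)"
    unfolding XX by (simp add: X mat_ring EE) (simp add: vec_eq_iff algebra_simps power2_eq_square power3_eq_cube)
  have t2: "trace (centred i E ** centred i E) = a * (N - a) / N"
    unfolding XX using N by (simp add: trace_add trace_cscale tr trace_I N_def[symmetric] field_simps power2_eq_square)
  have t3: "trace (centred i E ** (centred i E ** centred i E)) = a * (N - a) * (N - 2 * a) / N ^ 2"
    unfolding XXX using N
    by (simp add: trace_sub trace_cscale tr trace_I N_def[symmetric] field_simps power2_eq_square power3_eq_cube)
  show ?thesis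
    unfolding trace_form_def t2 t3 N_def[symmetric] a_def[symmetric] t_def[symmetric]
    using N by (simp add: field_simps power2_eq_square power3_eq_cube)
qed

text \<open>For traceless \<open>X\<close>, the square lies in the pencil if and only if its traceless part is proportional to \<open>X\<close>.\<close>

definition traceless_square :: "complex^'n^'n \<Rightarrow> complex^'n^'n" where
  "traceless_square X = X ** X - cscale (1 / of_nat CARD('n) * trace (X ** X)) (mat 1)"

text \<open>Proportionality to \<open>X\<close> is expressed by the vanishing of \<open>2 \<times> 2\<close> minors, which are forms of degree 3.\<close>

lemma closedin_restricted_Jo: "closedin Gr_zariski (restricted_Jo :: (complex^'n^'n) set set)"
proof -
  define m where "m = (\<lambda>(p, q, r, s) (X :: complex^'n^'n).
     traceless_square X $ p $ q * X $ r $ s - traceless_square X $ r $ s * X $ p $ q)"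
  have ts: "hom_poly 2 (\<lambda>X :: complex^'n^'n. traceless_square X $ p $ q)" for p q
  proof -
    have "hom_poly 2 (\<lambda>X :: complex^'n^'n. (X ** X) $ p $ q
        - (1 / of_nat CARD('n) * mat 1 $ p $ q) * (\<Sum>k\<in>UNIV. (X ** X) $ k $ k))"
      by (intro hom_poly_diff hom_poly_cmult hom_poly_sum hom_poly_square_entry)
    then show ?thesis by (simp add: traceless_square_def trace_def mult_ac)
  qed
  have m: "hom_poly (2 + 1) (m x)" for x
    unfolding m_def by (cases x) (simp only: case_prod_conv, intro hom_poly_diff hom_poly.mult ts hom_poly.coord)
  then have F: "\<forall>f\<in>range m. \<exists>k. hom_poly k f" by blast
  have iff: "X ** X \<in> pencil X \<longleftrightarrow> (\<forall>f\<in>range m. f X = 0)"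
    if X: "X \<in> traceless_symmetric" "X \<noteq> 0" for X
  proof
    assume "X ** X \<in> pencil X"
    then obtain b a where ab: "X ** X = cscale b (mat 1) + cscale a X" by (auto simp: mem_pencil)
    have "trace X = 0" using X by (simp add: traceless_symmetric_def)
    then have "traceless_square X = cscale a X"
      by (simp add: traceless_square_def ab trace_add trace_cscale trace_I)
    then show "\<forall>f\<in>range m. f X = 0" by (auto simp: m_def)
  next
    assume 0: "\<forall>f\<in>range m. f X = 0"
    obtain r s where rs: "X $ r $ s \<noteq> 0" using X(2) by (auto simp: vec_eq_iff)
    define t where "t = traceless_square X $ r $ s / X $ r $ s"
    have "traceless_square X $ p $ q = t * X $ p $ q" for p q
    proof -
      have "m (p, q, r, s) X = 0" using 0 by blast
      then show ?thesis using rs by (simp add: m_def t_def field_simps)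
    qed
    then have "traceless_square X = cscale t X" by (simp add: vec_eq_iff)
    moreover have "X ** X = cscale (1 / of_nat CARD('n) * trace (X ** X)) (mat 1) + traceless_square X"
      by (simp add: traceless_square_def)
    ultimately show "X ** X \<in> pencil X" unfolding mem_pencil by metis
  qed
  have "L \<in> restricted_Jo \<longleftrightarrow> L \<in> Gr_zeros (range m)" for L
  proof (cases "L \<in> restricted_Gr")
    case True
    then obtain X where X: "X \<in> traceless_symmetric" "X \<noteq> 0" "L = pencil X" using Gr_eq_pencil by blast
    then show ?thesis using pencil_in_Jo_iff[OF X(1,2)] iff[OF X(1,2)] pencil_in_Gr_zeros_iff[OF X(1,2) F] by simp
  qed (simp add: restricted_Jo_def Gr_zeros_def)
  then have "restricted_Jo = Gr_zeros (range m)" by blast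
  then show ?thesis unfolding closedin_Gr_zariski Gr_algebraic_def using F by blast
qed

text \<open>A form vanishing on all projections of rank \<open>r\<close> vanishes on the polynomial curve \<open>P\<close> for nonzero parameters,
  hence also at the parameter 0, where \<open>P\<close> passes through \<open>X\<close>.\<close>

lemma square_zero_in_hull:
  fixes X :: "complex^'n^'n"
  assumes X: "X \<in> traceless_symmetric" "X \<noteq> 0" and XX: "X ** X = 0"
  shows "\<exists>r. 0 < r \<and> 2 * r \<le> CARD('n) \<and> X \<in> hull_of_forms (centred r ` orth_proj r)"
proof -
  have "transpose X = X" using X by (simp add: traceless_symmetric_def symmetric_matrices_def)
  from square_zero_is_limit[OF this XX X(2)] obtain r Q Z where r: "0 < r" "2 * r \<le> CARD('n)"
    and E: "\<And>s. s \<noteq> 0 \<Longrightarrow> \<exists>E\<in>orth_proj r. X + cscale s Q + cscale (s * s) Z = cscale (2 * s) E"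
    by blast
  define P where "P b = X + cscale (b ()) (Q - cscale (2 * (of_nat r / of_nat CARD('n))) (mat 1)) + cscale (b () * b ()) Z"
    for b :: "unit \<Rightarrow> complex"
  have P: "poly_mat UNIV P"
    unfolding P_def[abs_def]
    by (intro poly_mat_add poly_mat_const poly_mat_cscale poly_fun_mult poly_fun_var) auto
  have "f X = 0" if f: "hom_poly k f" "\<forall>Y\<in>centred r ` orth_proj r. f Y = 0" for k f
  proof (rule ccontr)
    assume "f X \<noteq> 0"
    then have "f (P (\<lambda>_. 0)) \<noteq> 0" by (simp add: P_def)
    then obtain b where b: "f (P b) \<noteq> 0" "b () \<noteq> 0"
      using poly_fun_common_nonzero[OF poly_fun_form[OF _ P f(1)] poly_fun_var[of UNIV "()"], of "\<lambda>_. 0" "\<lambda>_. 1"]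
      by auto
    obtain E where "E \<in> orth_proj r" "X + cscale (b ()) Q + cscale (b () * b ()) Z = cscale (2 * b ()) E"
      using E[OF b(2)] by blast
    then have "P b = cscale (2 * b ()) (centred r E)" "f (centred r E) = 0"
      using f(2) by (simp_all add: P_def centred_def vec_eq_iff algebra_simps)
    then show False using b(1) by (simp add: hom_poly_scale[OF f(1)])
  qed
  then show ?thesis using r X by (auto simp: hull_of_forms_def)
qed

lemma closure_two_eigenvalue_pencils:
  assumes i: "0 < i" "i < CARD('n::finite)"
  shows "Gr_zariski closure_of (two_eigenvalue_pencils i :: (complex^'n^'n) set set)
    = pencil ` hull_of_forms (centred i ` orth_proj i)"
proof -
  have eq: "(two_eigenvalue_pencils i :: (complex^'n^'n) set set) = pencil ` centred i ` orth_proj i"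
    unfolding two_eigenvalue_pencils_eq[OF i] by (simp only: image_image)
  have sub: "centred i ` orth_proj i \<subseteq> (traceless_symmetric - {0} :: (complex^'n^'n) set)"
    using i by (auto simp: centred_orth_proj)
  show ?thesis unfolding eq by (rule closure_of_pencils[OF sub])
qed

text \<open>The form \<open>trace_form j\<close> vanishes on the second closure. On the first one it does so only if
  \<open>i (n - i) = j (n - j)\<close>.\<close>

lemma two_eigenvalue_closures_incomparable:
  assumes i: "0 < i" "i < CARD('n::finite)" "2 * i \<le> CARD('n)" and j: "0 < j" "j < CARD('n)" "2 * j \<le> CARD('n)"
    and sub: "Gr_zariski closure_of (two_eigenvalue_pencils i :: (complex^'n^'n) set set)
      \<subseteq> Gr_zariski closure_of two_eigenvalue_pencils j"
  shows "i = j"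
proof -
  obtain I :: "'n set" where I: "card I = i" using i by (metis obtain_subset_with_card_n less_imp_le)
  define E :: "complex^'n^'n" where "E = coord_proj I"
  have E: "E \<in> orth_proj i" using coord_proj_orth_proj[of I] I by (simp add: E_def)
  have W: "centred i E \<in> traceless_symmetric" "centred i E \<noteq> 0" using centred_orth_proj[OF E i(1,2)] .
  have "centred i E \<in> hull_of_forms (centred i ` orth_proj i)"
    using W E by (auto simp: hull_of_forms_def)
  then have "pencil (centred i E) \<in> pencil ` hull_of_forms (centred j ` orth_proj j)"
    using sub unfolding closure_two_eigenvalue_pencils[OF i(1,2)] closure_two_eigenvalue_pencils[OF j(1,2)] by blast
  then have "centred i E \<in> affine_cone (pencil ` hull_of_forms (centred j ` orth_proj j))"
    using W by (simp add: affine_cone_def)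
  then have "centred i E \<in> hull_of_forms (centred j ` orth_proj j)" unfolding cone_pencils_hull .
  moreover have "\<forall>Y\<in>centred j ` orth_proj j. trace_form j Y = 0"
    using trace_form_centred[of _ j j] by auto
  ultimately have "trace_form j (centred i E) = 0"
    using hom_poly_trace_form[of j] unfolding hull_of_forms_def by blast
  moreover have "(of_nat i :: complex) \<noteq> of_nat CARD('n)" using i(2) by (simp only: of_nat_eq_iff)
  ultimately have "(of_nat j :: complex) * (of_nat CARD('n) - of_nat j) = of_nat i * (of_nat CARD('n) - of_nat i)"
    using i by (simp add: trace_form_centred[OF E])
  then have "(of_nat j - of_nat i :: complex) * (of_nat CARD('n) - (of_nat i + of_nat j)) = 0"
    by (simp add: algebra_simps)
  then have "(of_nat j :: complex) = of_nat i \<or> (of_nat CARD('n) :: complex) = of_nat (i + j)" by simp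
  then have "j = i \<or> CARD('n) = i + j" by (simp only: of_nat_eq_iff)
  then show ?thesis using i(3) j(3) by linarith
qed

lemma irreducible_two_eigenvalue_closure:
  assumes i: "0 < i" "i < CARD('n::finite)"
  shows "irreducible_in Gr_zariski (Gr_zariski closure_of (two_eigenvalue_pencils i :: (complex^'n^'n) set set))"
proof -
  obtain I :: "'n set" where I: "card I = i" using i by (metis obtain_subset_with_card_n less_imp_le)
  note Ii = i[folded I]
  define u :: "nat \<Rightarrow> complex^'n^'n" where "u = (\<lambda>_. 0)"
  have u: "u k \<in> traceless_symmetric" for k
    using cmat.subspace_0[OF traceless_symmetric_subspace] by (simp add: u_def)
  show ?thesis
    using irreducible_closure_of_pencils[OF swept_cone_traceless[of u, OF u Ii] swept_cone_nonempty[OF Ii] prime_on_swept_cone, of 0]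
    unfolding pencil_swept_cone_0[OF Ii] I .
qed

text \<open>A Jordan pencil is spanned by the identity and either a projection or a square-zero matrix. The latter is
  a limit of projections of its own rank.\<close>

lemma restricted_Jo_eq_union:
  assumes n: "CARD('n::finite) \<ge> 2"
  shows "(restricted_Jo :: (complex^'n^'n) set set)
    = (\<Union>i\<in>{1..CARD('n) div 2}. Gr_zariski closure_of two_eigenvalue_pencils i)"
proof (intro equalityI subsetI)
  fix L :: "(complex^'n^'n) set" assume L: "L \<in> restricted_Jo"
  then have "L \<in> restricted_Gr" by (simp add: restricted_Jo_def)
  then obtain X where X: "X \<in> traceless_symmetric" "X \<noteq> 0" "L = pencil X" using Gr_eq_pencil by blast
  have "\<exists>i. 0 < i \<and> 2 * i \<le> CARD('n) \<and> L \<in> pencil ` hull_of_forms (centred i ` orth_proj i)"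
  proof (cases "X ** X = 0")
    case True
    then show ?thesis using square_zero_in_hull[OF X(1,2)] X(3) by blast
  next
    case False
    then obtain i E where i: "0 < i" "2 * i \<le> CARD('n)" and E: "E \<in> orth_proj i" "pencil X = pencil (centred i E)"
      using Jo_pencil_cases[OF X(1,2)] L X(3) by blast
    have "centred i E \<in> hull_of_forms (centred i ` orth_proj i)"
      using centred_orth_proj[OF E(1)] i E(1) by (auto simp: hull_of_forms_def)
    then show ?thesis using i E(2) X(3) by blast
  qed
  then obtain i where i: "0 < i" "2 * i \<le> CARD('n)" "L \<in> pencil ` hull_of_forms (centred i ` orth_proj i)" by blast
  then have "i < CARD('n)" "i \<in> {1..CARD('n) div 2}" by auto
  then show "L \<in> (\<Union>i\<in>{1..CARD('n) div 2}. Gr_zariski closure_of two_eigenvalue_pencils i)"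
    using i closure_two_eigenvalue_pencils[OF i(1), where 'n = 'n] by blast
next
  fix L :: "(complex^'n^'n) set"
  assume "L \<in> (\<Union>i\<in>{1..CARD('n) div 2}. Gr_zariski closure_of two_eigenvalue_pencils i)"
  then obtain i where i: "i \<in> {1..CARD('n) div 2}" "L \<in> Gr_zariski closure_of two_eigenvalue_pencils i" by blast
  then have i': "0 < i" "i < CARD('n)" using n by auto
  have "two_eigenvalue_pencils i \<subseteq> (restricted_Jo :: (complex^'n^'n) set set)"
    unfolding two_eigenvalue_pencils_eq[OF i'] using centred_pencil_Jo[OF _ i'] by blast
  then have "Gr_zariski closure_of two_eigenvalue_pencils i \<subseteq> (restricted_Jo :: (complex^'n^'n) set set)"
    by (rule closure_of_minimal[OF _ closedin_restricted_Jo])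
  then show "L \<in> restricted_Jo" using i(2) by blast
qed

theorem proposition3p1:
  assumes "CARD('n::finite) \<ge> 2"
  shows
    "bij_betw (\<lambda>L. L \<inter> traceless_symmetric)
       (restricted_Gr :: (complex^'n^'n) set set) (projective_space traceless_symmetric) \<and>
     cmat.dim (traceless_symmetric :: (complex^'n^'n) set) = ((CARD('n) + 1) choose 2) - 1 \<and>
     closedin Gr_zariski (restricted_Jo :: (complex^'n^'n) set set) \<and>
     (\<exists>V :: nat \<Rightarrow> (complex^'n^'n) set set.
        irreducible_components Gr_zariski restricted_Jo = V ` {1..CARD('n) div 2} \<and>
        card (irreducible_components Gr_zariski (restricted_Jo :: (complex^'n^'n) set set))
          = CARD('n) div 2 \<and>
        (\<forall>i \<in> {1..CARD('n) div 2}.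
           codim_in Gr_zariski (V i)
             = enat (((i + 1) choose 2) + ((CARD('n) - i + 1) choose 2) - 2) \<and>
           V i = Gr_zariski closure_of two_eigenvalue_pencils i \<and>
           (\<forall>L \<in> (two_eigenvalue_pencils i :: (complex^'n^'n) set set). L \<in> restricted_Jo \<and> jordan_iso_CC L)))"
proof -
  let ?K = "{1..CARD('n) div 2}"
  define V :: "nat \<Rightarrow> (complex^'n^'n) set set" where "V i = Gr_zariski closure_of two_eigenvalue_pencils i" for i
  have K: "0 < i" "i < CARD('n)" "2 * i \<le> CARD('n)" if "i \<in> ?K" for i using that assms by auto
  have incomparable: "i = j" if "i \<in> ?K" "j \<in> ?K" "V i \<subseteq> V j" for i j
    using two_eigenvalue_closures_incomparable[OF K(1-3)[OF that(1)] K(1-3)[OF that(2)]] that(3) by (simp add: V_def)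
  have comp: "irreducible_components Gr_zariski restricted_Jo = V ` ?K"
    unfolding restricted_Jo_eq_union[OF assms] V_def[symmetric]
  proof (rule irreducible_components_of_union[OF _ _ _ incomparable])
    show "closedin Gr_zariski (V i)" for i by (simp add: V_def)
    show "irreducible_in Gr_zariski (V i)" if "i \<in> ?K" for i
      unfolding V_def by (rule irreducible_two_eigenvalue_closure[OF K(1,2)[OF that]])
  qed simp_all
  have "inj_on V ?K" using incomparable by (intro inj_onI) simp
  then have card: "card (V ` ?K) = CARD('n) div 2" by (simp add: card_image)
  have pencils: "L \<in> restricted_Jo \<and> jordan_iso_CC L"
    if "i \<in> ?K" "L \<in> (two_eigenvalue_pencils i :: (complex^'n^'n) set set)" for i L
    using that(2) centred_pencil_Jo[OF _ K(1,2)[OF that(1)]] centred_pencil_iso[OF _ K(1,2)[OF that(1)]]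
    unfolding two_eigenvalue_pencils_eq[OF K(1,2)[OF that(1)]] by blast
  have "\<forall>i \<in> ?K. codim_in Gr_zariski (V i) = enat (((i + 1) choose 2) + ((CARD('n) - i + 1) choose 2) - 2) \<and>
           V i = Gr_zariski closure_of two_eigenvalue_pencils i \<and>
           (\<forall>L \<in> (two_eigenvalue_pencils i :: (complex^'n^'n) set set). L \<in> restricted_Jo \<and> jordan_iso_CC L)"
    using codim_two_eigenvalue_closure[OF assms K(1,2)] pencils by (simp add: V_def)
  then show ?thesis
    by (intro conjI exI[of _ V]) (simp_all only: restricted_Gr_bij dim_traceless_symmetric closedin_restricted_Jo comp card)
qed

end
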